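(* Fix $\rho_0\in(0,1)$ and consider the first inverse problem for $\rho\in[\rho_0,1)$. Let $\varphi\in H$ and $\sigma>0$ be given, and let $\lambda_1$ be the first eigenvalue of the operator $A$. Then there is a number $T_0=T_0(\lambda_1,\rho_0)$ such that for all $t_0\ge T_0$ there exists a unique solution $\{u(t),\rho\}$ of the first inverse problem $$D_t^\rho u(t)+A^\sigma u(t)=0\ \ (0<t\le T),\qquad u(0)=\varphi,\qquad |(u(t_0),v_1)|=d_0,$$ if and only if $$e^{-\lambda_1^\sigma t_0}\le\frac{d_0}{|\varphi_1|}<E_{\rho_0}(-t_0^{\rho_0}),$$ where $\varphi_1=(\varphi,v_1)$.
   Context: $H$ is a separable Hilbert space with scalar product $(\cdot,\cdot)$ and norm $\|\cdot\|$. $A$ is a self-adjoint operator in $H$ with domain $D(A)$, satisfying $(Ah,h)\ge C(h,h)$ for all $h\in D(A)$ with some constant $C>0$. It has a complete orthonormal system of eigenfunctions $v_k$, $k\ge1$, in $H$ and a countable set of ordered eigenvalues $0<\lambda_1\le\lambda_2\le\dots\to+\infty$ without finite limit points. For a real number $\sigma$, $A^\sigma g=\sum_{k=1}^\infty\lambda_k^\sigma g_kv_k$, where $g_k=(g,v_k)$, with domain $D(A^\sigma)=\{g\in H:\sum_{k=1}^\infty\lambda_k^{2\sigma}|g_k|^2<\infty\}$. For $0<\rho<1$ the Caputo fractional derivative of a function $h$ with values in $H$ is $$D_t^\rho h(t)=\frac{1}{\Gamma(1-\rho)}\frac{d}{dt}\int_0^t\frac{h(\xi)-h(0)}{(t-\xi)^\rho}\,d\xi,\quad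 t>0,$$ provided the right-hand side exists, where $\Gamma$ is Euler's gamma function. The Mittag-Leffler function is $E_\rho(z)=\sum_{k=0}^\infty\frac{z^k}{\Gamma(\rho k+1)}$. The forward problem is $D_t^\rho u(t)+A^\sigma u(t)=0$ for $0<t\le T$, $u(0)=\varphi$, with $\varphi\in H$, $\rho\in(0,1)$, $\sigma>0$. Its solution is a function $u\in C([0,T];H)$ with $D_t^\rho u,\ A^\sigma u\in C((0,T];H)$ satisfying these two conditions. In the first inverse problem $\sigma$ is known and $\rho$ is unknown, and the additional condition is $|(u(t_0),v_1)|=d_0$ with $d_0$ a given number, where $v_1$ is the eigenfunction corresponding to $\lambda_1$. A solution of the first inverse problem is a pair $\{u(t),\rho\}$ consisting of a parameter $\rho\in(0,1)$ (here sought in $[\rho_0,1)$) and a function $u(t)$ that solves the forward problem for this $\rho$ and satisfies the additional condition.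
   Formalization: The printed condition is false at both ends and drops a factor; what is proved is e^{-λ_1^σ t_0} < d_0/|φ_1| ≤ E_{ρ_0}(-λ_1^σ t_0^{ρ_0}): strict lower bound (ρ=1 is excluded), non-strict upper bound (ρ=ρ_0 is allowed), and λ_1^σ inserted in the Mittag-Leffler argument. *)

theory Defs
  imports "HOL-Analysis.Analysis"
begin

text \<open>
  The scalar field of a Hilbert space: the real or the complex numbers. The axioms force
  \<open>conjg\<close> to be the identity on the reals and complex conjugation on the complex numbers; by
  Gelfand-Mazur there are no other instances.
\<close>

class real_or_complex = real_normed_field + euclidean_space +
  fixes conjg :: "'a \<Rightarrow> 'a"
  assumes conjg_add: "conjg (a + b) = conjg a + conjg b"
    and conjg_mult: "conjg (a * b) = conjg a * conjg b"
    and conjg_conjg: "conjg (conjg a) = a"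
    and conjg_scaleR_one: "conjg (r *\<^sub>R 1) = r *\<^sub>R 1"
    and mult_conjg: "a * conjg a = (norm a)\<^sup>2 *\<^sub>R 1"

instantiation real :: real_or_complex
begin
definition conjg_real :: "real \<Rightarrow> real" where "conjg_real x = x"
instance by standard (auto simp: conjg_real_def power2_eq_square)
end

instantiation complex :: real_or_complex
begin
definition conjg_complex :: "complex \<Rightarrow> complex" where "conjg_complex z = cnj z"
instance
  by standard (auto simp: conjg_complex_def scaleR_conv_of_real complex_norm_square
      simp flip: of_real_power)
end

text \<open>
  A Hilbert space over \<open>'k\<close>: completeness and the real structure come from the class
  \<open>banach\<close>, and \<open>ip\<close> is a scalar product, linear in its first argument, that induces the norm.
  Separability is the class \<open>second_countable_topology\<close>.
\<close>

locale hilbert_space = vector_space smul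
  for smul :: "'k::real_or_complex \<Rightarrow> 'a::banach \<Rightarrow> 'a" +
  fixes ip :: "'a \<Rightarrow> 'a \<Rightarrow> 'k"
  assumes smul_of_real: "smul (of_real r) x = r *\<^sub>R x"
    and ip_add_left: "ip (x + y) z = ip x z + ip y z"
    and ip_smul_left: "ip (smul c x) y = c * ip x y"
    and ip_conjg: "ip y x = conjg (ip x y)"
    and ip_self: "ip x x = of_real ((norm x)\<^sup>2)"

text \<open>
  Unbounded operators are given by a domain \<open>D\<close> and a function \<open>A\<close> whose values outside \<open>D\<close>
  are irrelevant.
\<close>

definition linear_operator_on ::
  "('k::real_or_complex \<Rightarrow> 'a::banach \<Rightarrow> 'a) \<Rightarrow> 'a set \<Rightarrow> ('a \<Rightarrow> 'a) \<Rightarrow> bool" where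
  "linear_operator_on smul D A \<longleftrightarrow>
     0 \<in> D \<and>
     (\<forall>x\<in>D. \<forall>y\<in>D. x + y \<in> D \<and> A (x + y) = A x + A y) \<and>
     (\<forall>c. \<forall>x\<in>D. smul c x \<in> D \<and> A (smul c x) = smul c (A x))"

definition adjoint_graph ::
  "('a::banach \<Rightarrow> 'a \<Rightarrow> 'k::real_or_complex) \<Rightarrow> 'a set \<Rightarrow> ('a \<Rightarrow> 'a) \<Rightarrow> ('a \<times> 'a) set" where
  "adjoint_graph ip D A = {(y, z). \<forall>x\<in>D. ip (A x) y = ip x z}"

definition self_adjoint_operator ::
  "('k::real_or_complex \<Rightarrow> 'a::banach \<Rightarrow> 'a) \<Rightarrow> ('a \<Rightarrow> 'a \<Rightarrow> 'k) \<Rightarrow> 'a set \<Rightarrow> ('a \<Rightarrow> 'a) \<Rightarrow> bool" where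
  "self_adjoint_operator smul ip D A \<longleftrightarrow>
     linear_operator_on smul D A \<and> closure D = UNIV \<and>
     adjoint_graph ip D A = {(y, A y) | y. y \<in> D}"

definition complete_orthonormal_system ::
  "('a::banach \<Rightarrow> 'a \<Rightarrow> 'k::real_or_complex) \<Rightarrow> (nat \<Rightarrow> 'a) \<Rightarrow> bool" where
  "complete_orthonormal_system ip v \<longleftrightarrow>
     (\<forall>j k. ip (v j) (v k) = (if j = k then 1 else 0)) \<and>
     (\<forall>x. (\<forall>k. ip x (v k) = 0) \<longrightarrow> x = 0)"

text \<open>
  Eigenpairs are numbered from \<open>0\<close>: the pair written $(\lambda_{k+1}, v_{k+1})$ in mathematical
  notation is \<open>(lam k, v k)\<close>. The lower bound $(Ah,h) \ge C(h,h)$ presupposes that $(Ah,h)$ is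
  real, hence the witness \<open>r\<close>.
\<close>

definition operator_setting ::
  "('k::real_or_complex \<Rightarrow> 'a::banach \<Rightarrow> 'a) \<Rightarrow> ('a \<Rightarrow> 'a \<Rightarrow> 'k) \<Rightarrow> 'a set \<Rightarrow> ('a \<Rightarrow> 'a) \<Rightarrow>
    (nat \<Rightarrow> 'a) \<Rightarrow> (nat \<Rightarrow> real) \<Rightarrow> bool" where
  "operator_setting smul ip D A v lam \<longleftrightarrow>
     hilbert_space smul ip \<and>
     self_adjoint_operator smul ip D A \<and>
     (\<exists>C>0. \<forall>h\<in>D. \<exists>r. ip (A h) h = of_real r \<and> C * (norm h)\<^sup>2 \<le> r) \<and>
     complete_orthonormal_system ip v \<and>
     (\<forall>k. v k \<in> D \<and> A (v k) = smul (of_real (lam k)) (v k)) \<and>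
     0 < lam 0 \<and> mono lam \<and> filterlim lam at_top sequentially"

definition pow_domain ::
  "('a::banach \<Rightarrow> 'a \<Rightarrow> 'k::real_or_complex) \<Rightarrow> (nat \<Rightarrow> 'a) \<Rightarrow> (nat \<Rightarrow> real) \<Rightarrow> real \<Rightarrow> 'a set" where
  "pow_domain ip v lam \<sigma> = {g. summable (\<lambda>k. lam k powr (2 * \<sigma>) * (norm (ip g (v k)))\<^sup>2)}"

definition pow_operator ::
  "('k::real_or_complex \<Rightarrow> 'a::banach \<Rightarrow> 'a) \<Rightarrow> ('a \<Rightarrow> 'a \<Rightarrow> 'k) \<Rightarrow>
    (nat \<Rightarrow> 'a) \<Rightarrow> (nat \<Rightarrow> real) \<Rightarrow> real \<Rightarrow> 'a \<Rightarrow> 'a" where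
  "pow_operator smul ip v lam \<sigma> g =
     (\<Sum>k. smul (of_real (lam k powr \<sigma>) * ip g (v k)) (v k))"

definition mittag_leffler :: "real \<Rightarrow> real \<Rightarrow> real" where
  "mittag_leffler \<rho> z = (\<Sum>k. z ^ k / Gamma (\<rho> * real k + 1))"

definition caputo_integrand ::
  "real \<Rightarrow> (real \<Rightarrow> 'a::{banach,second_countable_topology}) \<Rightarrow> real \<Rightarrow> real \<Rightarrow> 'a" where
  "caputo_integrand \<rho> h t \<xi> = (1 / (t - \<xi>) powr \<rho>) *\<^sub>R (h \<xi> - h 0)"

definition caputo_integral ::
  "real \<Rightarrow> (real \<Rightarrow> 'a::{banach,second_countable_topology}) \<Rightarrow> real \<Rightarrow> 'a" where
  "caputo_integral \<rho> h t = (LINT \<xi>:{0..t}|lborel. caputo_integrand \<rho> h t \<xi>)"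

text \<open>
  The Caputo derivative of a function given on \<open>{0..T}\<close> only, whence the derivative
  \<open>within {0<..T}\<close>: it is the ordinary one for \<open>t < T\<close> and the left one for \<open>t = T\<close>.
  \<open>caputo_exists\<close> says that the right-hand side of the definition exists at \<open>t\<close>.
\<close>

definition caputo_exists ::
  "real \<Rightarrow> real \<Rightarrow> (real \<Rightarrow> 'a::{banach,second_countable_topology}) \<Rightarrow> real \<Rightarrow> bool" where
  "caputo_exists T \<rho> h t \<longleftrightarrow>
     (\<forall>s\<in>{0<..T}. set_integrable lborel {0..s} (caputo_integrand \<rho> h s)) \<and>
     (\<exists>d. (caputo_integral \<rho> h has_vector_derivative d) (at t within {0<..T}))"

definition caputo_derivative ::
  "real \<Rightarrow> real \<Rightarrow> (real \<Rightarrow> 'a::{banach,second_countable_topology}) \<Rightarrow> real \<Rightarrow> 'a" where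
  "caputo_derivative T \<rho> h t =
     (1 / Gamma (1 - \<rho>)) *\<^sub>R vector_derivative (caputo_integral \<rho> h) (at t within {0<..T})"

definition forward_solution ::
  "('k::real_or_complex \<Rightarrow> 'a::{banach,second_countable_topology} \<Rightarrow> 'a) \<Rightarrow> ('a \<Rightarrow> 'a \<Rightarrow> 'k) \<Rightarrow>
    (nat \<Rightarrow> 'a) \<Rightarrow> (nat \<Rightarrow> real) \<Rightarrow> real \<Rightarrow> real \<Rightarrow> real \<Rightarrow> 'a \<Rightarrow> (real \<Rightarrow> 'a) \<Rightarrow> bool" where
  "forward_solution smul ip v lam \<sigma> T \<rho> \<phi> u \<longleftrightarrow>
     continuous_on {0..T} u \<and>
     (\<forall>t\<in>{0<..T}. caputo_exists T \<rho> u t) \<and>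
     continuous_on {0<..T} (caputo_derivative T \<rho> u) \<and>
     (\<forall>t\<in>{0<..T}. u t \<in> pow_domain ip v lam \<sigma>) \<and>
     continuous_on {0<..T} (\<lambda>t. pow_operator smul ip v lam \<sigma> (u t)) \<and>
     (\<forall>t\<in>{0<..T}. caputo_derivative T \<rho> u t + pow_operator smul ip v lam \<sigma> (u t) = 0) \<and>
     u 0 = \<phi>"

text \<open>
  Functions on \<open>{0..T}\<close> are represented by their extensional representatives, so that counting
  solutions does not depend on irrelevant values outside \<open>{0..T}\<close>. The range of \<open>\<rho>\<close> includes
  \<open>\<rho>0\<close> and excludes \<open>1\<close>. For a solution with $(\varphi,v_1)\neq0$, the quotient
  $|(u(t_0),v_1)|/|(\varphi,v_1)|$ is $E_\rho(-\lambda_1^\sigma t_0^\rho)$; so the value for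
  \<open>\<rho>0\<close> is attained, while $e^{-\lambda_1^\sigma t_0}$ is only the limit for $\rho\to1$.
\<close>

definition first_inverse_solutions ::
  "('k::real_or_complex \<Rightarrow> 'a::{banach,second_countable_topology} \<Rightarrow> 'a) \<Rightarrow> ('a \<Rightarrow> 'a \<Rightarrow> 'k) \<Rightarrow>
    (nat \<Rightarrow> 'a) \<Rightarrow> (nat \<Rightarrow> real) \<Rightarrow> real \<Rightarrow> real \<Rightarrow> real \<Rightarrow> 'a \<Rightarrow> real \<Rightarrow> real \<Rightarrow>
    ((real \<Rightarrow> 'a) \<times> real) set" where
  "first_inverse_solutions smul ip v lam \<sigma> \<rho>0 T \<phi> t0 d0 =
     {(u, \<rho>). \<rho>0 \<le> \<rho> \<and> \<rho> < 1 \<and> u \<in> extensional {0..T} \<and>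
              forward_solution smul ip v lam \<sigma> T \<rho> \<phi> u \<and> norm (ip (u t0) (v 0)) = d0}"

end

theory Submission
  imports Defs "HOL-Complex_Analysis.Complex_Analysis" "HOL-Real_Asymp.Real_Asymp"
begin

text \<open>
  Expanding in the eigenfunctions turns the forward problem into the scalar equations
  $D_t^\rho y = -\mu_k y$ with $\mu_k = \lambda_k^\sigma$. An Abel integral equation shows that their only
  solutions are $y(0)\, E_\rho(-\mu_k t^\rho)$, and $\mu_k E_\rho(-\mu_k t^\rho) = O(t^{-\rho})$ makes the
  resulting series a solution. The inverse problem thus reduces to the equation
  $E_\rho(-l t_0^\rho) = d_0 / |\varphi_1|$ with $l = \lambda_1^\sigma$, and the point is that its left-hand
  side is strictly decreasing in $\rho$, for every $t_0 > 2$ and uniformly in $l > 0$.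

  This monotonicity follows from subordination. A contour integral and the
  uniqueness of Laplace transforms give $E_\alpha(-l t^\alpha) = \int e^{-rt}\, dK(r)$ with a probability
  measure $K$, and then $E_{\alpha\beta}(-l t^{\alpha\beta}) = \int E_\beta(-r t^\beta)\, dK(r)$. Because
  $E_\beta(-x) \ge e^{-x/\Gamma(1+\beta)}$, the latter is at least $E_\alpha(-l c^\alpha)$ with
  $c = t^\beta / \Gamma(1+\beta)$. By log-convexity $\Gamma(1+\beta) \ge 2^{\beta-1}$, so $c < t$ for
  $t > 2$. As $\rho \to 1$ the function tends to $e^{-l t_0}$, and the intermediate value theorem
  gives existence.
\<close>

section \<open>Mittag-Leffler functions\<close>

text \<open>The threshold \<open>T0\<close> is fixed before \<sigma>. For \<open>lam1 < 1\<close>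
  the parameter \<open>l = lam1 powr \<sigma>\<close> therefore comes arbitrarily close to 0, and
  asymptotics for large \<open>l * t powr \<rho>\<close> cannot settle monotonicity in the order.
  Some lower bound on t is unavoidable: for small \<open>l\<close> the function is
  \<open>1 - l * t powr \<rho> / Gamma (1 + \<rho>)\<close> to first order, and at t = 1 this
  increases in \<rho> near \<rho> = 1. The derivative in the order is an alternating series without
  a visible sign. Subordination avoids it: two orders become averages over the same measure, and
  only their kernels have to be compared. The exponential bound is Jensen's inequality in disguise.
  As a function of r, \<open>mittag_leffler \<beta> (- r * t powr \<beta>)\<close> is the Laplace
  transform of the law of an inverse stable subordinator at time t, whose mean is
  \<open>t powr \<beta> / Gamma (1 + \<beta>)\<close>. Here the bound is obtained from a
  differential inequality, without constructing that law.\<close>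

lemma set_integral_of_has_integral_nonneg:
  fixes f :: "real \<Rightarrow> real"
  assumes [measurable]: "f \<in> borel_measurable borel" "S \<in> sets borel"
    and nn: "\<And>x. x \<in> S \<Longrightarrow> 0 \<le> f x" and hi: "(f has_integral I) S"
  shows "set_integrable lborel S f" "(LINT x:S|lborel. f x) = I"
proof -
  have "integral\<^sup>N lborel (\<lambda>x. ennreal (indicator S x * f x)) = I"
    using nn_integral_has_integral_lebesgue[OF nn hi] by simp
  moreover have "0 \<le> I" using has_integral_nonneg[OF hi] nn by auto
  ultimately have "has_bochner_integral lborel (\<lambda>x. indicator S x * f x) I"
    by (intro has_bochner_integral_nn_integral) (auto simp: indicator_def nn)
  then show "set_integrable lborel S f" "(LINT x:S|lborel. f x) = I"
    by (auto simp: set_integrable_def set_lebesgue_integral_def has_bochner_integral_iff)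
qed

text \<open>Only the part \<open>t \<ge> R\<close> of Euler's integral is kept, and there
  \<open>t powr a \<ge> R powr a\<close>. Since \<open>R\<close> is free, this makes the
  Mittag-Leffler terms decay geometrically, uniformly in the order.\<close>

lemma Gamma_plus1_ge:
  fixes a R :: real assumes "0 \<le> a" "0 < R"
  shows "R powr a * exp (-R) \<le> Gamma (a+1)"
proof -
  have "((\<lambda>t::real. -(R powr a * exp (-t))) \<longlongrightarrow> 0) at_top"
    by real_asymp
  then have "(\<integral>\<^sup>+t. ennreal (R powr a * exp (-t)) * indicator {R..} t \<partial>lborel) = 0 - (-(R powr a * exp (-R)))"
    by (intro nn_integral_FTC_atLeast) (auto intro!: derivative_eq_intros)
  then have "ennreal (R powr a * exp (-R)) = (\<integral>\<^sup>+t. ennreal (R powr a * exp (-t)) * indicator {R..} t \<partial>lborel)"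
    by simp
  also have "\<dots> \<le> (\<integral>\<^sup>+t. ennreal (indicator {0..} t * t powr ((a+1) - 1) / exp t) \<partial>lborel)"
    using assms by (intro nn_integral_mono)
      (auto simp: indicator_def exp_minus divide_inverse intro!: ennreal_leI mult_right_mono powr_mono2)
  also have "\<dots> = Gamma (a+1)"
    using Gamma_conv_nn_integral_real[of "a+1"] assms by simp
  finally show ?thesis using assms by (simp add: Gamma_real_pos less_imp_le)
qed

text \<open>Scaling by t reduces this to the Beta integral on the unit interval. It is the
  fractional integral of a power, from which the closed forms for Mittag-Leffler functions follow
  term by term.\<close>

lemma Beta_convolution:
  fixes a b t :: real
  assumes "0 < a" "0 < b" "0 < t"
  shows "set_integrable lborel {0..t} (\<lambda>x. (t - x) powr (a - 1) * x powr (b - 1))"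
    and "(LINT x:{0..t}|lborel. (t - x) powr (a - 1) * x powr (b - 1)) = Beta a b * t powr (a + b - 1)"
proof -
  have "((\<lambda>x. ((1/t) *\<^sub>R x + 0) powr (b - 1) * (1 - ((1/t) *\<^sub>R x + 0)) powr (a - 1)) has_integral
     (1 / \<bar>1/t\<bar>^DIM(real)) *\<^sub>R Beta b a) ((\<lambda>x. (1/(1/t)) *\<^sub>R x + - ((1/(1/t)) *\<^sub>R 0)) ` cbox 0 1)"
    using has_integral_Beta_real[of b a] assms by (intro has_integral_affinity) auto
  moreover have "((\<lambda>x. (1/(1/t)) *\<^sub>R x + - ((1/(1/t)) *\<^sub>R 0)) ` cbox 0 1) = {0..t}"
    using assms by (auto simp: image_iff intro!: bexI[where x="x / t" for x] mult_left_le)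
  ultimately have "((\<lambda>x. (x/t) powr (b - 1) * (1 - x/t) powr (a - 1)) has_integral (t * Beta a b)) {0..t}"
    using assms by (simp add: Beta_commute)
  then have "((\<lambda>x. t powr (a+b-2) * ((x/t) powr (b - 1) * (1 - x/t) powr (a - 1))) has_integral
      (t powr (a+b-2) * (t * Beta a b))) {0..t}"
    by (rule has_integral_mult_right)
  moreover have "t powr (a+b-2) * (t * Beta a b) = Beta a b * t powr (a + b - 1)"
    using assms by (simp add: powr_diff powr_add power2_eq_square field_simps)
  moreover have "t powr (a+b-2) * ((x/t) powr (b - 1) * (1 - x/t) powr (a - 1)) = (t - x) powr (a - 1) * x powr (b - 1)"
    if "x \<in> {0..t}" for x
  proof -
    have "1 - x/t = (t-x)/t" using assms by (simp add: field_simps)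
    moreover have "t powr (a+b-2) = t powr (a-1) * t powr (b-1)" by (simp add: powr_add[symmetric])
    ultimately show ?thesis using that assms by (simp add: powr_divide)
  qed
  ultimately have hi: "((\<lambda>x. (t - x) powr (a - 1) * x powr (b - 1)) has_integral (Beta a b * t powr (a + b - 1))) {0..t}"
    by (metis (no_types, lifting) has_integral_eq)
  show "set_integrable lborel {0..t} (\<lambda>x. (t - x) powr (a - 1) * x powr (b - 1))"
    by (rule set_integral_of_has_integral_nonneg(1)[OF _ _ _ hi]) auto
  show "(LINT x:{0..t}|lborel. (t - x) powr (a - 1) * x powr (b - 1)) = Beta a b * t powr (a + b - 1)"
    by (rule set_integral_of_has_integral_nonneg(2)[OF _ _ _ hi]) auto
qed

lemma power_kernel_integral:
  fixes a t :: real
  assumes "0 < a" "0 \<le> t"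
  shows "set_integrable lborel {0..t} (\<lambda>x. (t - x) powr (a - 1))"
    and "(LINT x:{0..t}|lborel. (t - x) powr (a - 1)) = t powr a / a"
proof -
  have *: "set_integrable lborel {0..t} (\<lambda>x. (t - x) powr (a - 1)) \<and> (LINT x:{0..t}|lborel. (t - x) powr (a - 1)) = t powr a / a"
  proof (cases "t = 0")
    case True
    have "AE x in lborel. x \<noteq> (0::real)" by (rule AE_lborel_singleton)
    then have "AE x in lborel. indicator {0..0} x *\<^sub>R (0 - x) powr (a - 1) = (0::real)"
      by eventually_elim (auto simp: indicator_def)
    then show ?thesis using True assms
      unfolding set_integrable_def set_lebesgue_integral_def
      by (simp add: integrable_cong_AE[where g="\<lambda>_. 0"] integral_cong_AE[where g="\<lambda>_. 0"])
  next
    case False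
    with assms have t: "0 < t" by simp
    have b: "Beta a 1 = 1 / a" using assms Gamma_plus1[of a]
      by (simp add: Beta_def Gamma_eq_zero_iff nonpos_Ints_def)
    \<comment> \<open>\<open>x powr (1 - 1)\<close> is 1 except at \<open>x = 0\<close>, where
      \<open>0 powr 0 = 0\<close>; the two integrands agree only almost everywhere.\<close>
    have eq: "indicator {0..t} x *\<^sub>R ((t - x) powr (a - 1) * x powr (1 - 1)) =
       indicator {0..t} x *\<^sub>R ((t - x) powr (a - 1))" if "x \<noteq> 0" for x :: real
      using that by auto
    have ae: "AE x in lborel. indicator {0..t} x *\<^sub>R ((t - x) powr (a - 1) * x powr (1 - 1)) =
       indicator {0..t} x *\<^sub>R ((t - x) powr (a - 1))"
      using AE_lborel_singleton[of "0::real"] by eventually_elim (rule eq)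
    show ?thesis
      using Beta_convolution[OF assms(1) zero_less_one t] b
        integrable_cong_AE[OF _ _ ae] integral_cong_AE[OF _ _ ae]
      unfolding set_integrable_def set_lebesgue_integral_def by simp
  qed
  from * show "set_integrable lborel {0..t} (\<lambda>x. (t - x) powr (a - 1))"
    and "(LINT x:{0..t}|lborel. (t - x) powr (a - 1)) = t powr a / a" by auto
qed

text \<open>The two-parameter Mittag-Leffler function. Fractional integration of order a moves its
  second parameter from 1 to \<open>1 + a\<close>.\<close>

definition mittag_leffler2 :: "real \<Rightarrow> real \<Rightarrow> real \<Rightarrow> real" where
  "mittag_leffler2 \<rho> b z = (\<Sum>k. z ^ k / Gamma (\<rho> * real k + b))"

lemma mittag_leffler2_1: "mittag_leffler2 \<rho> 1 z = mittag_leffler \<rho> z"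
  by (simp add: mittag_leffler_def mittag_leffler2_def)

text \<open>\<open>R\<close> is so large that \<open>R powr \<rho>\<close> is at least twice the
  modulus of z, which by \<open>Gamma_plus1_ge\<close> leaves a factor 1/2 for each k. The bound
  involves neither \<rho> nor b nor z, so it serves the Weierstrass test in the argument as well as
  the one in the order.\<close>

lemma mittag_leffler_term_bound:
  fixes r \<rho> b z R X :: real
  assumes "0 < r" "r \<le> \<rho>" "1 \<le> b" "1 \<le> R" "\<bar>z\<bar> \<le> X" "2 * X \<le> R powr r"
  shows "\<bar>z ^ k / Gamma (\<rho> * real k + b)\<bar> \<le> exp R * (1/2) ^ k"
proof -
  have nn: "0 \<le> \<rho> * real k" using assms by simp
  have "R powr (\<rho> * real k) * exp (-R) \<le> R powr (\<rho> * real k + (b-1)) * exp (-R)"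
    using assms by (intro mult_right_mono powr_mono) auto
  also have "\<dots> \<le> Gamma (\<rho> * real k + b)"
    using Gamma_plus1_ge[of "\<rho> * real k + (b-1)" R] nn assms by simp
  finally have G: "R powr (\<rho> * real k) * exp (-R) \<le> Gamma (\<rho> * real k + b)" .
  have pos: "0 < R powr (\<rho> * real k) * exp (-R)" using assms by simp
  have "R powr r \<le> R powr \<rho>" using assms by (intro powr_mono) auto
  then have "2 * \<bar>z\<bar> \<le> R powr \<rho>" using assms by simp
  then have "(2 * \<bar>z\<bar>) ^ k \<le> (R powr \<rho>) ^ k" by (intro power_mono) auto
  also have "\<dots> = R powr (\<rho> * real k)" using assms by (simp add: powr_realpow[symmetric] powr_powr)
  finally have z: "2 ^ k * \<bar>z\<bar> ^ k \<le> R powr (\<rho> * real k)" by (simp add: power_mult_distrib)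
  have "\<bar>z ^ k / Gamma (\<rho> * real k + b)\<bar> = \<bar>z\<bar> ^ k / Gamma (\<rho> * real k + b)"
    using G pos by (simp add: power_abs abs_mult)
  also have "\<dots> \<le> \<bar>z\<bar> ^ k / (R powr (\<rho> * real k) * exp (-R))"
    using G pos by (intro divide_left_mono) auto
  also have "\<dots> \<le> (R powr (\<rho> * real k) / 2 ^ k) / (R powr (\<rho> * real k) * exp (-R))"
    using z pos by (intro divide_right_mono) (auto simp: field_simps)
  also have "\<dots> = exp R * (1/2) ^ k" using assms by (simp add: exp_minus field_simps power_divide)
  finally show ?thesis .
qed

lemma powr_unbounded: "0 < r \<Longrightarrow> \<exists>R\<ge>1. X \<le> R powr (r::real)"
proof (intro exI conjI)
  assume r: "0 < r"
  show "1 \<le> max 1 X powr (1/r)" using r by (auto intro: ge_one_powr_ge_zero)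
  have "X \<le> max 1 X" by simp
  also have "\<dots> = (max 1 X powr (1/r)) powr r" using r by (simp add: powr_powr)
  finally show "X \<le> (max 1 X powr (1/r)) powr r" .
qed

lemma mittag_leffler2_abs_summable:
  assumes "0 < \<rho>" "1 \<le> b"
  shows "summable (\<lambda>k. \<bar>z ^ k / Gamma (\<rho> * real k + b)\<bar>)"
proof -
  obtain R where R: "R \<ge> 1" "2 * \<bar>z\<bar> \<le> R powr \<rho>" using powr_unbounded[OF assms(1)] by blast
  have "norm \<bar>z ^ k / Gamma (\<rho> * real k + b)\<bar> \<le> exp R * (1/2) ^ k" for k
    using mittag_leffler_term_bound[OF assms(1) order_refl assms(2) R(1) order_refl R(2), of k] by (simp only: real_norm_def abs_abs)
  moreover have "summable (\<lambda>k. exp R * (1/2) ^ k)"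
    by (rule summable_mult[OF summable_geometric]) simp
  ultimately show ?thesis
    by (rule summable_comparison_test'[where N=0 and g="\<lambda>k. exp R * (1/2) ^ k", rotated])
qed

lemma mittag_leffler2_summable:
  assumes "0 < \<rho>" "1 \<le> b"
  shows "summable (\<lambda>k. z ^ k / Gamma (\<rho> * real k + b))"
  using mittag_leffler2_abs_summable[OF assms] by (rule summable_rabs_cancel)

text \<open>Splitting off the term \<open>k = 0\<close> and shifting the index. Combined with the
  convolution formulas, this recurrence is the fractional differential equation in integrated
  form.\<close>

lemma mittag_leffler2_rec:
  assumes "0 < \<rho>" "1 \<le> b"
  shows "mittag_leffler2 \<rho> b z = 1 / Gamma b + z * mittag_leffler2 \<rho> (\<rho> + b) z"
proof -
  have "mittag_leffler2 \<rho> b z = z ^ 0 / Gamma (\<rho> * real 0 + b) + (\<Sum>k. z ^ Suc k / Gamma (\<rho> * real (Suc k) + b))"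
    unfolding mittag_leffler2_def using suminf_split_head[OF mittag_leffler2_summable[OF assms]] by simp
  also have "(\<Sum>k. z ^ Suc k / Gamma (\<rho> * real (Suc k) + b)) = (\<Sum>k. z * (z ^ k / Gamma (\<rho> * real k + (\<rho> + b))))"
    by (simp add: algebra_simps)
  also have "\<dots> = z * mittag_leffler2 \<rho> (\<rho> + b) z"
    unfolding mittag_leffler2_def using assms
    by (intro suminf_mult mittag_leffler2_summable) auto
  finally show ?thesis by simp
qed

lemma mittag_leffler_0: "mittag_leffler \<rho> 0 = 1"
  using suminf_finite[of "{0}" "\<lambda>k. 0 ^ k / Gamma (\<rho> * real k + 1)"]
  by (simp add: mittag_leffler_def)

lemma mittag_leffler_1: "mittag_leffler 1 z = exp z"
  unfolding mittag_leffler_def exp_def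
  by (intro arg_cong[where f=suminf] ext) (simp add: Gamma_fact[symmetric] add.commute divide_inverse)

lemma continuous_on_mittag_leffler2: "0 < \<rho> \<Longrightarrow> 1 \<le> b \<Longrightarrow> continuous_on UNIV (mittag_leffler2 \<rho> b)"
proof -
  assume r: "0 < \<rho>" "1 \<le> b"
  have "continuous_on {-X..X} (mittag_leffler2 \<rho> b)" if "0 < X" for X
  proof -
    obtain R where R: "R \<ge> 1" "2 * X \<le> R powr \<rho>" using powr_unbounded[OF r(1)] by blast
    have "uniform_limit {-X..X} (\<lambda>n z. \<Sum>k<n. z ^ k / Gamma (\<rho> * real k + b)) (mittag_leffler2 \<rho> b) sequentially"
      unfolding mittag_leffler2_def
    proof (rule Weierstrass_m_test[where M="\<lambda>k. exp R * (1/2) ^ k"])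
      show "norm (z ^ k / Gamma (\<rho> * real k + b)) \<le> exp R * (1/2) ^ k" if "z \<in> {-X..X}" for k z
        using mittag_leffler_term_bound[of \<rho> \<rho> b R z X k] that r R by (simp add: abs_le_iff)
    qed (rule summable_mult[OF summable_geometric], simp)
    then show ?thesis
      by (rule uniform_limit_theorem[rotated]) (auto intro!: continuous_intros always_eventually simp: divide_inverse)
  qed
  then have "isCont (mittag_leffler2 \<rho> b) z" for z
    by (rule continuous_on_interior[of "{-(\<bar>z\<bar>+1)..\<bar>z\<bar>+1}"]) (auto simp: interior_atLeastAtMost_real)
  then show ?thesis by (simp add: continuous_on_eq_continuous_at)
qed

lemma isCont_mittag_leffler: "0 < \<rho> \<Longrightarrow> isCont (mittag_leffler \<rho>) z"
  using continuous_on_mittag_leffler2[of \<rho> 1]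
  by (simp add: mittag_leffler2_1[abs_def] continuous_on_eq_continuous_at)

text \<open>The range of orders is closed at 1, where the function is an exponential. This provides
  the limit at the excluded end of the order range and prepares the intermediate value
  argument.\<close>

lemma continuous_on_mittag_leffler_order:
  assumes "0 < r" "0 < t"
  shows "continuous_on {r..1} (\<lambda>\<rho>. mittag_leffler \<rho> (c * t powr \<rho>))"
proof -
  \<comment> \<open>t may be smaller than 1; \<open>max 1 t\<close> bounds
    \<open>t powr \<rho>\<close> for all orders up to 1 in either case.\<close>
  define X where "X = \<bar>c\<bar> * max 1 t"
  have X: "\<bar>c * t powr \<rho>\<bar> \<le> X" if "\<rho> \<in> {r..1}" for \<rho>
  proof -
    have "t powr \<rho> \<le> max 1 t powr \<rho>" using that assms by (intro powr_mono2) auto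
    also have "\<dots> \<le> max 1 t powr 1" using that by (intro powr_mono) auto
    finally show ?thesis by (auto simp: X_def abs_mult intro: mult_left_mono)
  qed
  obtain R where R: "R \<ge> 1" "2 * X \<le> R powr r" using powr_unbounded[OF assms(1)] by blast
  have ul: "uniform_limit {r..1} (\<lambda>n \<rho>. \<Sum>k<n. (c * t powr \<rho>) ^ k / Gamma (\<rho> * real k + 1))
     (\<lambda>\<rho>. mittag_leffler \<rho> (c * t powr \<rho>)) sequentially"
    unfolding mittag_leffler_def
  proof (rule Weierstrass_m_test[where M="\<lambda>k. exp R * (1/2) ^ k"])
    show "norm ((c * t powr \<rho>) ^ k / Gamma (\<rho> * real k + 1)) \<le> exp R * (1/2) ^ k" if "\<rho> \<in> {r..1}" for k \<rho>
      using mittag_leffler_term_bound[OF assms(1) _ order_refl R(1) X R(2), of \<rho> \<rho> k] that by simp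
  qed (rule summable_mult[OF summable_geometric], simp)
  have pos: "0 < \<rho> * real k + 1" if "r \<le> \<rho>" for \<rho> k
    using that assms by (intro add_nonneg_pos) auto
  have "continuous_on {r..1} (\<lambda>\<rho>. Gamma (\<rho> * real k + 1))" for k
  proof (rule continuous_on_compose2[OF continuous_on_Gamma[of "- \<int>\<^sub>\<le>\<^sub>0"]])
    show "continuous_on {r..1} (\<lambda>\<rho>. \<rho> * real k + 1)" by (intro continuous_intros)
    show "(\<lambda>\<rho>. \<rho> * real k + 1) ` {r..1} \<subseteq> - \<int>\<^sub>\<le>\<^sub>0"
      using pos[of _ k] by (fastforce elim!: nonpos_Ints_cases')
  qed simp
  moreover have "Gamma (\<rho> * real k + 1) \<noteq> 0" if "\<rho> \<in> {r..1}" for \<rho> k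
    using that Gamma_real_pos[OF pos[of \<rho> k]] by simp
  ultimately have "continuous_on {r..1} (\<lambda>\<rho>. \<Sum>k<n. (c * t powr \<rho>) ^ k / Gamma (\<rho> * real k + 1))" for n
    using assms by (intro continuous_intros) auto
  then show ?thesis
    by (intro uniform_limit_theorem[OF _ ul]) (auto intro: always_eventually)
qed

lemma mittag_leffler_measurable [measurable]: "0 < \<rho> \<Longrightarrow> mittag_leffler \<rho> \<in> borel_measurable borel"
  using continuous_on_mittag_leffler2[of \<rho> 1]
  by (simp add: mittag_leffler2_1[abs_def] borel_measurable_continuous_onI)

section \<open>Fractional integrals of the Mittag-Leffler function\<close>

lemma mittag_leffler_term_convolution:
  fixes \<rho> a c t :: real
  assumes "0 < \<rho>" "0 < a" "0 < t"
  shows "has_bochner_integral lborel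
     (\<lambda>x. indicator {0..t} x *\<^sub>R ((t - x) powr (a - 1) * ((c * x powr \<rho>) ^ n / Gamma (\<rho> * real n + 1))))
     (Gamma a * t powr a * ((c * t powr \<rho>) ^ n / Gamma (\<rho> * real n + (1 + a))))"
proof -
  define b where "b = \<rho> * real n + 1"
  have b: "0 < b" using assms by (simp add: b_def add_nonneg_pos)
  have G: "Gamma b \<noteq> 0" using Gamma_real_pos[OF b] by simp
  \<comment> \<open>false for \<open>x = 0\<close> and \<open>n = 0\<close>, because \<open>0 powr 0 = 0\<close>; hence the almost everywhere equality below\<close>
  have pw: "(c * x powr \<rho>) ^ n = c ^ n * x powr (b - 1)" if "0 < x" for x :: real
    using that by (simp add: b_def power_mult_distrib powr_realpow[symmetric] powr_powr)
  have "has_bochner_integral lborel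
     (\<lambda>x. (c ^ n / Gamma b) * (indicator {0..t} x *\<^sub>R ((t - x) powr (a - 1) * x powr (b - 1))))
     ((c ^ n / Gamma b) * (Beta a b * t powr (a + b - 1)))"
    using Beta_convolution[OF assms(2) b assms(3)]
    by (intro has_bochner_integral_mult_right)
      (auto simp: has_bochner_integral_iff set_integrable_def set_lebesgue_integral_def)
  moreover have "(c ^ n / Gamma b) * (Beta a b * t powr (a + b - 1)) =
      Gamma a * t powr a * ((c * t powr \<rho>) ^ n / Gamma (\<rho> * real n + (1 + a)))"
    using G assms by (simp add: pw Beta_def) (simp add: b_def powr_add[symmetric] add_ac)
  moreover have "AE x in lborel. (c ^ n / Gamma b) * (indicator {0..t} x *\<^sub>R ((t - x) powr (a - 1) * x powr (b - 1)))
     = indicator {0..t} x *\<^sub>R ((t - x) powr (a - 1) * ((c * x powr \<rho>) ^ n / Gamma (\<rho> * real n + 1)))"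
    using AE_lborel_singleton[of "0::real"]
    by eventually_elim (auto simp: indicator_def pw b_def)
  ultimately show ?thesis
    by (subst has_bochner_integral_cong_AE[symmetric,
          where f="\<lambda>x. (c ^ n / Gamma b) * (indicator {0..t} x *\<^sub>R ((t - x) powr (a - 1) * x powr (b - 1)))"]) auto
qed

text \<open>The series is integrated term by term. The absolute value of a term is the same term
  with c replaced by its absolute value, so the formula for the integrals of the terms also shows
  that the integrals of the norms are summable.\<close>

lemma mittag_leffler_convolution:
  fixes \<rho> a c t :: real
  assumes "0 < \<rho>" "0 < a" "0 < t"
  shows "set_integrable lborel {0..t} (\<lambda>x. (t - x) powr (a - 1) * mittag_leffler \<rho> (c * x powr \<rho>))"
    and "(LINT x:{0..t}|lborel. (t - x) powr (a - 1) * mittag_leffler \<rho> (c * x powr \<rho>)) =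
      Gamma a * t powr a * mittag_leffler2 \<rho> (1 + a) (c * t powr \<rho>)"
proof -
  define f where "f = (\<lambda>c n x. indicator {0..t} x *\<^sub>R ((t - x) powr (a - 1) * ((c * x powr \<rho>) ^ n / Gamma (\<rho> * real n + 1))))"
  have hb: "has_bochner_integral lborel (f c n)
      (Gamma a * t powr a * ((c * t powr \<rho>) ^ n / Gamma (\<rho> * real n + (1 + a))))" for c n
    unfolding f_def by (rule mittag_leffler_term_convolution[OF assms])
  have int: "integrable lborel (f c n)" and eq: "integral\<^sup>L lborel (f c n) =
      Gamma a * t powr a * ((c * t powr \<rho>) ^ n / Gamma (\<rho> * real n + (1 + a)))" for c n
    using hb[of c n] by (auto simp: has_bochner_integral_iff)
  have Gp: "0 < Gamma (\<rho> * real n + 1)" for n using assms by (intro Gamma_real_pos add_nonneg_pos) auto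
  have norm_eq: "norm (f c n x) = f \<bar>c\<bar> n x" for n x
    using Gp[of n] by (auto simp: f_def abs_mult power_abs indicator_def)
  have sm: "summable (\<lambda>n. f c n x)" for c x
    unfolding f_def using mittag_leffler2_summable[OF assms(1) order_refl, of "c * x powr \<rho>"]
    by (intro summable_scaleR_right summable_mult)
  have sum: "(\<Sum>n. f c n x) = indicator {0..t} x *\<^sub>R ((t - x) powr (a - 1) * mittag_leffler \<rho> (c * x powr \<rho>))" for x
    unfolding f_def mittag_leffler_def
    using mittag_leffler2_summable[OF assms(1) order_refl, of "c * x powr \<rho>"]
    by (intro sums_unique[symmetric] sums_scaleR_right sums_mult summable_sums)
  have 1: "AE x in lborel. summable (\<lambda>n. norm (f c n x))"
    unfolding norm_eq using sm by simp
  have 2: "summable (\<lambda>n. \<integral>x. norm (f c n x) \<partial>lborel)"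
    unfolding norm_eq eq using assms by (intro summable_mult mittag_leffler2_summable) auto
  have 3: "(\<Sum>n. integral\<^sup>L lborel (f c n)) = Gamma a * t powr a * mittag_leffler2 \<rho> (1 + a) (c * t powr \<rho>)"
    unfolding eq mittag_leffler2_def using assms by (intro suminf_mult mittag_leffler2_summable) auto
  show "set_integrable lborel {0..t} (\<lambda>x. (t - x) powr (a - 1) * mittag_leffler \<rho> (c * x powr \<rho>))"
    using integrable_suminf[OF int 1 2] unfolding sum set_integrable_def .
  show "(LINT x:{0..t}|lborel. (t - x) powr (a - 1) * mittag_leffler \<rho> (c * x powr \<rho>)) =
      Gamma a * t powr a * mittag_leffler2 \<rho> (1 + a) (c * t powr \<rho>)"
    using integral_suminf[OF int 1 2] unfolding sum 3 set_lebesgue_integral_def .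
qed

text \<open>The initial value problem with order \<rho>, coefficient c and initial value 1, written
  as a Volterra equation; it is the recurrence for second parameter 1.\<close>

lemma mittag_leffler_volterra:
  assumes "0 < \<rho>" "0 < t"
  shows "(LINT x:{0..t}|lborel. (t - x) powr (\<rho> - 1) * mittag_leffler \<rho> (c * x powr \<rho>)) * c
     = Gamma \<rho> * (mittag_leffler \<rho> (c * t powr \<rho>) - 1)"
  using mittag_leffler_convolution(2)[OF assms(1,1,2), of c] mittag_leffler2_rec[OF assms(1) order_refl, of "c * t powr \<rho>"]
  by (simp add: mittag_leffler2_1 algebra_simps)

text \<open>The fractional equation integrated once in time, so that nothing is differentiated near
  the singular point 0. The two sides are Mittag-Leffler functions with second parameters
  \<open>2 - \<rho>\<close> and 2, linked by the recurrence; its leading term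
  \<open>1 / Gamma (2 - \<rho>)\<close> is the contribution of the subtracted initial value.\<close>

lemma mittag_leffler_caputo:
  assumes "0 < \<rho>" "\<rho> < 1" "0 < t"
  shows "(LINT x:{0..t}|lborel. (t - x) powr (- \<rho>) * (mittag_leffler \<rho> (c * x powr \<rho>) - 1))
     = c * Gamma (1 - \<rho>) * (LINT x:{0..t}|lborel. mittag_leffler \<rho> (c * x powr \<rho>))"
proof -
  have a: "0 < 1 - \<rho>" using assms by simp
  have c1: "(LINT x:{0..t}|lborel. (t - x) powr (- \<rho>) * mittag_leffler \<rho> (c * x powr \<rho>)) =
     Gamma (1-\<rho>) * t powr (1-\<rho>) * mittag_leffler2 \<rho> (2 - \<rho>) (c * t powr \<rho>)"
    "set_integrable lborel {0..t} (\<lambda>x. (t - x) powr (- \<rho>) * mittag_leffler \<rho> (c * x powr \<rho>))"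
    using mittag_leffler_convolution[OF assms(1) a assms(3), of c] by auto
  have c2: "set_integrable lborel {0..t} (\<lambda>x. (t - x) powr (- \<rho>))"
    "(LINT x:{0..t}|lborel. (t - x) powr (- \<rho>)) = t powr (1-\<rho>) / (1-\<rho>)"
    using power_kernel_integral[OF a, of t] assms by auto
  \<comment> \<open>The plain integral is the convolution with exponent \<open>1 - 1\<close>, whose
    kernel is 1 except for the value 0 at \<open>x = t\<close>.\<close>
  have "AE x in lborel. indicator {0..t} x *\<^sub>R ((t - x) powr (1 - 1) * mittag_leffler \<rho> (c * x powr \<rho>)) =
      indicator {0..t} x *\<^sub>R mittag_leffler \<rho> (c * x powr \<rho>)"
    using AE_lborel_singleton[of "t"] by eventually_elim (auto simp: indicator_def)
  then have "(LINT x:{0..t}|lborel. (t - x) powr (1 - 1) * mittag_leffler \<rho> (c * x powr \<rho>)) =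
      (LINT x:{0..t}|lborel. mittag_leffler \<rho> (c * x powr \<rho>))"
    unfolding set_lebesgue_integral_def using assms by (intro integral_cong_AE) measurable
  then have c3: "(LINT x:{0..t}|lborel. mittag_leffler \<rho> (c * x powr \<rho>)) = t * mittag_leffler2 \<rho> 2 (c * t powr \<rho>)"
    using mittag_leffler_convolution(2)[OF assms(1) zero_less_one assms(3), of c] assms by simp
  have r: "mittag_leffler2 \<rho> (2 - \<rho>) (c * t powr \<rho>) = 1 / Gamma (2 - \<rho>) + c * t powr \<rho> * mittag_leffler2 \<rho> 2 (c * t powr \<rho>)"
    using mittag_leffler2_rec[of \<rho> "2 - \<rho>" "c * t powr \<rho>"] assms by simp
  have G: "Gamma (2 - \<rho>) = (1 - \<rho>) * Gamma (1 - \<rho>)"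
    using Gamma_plus1[of "1 - \<rho>"] assms by (force elim!: nonpos_Ints_cases' simp: add.commute)
  have q: "Gamma (1 - \<rho>) * t powr (1 - \<rho>) / Gamma (2 - \<rho>) = t powr (1 - \<rho>) / (1 - \<rho>)"
    unfolding G using Gamma_real_pos[OF a] by simp
  have t: "t powr (1 - \<rho>) * t powr \<rho> = t" using assms by (simp add: powr_add[symmetric])
  have "(LINT x:{0..t}|lborel. (t - x) powr (- \<rho>) * (mittag_leffler \<rho> (c * x powr \<rho>) - 1)) =
     (LINT x:{0..t}|lborel. (t - x) powr (- \<rho>) * mittag_leffler \<rho> (c * x powr \<rho>)) - (LINT x:{0..t}|lborel. (t - x) powr (- \<rho>))"
    using set_integral_diff(2)[OF c1(2) c2(1)] by (simp add: right_diff_distrib)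
  also have "\<dots> = c * Gamma (1 - \<rho>) * (t powr (1 - \<rho>) * t powr \<rho>) * mittag_leffler2 \<rho> 2 (c * t powr \<rho>)"
    unfolding c1 c2 r using q by (simp add: distrib_left)
  finally show ?thesis using t c3 by simp
qed

section \<open>Laplace transforms of powers and of the Mittag-Leffler function\<close>

lemma Laplace_power:
  assumes "0 < b" "0 < (p::real)"
  shows "has_bochner_integral lborel (\<lambda>t. indicator {0..} t *\<^sub>R (t powr (b - 1) * exp (- p * t))) (Gamma b / p powr b)"
proof -
  have "((\<lambda>t. t powr (b - 1) / exp t) has_integral Gamma b) {0..}" using Gamma_integral_real[OF assms(1)] .
  then have "(LINT t:{0..}|lborel. t powr (b - 1) / exp t) = Gamma b"
     "set_integrable lborel {0..} (\<lambda>t. t powr (b - 1) / exp t)"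
    by (auto intro!: set_integral_of_has_integral_nonneg[of "\<lambda>t. t powr (b - 1) / exp t" "{0..}"])
  then have "has_bochner_integral lborel (\<lambda>t. indicator {0..} t *\<^sub>R (t powr (b - 1) / exp t)) (Gamma b)"
    by (simp add: set_integrable_def set_lebesgue_integral_def has_bochner_integral_iff)
  then have "has_bochner_integral lborel (\<lambda>t. indicator {0..} (0 + p * t) *\<^sub>R ((0 + p * t) powr (b - 1) / exp (0 + p * t)))
      (Gamma b /\<^sub>R \<bar>p\<bar>)"
    using assms by (subst (asm) lborel_has_bochner_integral_real_affine_iff[where c=p and t=0]) auto
  then have "has_bochner_integral lborel (\<lambda>t. p powr (1 - b) * (indicator {0..} (0 + p * t) *\<^sub>R ((0 + p * t) powr (b - 1) / exp (0 + p * t))))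
      (p powr (1 - b) * (Gamma b /\<^sub>R \<bar>p\<bar>))"
    by (rule has_bochner_integral_mult_right)
  moreover have "p powr (1 - b) * (Gamma b /\<^sub>R \<bar>p\<bar>) = Gamma b / p powr b"
    using assms by (simp add: powr_diff field_simps)
  moreover have "p powr (1 - b) * (indicator {0..} (0 + p * t) *\<^sub>R ((0 + p * t) powr (b - 1) / exp (0 + p * t))) =
     indicator {0..} t *\<^sub>R (t powr (b - 1) * exp (- p * t))" for t
  proof -
    have "p powr (1 - b) * p powr (b - 1) = 1" using assms by (simp add: powr_add[symmetric])
    then show ?thesis using assms
      by (auto simp: indicator_def powr_mult exp_minus field_simps zero_le_mult_iff)
  qed
  ultimately show ?thesis by (simp cong: has_bochner_integral_cong)
qed

text \<open>The transformed series is geometric with ratio \<open>c / p powr \<rho>\<close>, and the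
  condition on p is exactly its convergence.\<close>

lemma Laplace_mittag_leffler_large:
  assumes "0 < \<rho>" "0 < p" "\<bar>c\<bar> < p powr \<rho>"
  shows "has_bochner_integral lborel (\<lambda>t. indicator {0..} t *\<^sub>R (mittag_leffler \<rho> (c * t powr \<rho>) * exp (- p * t)))
    (p powr (\<rho> - 1) / (p powr \<rho> - c))"
proof -
  define f where "f = (\<lambda>c n t. indicator {0..} t *\<^sub>R ((c * t powr \<rho>) ^ n / Gamma (\<rho> * real n + 1) * exp (- p * t)))"
  have Gp: "0 < Gamma (\<rho> * real n + 1)" for n using assms by (intro Gamma_real_pos add_nonneg_pos) auto
  have hb: "has_bochner_integral lborel (f c n) ((c / p powr \<rho>) ^ n / p)" for c n
  proof -
    define b where "b = \<rho> * real n + 1"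
    have b: "0 < b" using assms by (simp add: b_def add_nonneg_pos)
    have G: "Gamma b \<noteq> 0" using Gamma_real_pos[OF b] by simp
    have pw: "(c * x powr \<rho>) ^ n = c ^ n * x powr (b - 1)" if "0 < x" for x :: real
      using that by (simp add: b_def power_mult_distrib powr_realpow[symmetric] powr_powr)
    have "has_bochner_integral lborel
       (\<lambda>t. (c ^ n / Gamma b) * (indicator {0..} t *\<^sub>R (t powr (b - 1) * exp (- p * t))))
       ((c ^ n / Gamma b) * (Gamma b / p powr b))"
      by (intro has_bochner_integral_mult_right Laplace_power b assms)
    moreover have "p powr b = (p powr \<rho>) ^ n * p" using assms
      by (simp add: b_def powr_add powr_realpow[symmetric] powr_powr)
    then have "(c ^ n / Gamma b) * (Gamma b / p powr b) = (c / p powr \<rho>) ^ n / p"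
      using G by (simp add: power_divide)
    moreover have "AE t in lborel. (c ^ n / Gamma b) * (indicator {0..} t *\<^sub>R (t powr (b - 1) * exp (- p * t))) = f c n t"
      using AE_lborel_singleton[of "0::real"]
      by eventually_elim (auto simp: indicator_def pw b_def f_def)
    moreover have "f c n \<in> borel_measurable lborel" unfolding f_def by measurable
    ultimately show ?thesis
      by (subst has_bochner_integral_cong_AE[symmetric,
          where f="\<lambda>t. (c ^ n / Gamma b) * (indicator {0..} t *\<^sub>R (t powr (b - 1) * exp (- p * t)))"]) auto
  qed
  have int: "integrable lborel (f c n)" and eq: "integral\<^sup>L lborel (f c n) = (c / p powr \<rho>) ^ n / p" for c n
    using hb[of c n] by (auto simp: has_bochner_integral_iff)
  have norm_eq: "norm (f c n x) = f \<bar>c\<bar> n x" for n x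
    using Gp[of n] by (auto simp: f_def abs_mult power_abs indicator_def)
  have sm: "summable (\<lambda>n. f c n x)" for c x
    unfolding f_def using mittag_leffler2_summable[OF assms(1) order_refl, of "c * x powr \<rho>"]
    by (intro summable_scaleR_right summable_mult2)
  have sum: "(\<Sum>n. f c n x) = indicator {0..} x *\<^sub>R (mittag_leffler \<rho> (c * x powr \<rho>) * exp (- p * x))" for x
    unfolding f_def mittag_leffler_def
    using mittag_leffler2_summable[OF assms(1) order_refl, of "c * x powr \<rho>"]
    by (intro sums_unique[symmetric] sums_scaleR_right sums_mult2 summable_sums)
  have 1: "AE x in lborel. summable (\<lambda>n. norm (f c n x))"
    unfolding norm_eq using sm by simp
  have q: "norm (\<bar>c\<bar> / p powr \<rho>) < 1" "norm (c / p powr \<rho>) < 1" using assms by auto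
  have 2: "summable (\<lambda>n. \<integral>x. norm (f c n x) \<partial>lborel)"
    unfolding norm_eq eq by (rule summable_divide[OF summable_geometric[OF q(1)]])
  have 3: "(\<Sum>n. integral\<^sup>L lborel (f c n)) = p powr (\<rho> - 1) / (p powr \<rho> - c)"
  proof -
    have "(\<Sum>n. integral\<^sup>L lborel (f c n)) = 1 / (1 - c / p powr \<rho>) / p"
      unfolding eq using suminf_divide[OF summable_geometric[OF q(2)]] suminf_geometric[OF q(2)] by simp
    also have "\<dots> = p powr (\<rho> - 1) / (p powr \<rho> - c)"
      using assms by (simp add: powr_diff field_simps)
    finally show ?thesis .
  qed
  show ?thesis
    using integrable_suminf[OF int 1 2] integral_suminf[OF int 1 2]
    unfolding sum 3 has_bochner_integral_iff by simp
qed

section \<open>A Stieltjes representation\<close>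

lemma has_contour_integral_linepath_horizontal_iff:
  assumes "a < b"
  shows "(f has_contour_integral I) (linepath (Complex a h) (Complex b h)) \<longleftrightarrow>
     ((\<lambda>x. f (Complex x h)) has_integral I) {a..b}"
proof -
  have l: "linepath (Complex a h) (Complex b h) = (+) (Complex 0 h) \<circ> linepath (of_real a) (of_real b)"
    by (auto simp: linepath_def fun_eq_iff complex_eq_iff algebra_simps)
  have "(f has_contour_integral I) (linepath (Complex a h) (Complex b h)) \<longleftrightarrow>
     ((\<lambda>x. f (of_real x + Complex 0 h)) has_integral I) {a..b}"
    unfolding l has_contour_integral_translate
    using assms by (subst has_contour_integral_linepath_Reals_iff) auto
  also have "(\<lambda>x. f (of_real x + Complex 0 h)) = (\<lambda>x. f (Complex x h))"
    by (intro ext arg_cong[where f=f]) (simp add: complex_eq_iff)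
  finally show ?thesis .
qed

text \<open>The horizontal sides are traversed in opposite directions, so together they integrate
  the jump of f between the two edges; the vertical sides remain as error terms.\<close>

lemma contour_integral_centered_rectpath:
  assumes "0 < R" "0 < h"
    and cont: "continuous_on (path_image (rectpath (Complex (-R) (-h)) (Complex R h))) f"
  shows "((\<lambda>x. f (Complex x (-h)) - f (Complex x h)) has_integral
     (contour_integral (rectpath (Complex (-R) (-h)) (Complex R h)) f
     - contour_integral (linepath (Complex R (-h)) (Complex R h)) f
     - contour_integral (linepath (Complex (-R) h) (Complex (-R) (-h))) f)) {-R..R}"
proof -
  let ?a1 = "Complex (-R) (-h)" and ?a2 = "Complex R (-h)" and ?a3 = "Complex R h" and ?a4 = "Complex (-R) h"
  have rp: "rectpath ?a1 ?a3 = linepath ?a1 ?a2 +++ linepath ?a2 ?a3 +++ linepath ?a3 ?a4 +++ linepath ?a4 ?a1"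
    by (simp add: rectpath_def Let_def)
  then have img: "path_image (rectpath ?a1 ?a3) = closed_segment ?a1 ?a2 \<union> closed_segment ?a2 ?a3 \<union> closed_segment ?a3 ?a4 \<union> closed_segment ?a4 ?a1"
    by (simp add: path_image_join Un_assoc)
  have ci: "f contour_integrable_on linepath ?a1 ?a2" "f contour_integrable_on linepath ?a2 ?a3"
     "f contour_integrable_on linepath ?a3 ?a4" "f contour_integrable_on linepath ?a4 ?a1"
    using cont unfolding img by (auto intro!: contour_integrable_continuous_linepath elim: continuous_on_subset)
  have sum: "contour_integral (rectpath ?a1 ?a3) f = contour_integral (linepath ?a1 ?a2) f +
     contour_integral (linepath ?a2 ?a3) f + contour_integral (linepath ?a3 ?a4) f + contour_integral (linepath ?a4 ?a1) f"
    unfolding rp using ci by (simp add: add.assoc)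
  have "contour_integral (linepath ?a4 ?a3) f = - contour_integral (linepath ?a3 ?a4) f"
    using contour_integral_reversepath[of "linepath ?a3 ?a4" f] by simp
  moreover have "f contour_integrable_on linepath ?a4 ?a3"
    using ci(3) contour_integrable_reversepath[of "linepath ?a3 ?a4" f] by simp
  ultimately have "((\<lambda>x. f (Complex x h)) has_integral (- contour_integral (linepath ?a3 ?a4) f)) {-R..R}"
    using has_contour_integral_linepath_horizontal_iff[of "-R" R f _ h] assms
    by (metis contour_integral_unique has_contour_integral_integral neg_less_pos)
  moreover have "((\<lambda>x. f (Complex x (-h))) has_integral (contour_integral (linepath ?a1 ?a2) f)) {-R..R}"
    using has_contour_integral_linepath_horizontal_iff[of "-R" R f _ "-h"] assms ci(1)
    by (metis has_contour_integral_integral neg_less_pos)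
  ultimately have "((\<lambda>x. f (Complex x (-h)) - f (Complex x h)) has_integral
     (contour_integral (linepath ?a1 ?a2) f - (- contour_integral (linepath ?a3 ?a4) f))) {-R..R}"
    by (rule has_integral_diff[rotated])
  then show ?thesis unfolding sum by (simp add: algebra_simps)
qed

text \<open>
  The density, in the variable \<open>x = ln r\<close>, of the measure whose mixture of the functions
  \<open>exp (- r * t)\<close> is \<open>mittag_leffler \<rho> (- l * t powr \<rho>)\<close>.
\<close>

definition spectral_density :: "real \<Rightarrow> real \<Rightarrow> real \<Rightarrow> real" where
  "spectral_density \<rho> l x =
     l * exp (\<rho> * x) * sin (\<rho> * pi) / (pi * ((exp (\<rho> * x) * cos (\<rho> * pi) + l)\<^sup>2 + (exp (\<rho> * x) * sin (\<rho> * pi))\<^sup>2))"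

context
  fixes \<rho> l :: real
  assumes \<rho>: "0 < \<rho>" "\<rho> < 1" and l: "0 < l"
begin

lemma sin_rho_pos: "0 < sin (\<rho> * pi)"
  using \<rho> by (intro sin_gt_zero) auto

lemma spectral_density_pos: "0 < spectral_density \<rho> l x"
proof -
  have "0 < (exp (\<rho> * x) * sin (\<rho> * pi))\<^sup>2" using sin_rho_pos by simp
  then show ?thesis unfolding spectral_density_def
    using l sin_rho_pos by (intro divide_pos_pos mult_pos_pos add_nonneg_pos) auto
qed

lemma spectral_density_continuous: "continuous_on UNIV (spectral_density \<rho> l)"
proof -
  have "(exp (\<rho> * x) * cos (\<rho> * pi) + l)\<^sup>2 + (exp (\<rho> * x) * sin (\<rho> * pi))\<^sup>2 \<noteq> 0" for x
  proof -
    have "0 < (exp (\<rho> * x) * sin (\<rho> * pi))\<^sup>2" using sin_rho_pos by simp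
    then show ?thesis by (smt (verit) zero_le_power2)
  qed
  then show ?thesis unfolding spectral_density_def by (intro continuous_intros) auto
qed

lemma spectral_density_measurable [measurable]: "spectral_density \<rho> l \<in> borel_measurable borel"
  using spectral_density_continuous by (rule borel_measurable_continuous_onI)

text \<open>A value \<open>- l\<close> would be real, which forces \<open>\<rho> * Im w\<close> to
  be a multiple of pi of modulus below pi, hence 0; but then the exponential is positive. In the
  variable z this says that z to the power \<rho>, plus l, has no zero on the principal
  sheet.\<close>

lemma exp_rho_plus_nonzero:
  fixes w :: complex
  assumes "\<bar>Im w\<bar> * \<rho> < pi"
  shows "exp (of_real \<rho> * w) + of_real l \<noteq> 0"
proof
  assume "exp (of_real \<rho> * w) + of_real l = 0"
  then have e: "exp (of_real \<rho> * w) = - of_real l" by (simp add: eq_neg_iff_add_eq_0)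
  have "Im (exp (of_real \<rho> * w)) = 0" unfolding e by simp
  then have s: "sin (\<rho> * Im w) = 0" by (simp add: Im_exp)
  have "\<bar>\<rho> * Im w\<bar> < pi" using assms \<rho> by (simp add: abs_mult mult.commute)
  then have "\<rho> * Im w = 0" using s by (metis abs_less_iff minus_less_iff sin_eq_0_pi)
  then have "cos (\<rho> * Im w) = 1" by (metis cos_zero)
  then have "0 < Re (exp (of_real \<rho> * w))" by (simp add: Re_exp)
  then show False unfolding e using l by simp
qed

text \<open>
  In the variable \<open>w = ln z\<close> the plane cut along the negative real axis becomes the strip
  \<open>\<bar>Im w\<bar> < pi\<close>, so that a rectangle replaces the keyhole contour.
\<close>

definition strip_fun :: "real \<Rightarrow> complex \<Rightarrow> complex" where
  "strip_fun p w = (exp (of_real \<rho> * w) / (exp (of_real \<rho> * w) + of_real l)) / (exp w - of_real p)"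

text \<open>Both edges of the strip represent the cut, where \<open>exp w = - exp x\<close>. The
  first factors of \<open>strip_fun\<close> on the two edges are complex conjugates, so the jump is
  purely imaginary; this is where the formula for the density comes from.\<close>

lemma strip_fun_jump:
  assumes "0 < p"
  shows "strip_fun p (Complex x (-pi)) - strip_fun p (Complex x pi)
     = of_real (2 * pi * (spectral_density \<rho> l x / (exp x + p))) * \<i>"
proof -
  define Z where "Z = Complex (exp (\<rho> * x) * cos (\<rho> * pi)) (exp (\<rho> * x) * sin (\<rho> * pi))"
  have e1: "exp (of_real \<rho> * Complex x pi) = Z" "exp (of_real \<rho> * Complex x (-pi)) = cnj Z"
    by (simp_all add: Z_def complex_eq_iff Re_exp Im_exp)
  have e2: "exp (Complex x pi) = - of_real (exp x)" "exp (Complex x (-pi)) = - of_real (exp x)"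
    by (simp_all add: complex_eq_iff Re_exp Im_exp)
  have "\<bar>Im (Complex x pi)\<bar> * \<rho> < pi" using \<rho> by simp
  from exp_rho_plus_nonzero[OF this] have nz: "Z + of_real l \<noteq> 0" by (simp add: e1)
  then have nz': "cnj Z + of_real l \<noteq> 0" by (metis complex_cnj_add complex_cnj_complex_of_real complex_cnj_zero_iff)
  have N: "(Z + of_real l) * (cnj Z + of_real l) = of_real ((exp (\<rho> * x) * cos (\<rho> * pi) + l)\<^sup>2 + (exp (\<rho> * x) * sin (\<rho> * pi))\<^sup>2)"
    by (simp add: Z_def complex_eq_iff power2_eq_square algebra_simps)
  have "strip_fun p (Complex x (-pi)) - strip_fun p (Complex x pi)
     = (cnj Z / (cnj Z + of_real l) - Z / (Z + of_real l)) / (- of_real (exp x + p))"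
    unfolding strip_fun_def e1 e2 by (simp add: diff_divide_distrib)
  also have "cnj Z / (cnj Z + of_real l) - Z / (Z + of_real l) = of_real l * (cnj Z - Z) / ((Z + of_real l) * (cnj Z + of_real l))"
    using nz nz' by (simp add: field_simps)
  also have "\<dots> = - (of_real (2 * pi * spectral_density \<rho> l x) * \<i>)"
    unfolding N by (simp add: Z_def spectral_density_def complex_eq_iff)
  finally show ?thesis by (simp only: minus_divide_divide of_real_mult of_real_divide mult.assoc times_divide_eq_right times_divide_eq_left mult.left_commute mult.commute)
qed

text \<open>With \<open>z = exp w\<close> and dz = z dw, the integrand is the Cauchy kernel 1/(z -
  p) applied to the Laplace transform z^(\<rho> - 1) / (z^\<rho> + l). The only pole is
  \<open>w = ln p\<close>, and its residue is the value of that transform at p.\<close>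

lemma strip_fun_contour:
  assumes p: "0 < p" and R: "\<bar>ln p\<bar> < R"
  shows "contour_integral (rectpath (Complex (-R) (-pi)) (Complex R pi)) (strip_fun p)
     = 2 * pi * \<i> * of_real (p powr (\<rho> - 1) / (p powr \<rho> + l))"
    and "continuous_on (path_image (rectpath (Complex (-R) (-pi)) (Complex R pi))) (strip_fun p)"
proof -
  \<comment> \<open>The open strip of half-height \<open>m\<close> has to contain the closed
    rectangle, so \<open>m\<close> exceeds pi. The bound \<open>pi / \<rho>\<close> keeps the inner
    denominator away from 0, and the bound \<open>2 * pi\<close> leaves \<open>ln p\<close> as the
    only logarithm of p in the strip.\<close>
  define m where "m = min (pi / \<rho>) (2 * pi)"
  have m: "pi < m" using \<rho> by (simp add: m_def field_simps)
  define S where "S = {w. - m < Im w} \<inter> {w. Im w < m}"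
  define q where "q = complex_of_real (ln p)"
  define \<phi> :: "complex \<Rightarrow> complex" where "\<phi> = (\<lambda>w. exp (of_real \<rho> * w) / (exp (of_real \<rho> * w) + of_real l))"
  have oS: "open S" unfolding S_def by (intro open_Int open_halfspace_Im_gt open_halfspace_Im_lt)
  have cS: "connected S" unfolding S_def
    by (intro convex_connected convex_Int convex_halfspace_Im_gt convex_halfspace_Im_lt)
  have nz: "exp (of_real \<rho> * w) + of_real l \<noteq> 0" if "w \<in> S" for w
  proof (rule exp_rho_plus_nonzero)
    have "\<bar>Im w\<bar> < pi / \<rho>" using that unfolding S_def m_def by (auto simp: abs_less_iff)
    then show "\<bar>Im w\<bar> * \<rho> < pi" using \<rho> by (simp add: field_simps)
  qed
  have \<phi>h: "\<phi> holomorphic_on S" unfolding \<phi>_def using nz by (intro holomorphic_intros) auto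
  have q: "exp q = of_real p" using p by (simp only: q_def exp_of_real exp_ln)
  have only: "w = q" if w: "w \<in> S" "exp w = of_real p" for w
  proof -
    obtain n :: int where n: "w = q + (of_int (2 * n) * pi) * \<i>"
      using w q exp_eq[of w q] by auto
    have "Im w = 2 * of_int n * pi" unfolding n by (simp add: q_def)
    moreover have "\<bar>Im w\<bar> < 2 * pi" using w unfolding S_def m_def by (auto simp: abs_less_iff)
    ultimately have "\<bar>of_int n\<bar> < (1::real)" by (simp add: abs_mult)
    then have "n = 0" by linarith
    then show ?thesis using n by simp
  qed
  have qS: "q \<in> S" using less_trans[OF pi_gt_zero m] by (auto simp: q_def S_def)
  have holo: "strip_fun p holomorphic_on S - {q}"
    unfolding strip_fun_def using nz only by (intro holomorphic_intros) auto
  let ?g = "rectpath (Complex (-R) (-pi)) (Complex R pi)"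
  have qb: "q \<in> box (Complex (-R) (-pi)) (Complex R pi)"
    using R by (auto simp: in_box_complex_iff q_def)
  have R0: "0 < R" using R by simp
  have img: "path_image ?g \<subseteq> cbox (Complex (-R) (-pi)) (Complex R pi)"
    "q \<notin> path_image ?g"
    using qb R0 by (auto simp: path_image_rectpath_cbox_minus_box)
  have sub: "cbox (Complex (-R) (-pi)) (Complex R pi) \<subseteq> S"
    using m by (auto simp: in_cbox_complex_iff S_def)
  have imgS: "path_image ?g \<subseteq> S - {q}" using img sub by auto
  show "continuous_on (path_image ?g) (strip_fun p)"
    using holo imgS holomorphic_on_imp_continuous_on continuous_on_subset by blast
  have "contour_integral ?g (strip_fun p) = 2 * pi * \<i> * (\<Sum>z\<in>{q}. winding_number ?g z * residue (strip_fun p) z)"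
  proof (rule Residue_theorem[OF oS cS _ _ _ _ imgS])
    show "\<forall>z. z \<notin> S \<longrightarrow> winding_number ?g z = 0"
      using sub R0 by (auto intro!: winding_number_rectpath_outside)
  qed (use holo in auto)
  also have "\<dots> = 2 * pi * \<i> * residue (strip_fun p) q"
    using winding_number_rectpath[OF qb] by simp
  also have "residue (strip_fun p) q = \<phi> q / of_real p"
  proof -
    have "residue (\<lambda>w. \<phi> w / (exp w - of_real p)) q = \<phi> q / of_real p"
    proof (rule residue_simple_pole_deriv[OF \<phi>h _ oS cS qS])
      show "(\<lambda>w. exp w - of_real p) holomorphic_on S" by (intro holomorphic_intros)
      show "((\<lambda>w. exp w - of_real p) has_field_derivative of_real p) (at q)"
        by (auto intro!: derivative_eq_intros simp: q)
      show "\<phi> q \<noteq> 0" using nz[OF qS] by (simp add: \<phi>_def)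
    qed (use p q in auto)
    then show ?thesis by (simp add: \<phi>_def strip_fun_def[abs_def])
  qed
  also have "\<phi> q / of_real p = of_real (p powr (\<rho> - 1) / (p powr \<rho> + l))"
  proof -
    have "exp (of_real \<rho> * q) = of_real (p powr \<rho>)" using p
      by (simp add: q_def powr_def exp_of_real[symmetric])
    then show ?thesis using p by (simp add: \<phi>_def powr_diff)
  qed
  finally show "contour_integral ?g (strip_fun p) = 2 * pi * \<i> * of_real (p powr (\<rho> - 1) / (p powr \<rho> + l))" .
qed

text \<open>The reverse triangle inequality in both denominators gives a bound that depends on the
  real part only. It decays like \<open>exp (- x)\<close> on the right and like
  \<open>exp (\<rho> * x)\<close> on the left, so the vertical sides disappear in the limit.\<close>

lemma strip_fun_vertical_bound:
  assumes "0 < p" "Re w = x" "exp x \<noteq> p" "exp (\<rho> * x) \<noteq> l"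
  shows "norm (strip_fun p w) \<le> exp (\<rho> * x) / \<bar>exp (\<rho> * x) - l\<bar> / \<bar>exp x - p\<bar>"
proof -
  have n1: "norm (exp (of_real \<rho> * w)) = exp (\<rho> * x)" "norm (exp w) = exp x"
    using assms by simp_all
  have "\<bar>exp (\<rho> * x) - l\<bar> \<le> norm (exp (of_real \<rho> * w) + of_real l)"
    using norm_triangle_ineq3[of "exp (of_real \<rho> * w)" "- of_real l"] n1 l by simp
  moreover have "\<bar>exp x - p\<bar> \<le> norm (exp w - of_real p)"
    using norm_triangle_ineq3[of "exp w" "of_real p"] n1 assms by simp
  ultimately show ?thesis
    unfolding strip_fun_def norm_divide n1 using assms
    by (intro frac_le) auto
qed

text \<open>Under \<open>r = exp x\<close> the integral is a Stieltjes transform in p: the residue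
  at \<open>ln p\<close> equals the integrated jump across the cut as the rectangle grows.\<close>

lemma spectral_density_Stieltjes:
  assumes p: "0 < p"
  shows "has_bochner_integral lborel (\<lambda>x. spectral_density \<rho> l x / (exp x + p)) (p powr (\<rho> - 1) / (p powr \<rho> + l))"
proof -
  define g where "g = (\<lambda>x. spectral_density \<rho> l x / (exp x + p))"
  define V where "V = p powr (\<rho> - 1) / (p powr \<rho> + l)"
  define B where "B = (\<lambda>x. exp (\<rho> * x) / \<bar>exp (\<rho> * x) - l\<bar> / \<bar>exp x - p\<bar>)"
  have g0: "0 \<le> g x" for x using spectral_density_pos[of x] p by (simp add: g_def add_pos_pos less_imp_le)
  have g_cont: "continuous_on UNIV g"
    unfolding g_def using p by (intro continuous_intros spectral_density_continuous) (metis add_pos_pos exp_gt_zero less_irrefl)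
  have [measurable]: "g \<in> borel_measurable borel" using g_cont by (rule borel_measurable_continuous_onI)
  have Blim: "(B \<longlongrightarrow> 0) at_top" "((\<lambda>x. B (- x)) \<longlongrightarrow> 0) at_top"
    unfolding B_def using \<rho> l p by real_asymp+
  \<comment> \<open>The first condition on \<open>R\<close> puts the pole inside the rectangle. Both
    together keep the denominators in \<open>B\<close> nonzero on the vertical sides. These sides
    have length \<open>2 * pi\<close>, which cancels against the factor of the jump.\<close>
  have main: "\<bar>integral {-R..R} g - V\<bar> \<le> B R + B (-R)"
    if R: "\<bar>ln p\<bar> < R" "\<bar>ln l / \<rho>\<bar> < R" for R
  proof -
    have R0: "0 < R" using R by simp
    define c2 where "c2 = contour_integral (linepath (Complex R (-pi)) (Complex R pi)) (strip_fun p)"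
    define c4 where "c4 = contour_integral (linepath (Complex (-R) pi) (Complex (-R) (-pi))) (strip_fun p)"
    note cont = strip_fun_contour(2)[OF p R(1)]
    have ne: "exp x \<noteq> p" "exp (\<rho> * x) \<noteq> l" if "\<bar>x\<bar> = R" for x
    proof -
      show "exp x \<noteq> p" using that R(1) by auto
      show "exp (\<rho> * x) \<noteq> l"
      proof
        assume "exp (\<rho> * x) = l"
        then have "ln l / \<rho> = x" using \<rho> by auto
        then show False using that R(2) by auto
      qed
    qed
    have img: "closed_segment (Complex R (-pi)) (Complex R pi) \<subseteq> path_image (rectpath (Complex (-R) (-pi)) (Complex R pi))"
       "closed_segment (Complex (-R) pi) (Complex (-R) (-pi)) \<subseteq> path_image (rectpath (Complex (-R) (-pi)) (Complex R pi))"
      by (auto simp: rectpath_def Let_def path_image_join)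
    have B: "norm c2 \<le> B R * (2 * pi)" "norm c4 \<le> B (-R) * (2 * pi)"
    proof -
      have "norm c2 \<le> B R * norm (Complex R pi - Complex R (-pi))"
        unfolding c2_def
      proof (rule contour_integral_bound_linepath)
        show "strip_fun p contour_integrable_on linepath (Complex R (-pi)) (Complex R pi)"
          by (intro contour_integrable_continuous_linepath continuous_on_subset[OF cont] img)
        show "norm (strip_fun p w) \<le> B R" if "w \<in> closed_segment (Complex R (-pi)) (Complex R pi)" for w
          unfolding B_def using that ne[of R] R0 p
          by (intro strip_fun_vertical_bound) (auto simp: closed_segment_same_Re)
      qed (simp add: B_def)
      moreover have "norm (Complex R pi - Complex R (-pi)) = 2 * pi" by (simp add: complex_diff cmod_def real_sqrt_mult)
      ultimately show "norm c2 \<le> B R * (2 * pi)" by simp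
      have "norm c4 \<le> B (-R) * norm (Complex (-R) (-pi) - Complex (-R) pi)"
        unfolding c4_def
      proof (rule contour_integral_bound_linepath)
        show "strip_fun p contour_integrable_on linepath (Complex (-R) pi) (Complex (-R) (-pi))"
          by (intro contour_integrable_continuous_linepath continuous_on_subset[OF cont] img)
        show "norm (strip_fun p w) \<le> B (-R)" if "w \<in> closed_segment (Complex (-R) pi) (Complex (-R) (-pi))" for w
          unfolding B_def using that ne[of "-R"] R0 p
          by (intro strip_fun_vertical_bound) (auto simp: closed_segment_same_Re)
      qed (simp add: B_def)
      moreover have "norm (Complex (-R) (-pi) - Complex (-R) pi) = 2 * pi" by (simp add: complex_diff cmod_def real_sqrt_mult)
      ultimately show "norm c4 \<le> B (-R) * (2 * pi)" by simp
    qed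
    have "((\<lambda>x. of_real (2 * pi * g x) * \<i>) has_integral (2 * pi * \<i> * of_real V - c2 - c4)) {-R..R}"
      using contour_integral_centered_rectpath[OF R0 pi_gt_zero cont]
      unfolding strip_fun_jump[OF p] strip_fun_contour(1)[OF p R(1)] c2_def c4_def V_def g_def .
    moreover have "(g has_integral integral {-R..R} g) {-R..R}"
      by (intro integrable_integral integrable_continuous_interval continuous_on_subset[OF g_cont]) auto
    then have "((\<lambda>x. of_real (2 * pi * g x) * \<i>) has_integral of_real (2 * pi * integral {-R..R} g) * \<i>) {-R..R}"
      by (intro has_integral_mult_left has_integral_of_real has_integral_mult_right)
    ultimately have "of_real (2 * pi * integral {-R..R} g) * \<i> = 2 * pi * \<i> * of_real V - c2 - c4"
      by (rule has_integral_unique[rotated])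
    then have "of_real (2 * pi * (integral {-R..R} g - V)) * \<i> = - c2 - c4"
      by (simp add: algebra_simps)
    then have "norm (complex_of_real (2 * pi * (integral {-R..R} g - V)) * \<i>) \<le> norm c2 + norm c4"
      using norm_triangle_ineq4[of "- c2" c4] by simp
    moreover have "norm (complex_of_real y * \<i>) = \<bar>y\<bar>" for y by (simp add: norm_mult)
    ultimately have "\<bar>2 * pi * (integral {-R..R} g - V)\<bar> \<le> B R * (2 * pi) + B (-R) * (2 * pi)"
      using B by (smt (verit))
    then have "2 * pi * \<bar>integral {-R..R} g - V\<bar> \<le> B R * (2 * pi) + B (-R) * (2 * pi)"
      by (simp add: abs_mult)
    also have "\<dots> = 2 * pi * (B R + B (-R))" by (simp add: algebra_simps)
    finally show ?thesis by simp
  qed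
  have lim: "((\<lambda>R. integral {-R..R} g) \<longlongrightarrow> V) at_top"
  proof (rule LIM_zero_cancel, rule tendsto_rabs_zero_cancel, rule tendsto_sandwich[OF _ _ tendsto_const])
    show "((\<lambda>R. B R + B (- R)) \<longlongrightarrow> 0) at_top" using tendsto_add[OF Blim] by simp
    show "\<forall>\<^sub>F R in at_top. \<bar>integral {-R..R} g - V\<bar> \<le> B R + B (- R)"
      using eventually_gt_at_top[of "\<bar>ln p\<bar>"] eventually_gt_at_top[of "\<bar>ln l / \<rho>\<bar>"]
      by eventually_elim (rule main)
  qed auto
  have si: "set_integrable lborel {- real n..real n} g" for n
    by (rule borel_integrable_atLeastAtMost') (rule continuous_on_subset[OF g_cont], simp)
  \<comment> \<open>Symmetric intervals yield only an improper integral; as \<open>g\<close> is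
    nonnegative, monotone convergence turns it into a Lebesgue integral.\<close>
  have "has_bochner_integral lborel g V"
  proof (rule has_bochner_integral_monotone_convergence)
    show "integrable lborel (\<lambda>x. indicator {- real n..real n} x *\<^sub>R g x)" for n
      using si by (simp add: set_integrable_def)
    show "AE x in lborel. mono (\<lambda>n. indicator {- real n..real n} x *\<^sub>R g x)"
      using g0 by (intro AE_I2 monoI) (auto simp: indicator_def)
    show "AE x in lborel. (\<lambda>n. indicator {- real n..real n} x *\<^sub>R g x) \<longlonglongrightarrow> g x"
    proof (rule AE_I2, rule tendsto_eventually)
      fix x
      show "\<forall>\<^sub>F n in sequentially. indicator {- real n..real n} x *\<^sub>R g x = g x"
        using eventually_ge_at_top[of "nat \<lceil>\<bar>x\<bar>\<rceil>"]
      proof eventually_elim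
        case (elim n)
        then have "\<bar>x\<bar> \<le> real n" by linarith
        then show ?case by (auto simp: indicator_def)
      qed
    qed
    have "(\<lambda>n. integral {- real n..real n} g) \<longlonglongrightarrow> V"
      using filterlim_compose[OF lim filterlim_real_sequentially] .
    moreover have "integral {- real n..real n} g = (\<integral>x. indicator {- real n..real n} x *\<^sub>R g x \<partial>lborel)" for n
      using set_borel_integral_eq_integral(2)[OF si[of n]] by (simp add: set_lebesgue_integral_def)
    ultimately show "(\<lambda>n. \<integral>x. indicator {- real n..real n} x *\<^sub>R g x \<partial>lborel) \<longlonglongrightarrow> V" by simp
  qed simp
  then show ?thesis unfolding g_def V_def .
qed

end

section \<open>Laplace transforms and complete monotonicity\<close>

text \<open>In the variable \<open>exp (- t)\<close> the hypothesis says that all moments vanish.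
  Hence every polynomial weight integrates to 0, and by Weierstrass approximation on the unit
  interval so does every continuous weight.\<close>

lemma Laplace_zero_imp_weighted_zero:
  fixes f :: "real \<Rightarrow> real" and \<psi> :: "real \<Rightarrow> real"
  assumes int: "set_integrable lborel {0..} f"
    and zero: "\<And>n. (LINT t:{0..}|lborel. f t * exp (- t) ^ n) = 0"
    and cont: "continuous_on UNIV \<psi>"
  shows "set_integrable lborel {0..} (\<lambda>t. f t * \<psi> (exp (- t)))"
    and "(LINT t:{0..}|lborel. f t * \<psi> (exp (- t))) = 0"
proof -
  have si: "set_integrable lborel {0..} (\<lambda>t. f t * \<theta> (exp (- t)))" if \<theta>: "continuous_on UNIV \<theta>" for \<theta> :: "real \<Rightarrow> real"
  proof -
    have "compact (\<theta> ` {0..1})"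
      by (intro compact_continuous_image continuous_on_subset[OF \<theta>]) auto
    then obtain B where B: "\<And>x. x \<in> {0..1} \<Longrightarrow> \<bar>\<theta> x\<bar> \<le> B"
      using compact_imp_bounded bounded_iff by (metis imageI real_norm_def)
    have [measurable]: "\<theta> \<in> borel_measurable borel" using \<theta> by (rule borel_measurable_continuous_onI)
    have m: "(\<lambda>t. indicator {0..} t *\<^sub>R f t) \<in> borel_measurable lborel"
      using int unfolding set_integrable_def by (rule borel_measurable_integrable)
    have "(\<lambda>t. (indicator {0..} t *\<^sub>R f t) * \<theta> (exp (- t))) \<in> borel_measurable lborel"
      using m by measurable
    moreover have "integrable lborel (\<lambda>t. B * \<bar>indicator {0..} t *\<^sub>R f t\<bar>)"
      using int unfolding set_integrable_def by (intro integrable_mult_right integrable_abs)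
    moreover have "norm ((indicator {0..} t *\<^sub>R f t) * \<theta> (exp (- t))) \<le> norm (B * \<bar>indicator {0..} t *\<^sub>R f t\<bar>)" for t
    proof (cases "0 \<le> t")
      case True
      then have "\<bar>\<theta> (exp (- t))\<bar> \<le> B" using B by simp
      then have "\<bar>f t\<bar> * \<bar>\<theta> (exp (- t))\<bar> \<le> \<bar>f t\<bar> * \<bar>B\<bar>" by (intro mult_left_mono) auto
      then show ?thesis using True by (simp add: abs_mult mult.commute)
    qed simp
    ultimately have "integrable lborel (\<lambda>t. (indicator {0..} t *\<^sub>R f t) * \<theta> (exp (- t)))"
      by (metis (lifting) Bochner_Integration.integrable_bound AE_I2)
    then show ?thesis by (simp add: set_integrable_def mult.assoc)
  qed
  show "set_integrable lborel {0..} (\<lambda>t. f t * \<psi> (exp (- t)))" by (rule si[OF cont])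
  define M where "M = (LINT t:{0..}|lborel. \<bar>f t\<bar>)"
  have M: "0 \<le> M" unfolding M_def set_lebesgue_integral_def by (intro integral_nonneg_AE) (auto simp: indicator_def)
  have "\<bar>LINT t:{0..}|lborel. f t * \<psi> (exp (- t))\<bar> \<le> 0"
  proof (rule field_le_epsilon)
    fix e :: real assume e: "0 < e"
    \<comment> \<open>The summand 1 covers the case \<open>M = 0\<close>.\<close>
    define \<epsilon> where "\<epsilon> = e / (M + 1)"
    have \<epsilon>: "0 < \<epsilon>" using e M by (simp add: \<epsilon>_def)
    obtain P where P: "real_polynomial_function P" "\<And>x. x \<in> {0..1} \<Longrightarrow> \<bar>\<psi> x - P x\<bar> < \<epsilon>"
      using Stone_Weierstrass_real_polynomial_function[of "{0..1::real}" \<psi> \<epsilon>] \<epsilon> continuous_on_subset[OF cont]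
      by (metis compact_Icc subset_UNIV)
    obtain a n where an: "P = (\<lambda>x. \<Sum>i\<le>n. a i * x ^ i)"
      using P(1) real_polynomial_function_iff_sum by auto
    have contP: "continuous_on UNIV P" unfolding an by (intro continuous_intros)
    have "(LINT t:{0..}|lborel. f t * P (exp (- t))) = (LINT t:{0..}|lborel. (\<Sum>i\<le>n. a i * (f t * exp (- t) ^ i)))"
      by (simp add: an sum_distrib_left mult.left_commute)
    also have "\<dots> = (\<Sum>i\<le>n. LINT t:{0..}|lborel. a i * (f t * exp (- t) ^ i))"
      using si[of "\<lambda>x. x ^ i" for i] unfolding set_integrable_def set_lebesgue_integral_def scaleR_sum_right
      by (intro Bochner_Integration.integral_sum) (simp add: mult.left_commute continuous_intros)
    also have "\<dots> = 0" by (simp add: zero)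
    finally have z: "(LINT t:{0..}|lborel. f t * P (exp (- t))) = 0" .
    have "(LINT t:{0..}|lborel. f t * \<psi> (exp (- t))) =
        (LINT t:{0..}|lborel. f t * \<psi> (exp (- t)) - f t * P (exp (- t)))"
      using set_integral_diff(2)[OF si[OF cont] si[OF contP]] z by simp
    also have "\<bar>\<dots>\<bar> \<le> (LINT t:{0..}|lborel. \<bar>f t * \<psi> (exp (- t)) - f t * P (exp (- t))\<bar>)"
      using set_integral_norm_bound[OF set_integral_diff(1)[OF si[OF cont] si[OF contP]]] by simp
    also have "\<dots> \<le> (LINT t:{0..}|lborel. \<epsilon> * \<bar>f t\<bar>)"
    proof (rule set_integral_mono)
      show "set_integrable lborel {0..} (\<lambda>t. \<bar>f t * \<psi> (exp (- t)) - f t * P (exp (- t))\<bar>)"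
        by (intro set_integrable_abs set_integral_diff si cont contP)
      show "set_integrable lborel {0..} (\<lambda>t. \<epsilon> * \<bar>f t\<bar>)"
        using int by (intro set_integrable_mult_right set_integrable_abs)
      fix t :: real assume "t \<in> {0..}"
      then have "\<bar>\<psi> (exp (- t)) - P (exp (- t))\<bar> \<le> \<epsilon>" using P(2)[of "exp (- t)"] by auto
      then have "\<bar>f t\<bar> * \<bar>\<psi> (exp (- t)) - P (exp (- t))\<bar> \<le> \<bar>f t\<bar> * \<epsilon>" by (intro mult_left_mono) auto
      then show "\<bar>f t * \<psi> (exp (- t)) - f t * P (exp (- t))\<bar> \<le> \<epsilon> * \<bar>f t\<bar>"
        by (simp add: right_diff_distrib[symmetric] abs_mult mult.commute)
    qed
    also have "\<dots> = \<epsilon> * M" by (simp add: M_def)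
    also have "\<dots> \<le> 0 + e" using e M by (simp add: \<epsilon>_def field_simps)
    finally show "\<bar>LINT t:{0..}|lborel. f t * \<psi> (exp (- t))\<bar> \<le> 0 + e" .
  qed
  then show "(LINT t:{0..}|lborel. f t * \<psi> (exp (- t))) = 0" by simp
qed

text \<open>If f were positive at s, a nonnegative bump supported near s would give a positive
  integral. The one-sided conclusion is enough, because it is applied to a difference of two
  functions and to its negative.\<close>

lemma Laplace_zero_imp_nonpos:
  fixes f :: "real \<Rightarrow> real"
  assumes int: "set_integrable lborel {0..} f"
    and zero: "\<And>n. (LINT t:{0..}|lborel. f t * exp (- t) ^ n) = 0"
    and cont: "continuous_on {0<..} f" and s: "0 < s"
  shows "f s \<le> 0"
proof (rule ccontr)
  assume "\<not> f s \<le> 0"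
  then have "0 < f s" by simp
  moreover have "(f \<longlongrightarrow> f s) (at s)"
    using cont s by (metis continuous_on_def at_within_open greaterThan_iff open_greaterThan)
  ultimately have "\<forall>\<^sub>F t in at s. 0 < f t" by (rule order_tendstoD(1)[rotated])
  then obtain d where d: "0 < d" "\<And>t. t \<noteq> s \<Longrightarrow> dist t s < d \<Longrightarrow> 0 < f t"
    unfolding eventually_at by auto
  \<comment> \<open>The bound by s keeps the interval around s inside the half-line of
    integration.\<close>
  define \<delta> where "\<delta> = min d s"
  have \<delta>: "0 < \<delta>" "\<delta> \<le> s" using d s by (auto simp: \<delta>_def)
  have pos: "0 < f t" if "t \<in> {s-\<delta><..<s+\<delta>}" for t
    using that d(2)[of t] \<open>0 < f s\<close> by (cases "t = s") (auto simp: \<delta>_def dist_real_def)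
  define a b where "a = exp (- (s + \<delta>))" and "b = exp (- (s - \<delta>))"
  \<comment> \<open>A parabola cut off at 0, positive exactly between \<open>a\<close> and
    \<open>b\<close>. Since \<open>exp (- t)\<close> decreases, \<open>a\<close> belongs to the
    right end of the time interval and \<open>b\<close> to the left end.\<close>
  define \<psi> where "\<psi> = (\<lambda>x::real. max 0 ((x - a) * (b - x)))"
  have c: "continuous_on UNIV \<psi>" unfolding \<psi>_def by (intro continuous_intros)
  have \<psi>0: "\<psi> (exp (- t)) = 0" if "t \<notin> {s-\<delta><..<s+\<delta>}" for t
  proof -
    have "t \<le> s - \<delta> \<or> s + \<delta> \<le> t" using that by auto
    then have "(exp (- t) - a) * (b - exp (- t)) \<le> 0"
    proof
      assume "t \<le> s - \<delta>"
      then have "b \<le> exp (- t)" "a \<le> exp (- t)" using \<delta> by (auto simp: a_def b_def)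
      then show ?thesis by (simp add: mult_nonneg_nonpos)
    next
      assume "s + \<delta> \<le> t"
      then have "exp (- t) \<le> b" "exp (- t) \<le> a" using \<delta> by (auto simp: a_def b_def)
      then show ?thesis by (simp add: mult_nonpos_nonneg)
    qed
    then show ?thesis by (simp add: \<psi>_def)
  qed
  have \<psi>1: "0 < \<psi> (exp (- t))" if "t \<in> {s-\<delta><..<s+\<delta>}" for t
  proof -
    have "a < exp (- t)" "exp (- t) < b" using that by (auto simp: a_def b_def)
    then have "0 < (exp (- t) - a) * (b - exp (- t))" by (intro mult_pos_pos) auto
    then show ?thesis by (simp add: \<psi>_def)
  qed
  note w = Laplace_zero_imp_weighted_zero[OF int zero c]
  have "AE t in lborel. indicator {0..} t *\<^sub>R (f t * \<psi> (exp (- t))) = 0"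
  proof (subst integral_nonneg_eq_0_iff_AE[symmetric])
    show "AE t in lborel. 0 \<le> indicator {0..} t *\<^sub>R (f t * \<psi> (exp (- t)))"
    proof (rule AE_I2)
      fix t show "0 \<le> indicator {0..} t *\<^sub>R (f t * \<psi> (exp (- t)))"
        using pos[of t] \<psi>1[of t] \<psi>0[of t] by (cases "t \<in> {s-\<delta><..<s+\<delta>}") (auto simp: indicator_def)
    qed
  qed (use w in \<open>auto simp: set_integrable_def set_lebesgue_integral_def\<close>)
  then have "AE t in lborel. t \<notin> {s-\<delta><..<s+\<delta>}"
  proof eventually_elim
    case (elim t)
    show ?case
    proof
      assume t: "t \<in> {s-\<delta><..<s+\<delta>}"
      then have "t \<in> {0..}" using \<delta> by auto
      then show False using elim pos[OF t] \<psi>1[OF t] by auto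
    qed
  qed
  then have "emeasure lborel {s-\<delta><..<s+\<delta>} = 0"
    by (subst (asm) AE_iff_measurable[of "{s-\<delta><..<s+\<delta>}"]) auto
  then show False using \<delta> by simp
qed

text \<open>The factor \<open>exp (- p0 * t)\<close> is absorbed into the function, and the
  transforms at \<open>p0 + n\<close> become the moments of the previous lemmas. It therefore
  suffices to know the transforms for large p, where the Mittag-Leffler series can be transformed
  term by term.\<close>

lemma Laplace_unique:
  fixes f g F :: "real \<Rightarrow> real"
  assumes f: "\<And>p. p0 \<le> p \<Longrightarrow> has_bochner_integral lborel (\<lambda>t. indicator {0..} t *\<^sub>R (f t * exp (- p * t))) (F p)"
    and g: "\<And>p. p0 \<le> p \<Longrightarrow> has_bochner_integral lborel (\<lambda>t. indicator {0..} t *\<^sub>R (g t * exp (- p * t))) (F p)"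
    and cont: "continuous_on {0<..} f" "continuous_on {0<..} g" and s: "0 < s"
  shows "f s = g s"
proof -
  have le: "f s \<le> g s"
    if f: "\<And>p. p0 \<le> p \<Longrightarrow> has_bochner_integral lborel (\<lambda>t. indicator {0..} t *\<^sub>R (f t * exp (- p * t))) (F p)"
    and g: "\<And>p. p0 \<le> p \<Longrightarrow> has_bochner_integral lborel (\<lambda>t. indicator {0..} t *\<^sub>R (g t * exp (- p * t))) (F p)"
    and cont: "continuous_on {0<..} f" "continuous_on {0<..} g" for f g :: "real \<Rightarrow> real"
  proof -
    define h where "h = (\<lambda>t. (f t - g t) * exp (- p0 * t))"
    have hb: "has_bochner_integral lborel (\<lambda>t. indicator {0..} t *\<^sub>R (h t * exp (- t) ^ n)) 0" for n
    proof -
      have "has_bochner_integral lborel (\<lambda>t. indicator {0..} t *\<^sub>R (f t * exp (- (p0 + real n) * t))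
         - indicator {0..} t *\<^sub>R (g t * exp (- (p0 + real n) * t))) (F (p0 + real n) - F (p0 + real n))"
        by (intro has_bochner_integral_diff f g) auto
      moreover have "indicator {0..} t *\<^sub>R (f t * exp (- (p0 + real n) * t))
         - indicator {0..} t *\<^sub>R (g t * exp (- (p0 + real n) * t)) = indicator {0..} t *\<^sub>R (h t * exp (- t) ^ n)" for t
      proof -
        have "exp (- (p0 + real n) * t) = exp (- p0 * t) * exp (- t) ^ n"
          by (simp add: exp_add[symmetric] exp_of_nat_mult[symmetric] algebra_simps)
        then show ?thesis by (simp add: h_def algebra_simps)
      qed
      ultimately show ?thesis by simp
    qed
    have "h s \<le> 0"
    proof (rule Laplace_zero_imp_nonpos[OF _ _ _ s])
      show "set_integrable lborel {0..} h"
        using hb[of 0] by (simp add: set_integrable_def has_bochner_integral_iff)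
      show "(LINT t:{0..}|lborel. h t * exp (- t) ^ n) = 0" for n
        using hb[of n] by (simp add: set_lebesgue_integral_def has_bochner_integral_iff)
      show "continuous_on {0<..} h" unfolding h_def by (intro continuous_intros cont)
    qed
    then show ?thesis by (simp add: h_def mult_le_0_iff)
  qed
  show ?thesis using le[OF f g cont] le[OF g f cont(2,1)] by simp
qed

text \<open>Tonelli's theorem for nonnegative kernels. It is used twice: with exponentials as kernel
  for the spectral representation, and with Mittag-Leffler functions for subordination.\<close>

lemma Laplace_mixture:
  fixes \<kappa> G :: "real \<Rightarrow> real" and g :: "real \<Rightarrow> real \<Rightarrow> real"
  assumes \<kappa>: "integrable lborel \<kappa>" "\<And>x. 0 \<le> \<kappa> x"
    and [measurable]: "case_prod g \<in> borel_measurable (borel \<Otimes>\<^sub>M borel)"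
    and g: "\<And>x t. 0 \<le> t \<Longrightarrow> 0 \<le> g x t" "\<And>x t. 0 \<le> t \<Longrightarrow> g x t \<le> 1"
    and G: "\<And>x. has_bochner_integral lborel (\<lambda>t. indicator {0..} t *\<^sub>R (g x t * exp (- p * t))) (G x)"
    and V: "has_bochner_integral lborel (\<lambda>x. \<kappa> x * G x) V"
  shows "has_bochner_integral lborel (\<lambda>t. indicator {0..} t *\<^sub>R ((\<integral>x. \<kappa> x * g x t \<partial>lborel) * exp (- p * t))) V"
proof -
  have [measurable]: "\<kappa> \<in> borel_measurable borel" using \<kappa>(1) by auto
  have G0: "0 \<le> G x" for x
  proof -
    have "0 \<le> (\<integral>t. indicator {0..} t *\<^sub>R (g x t * exp (- p * t)) \<partial>lborel)"
      using g(1) by (intro Bochner_Integration.integral_nonneg) (auto simp: indicator_def)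
    then show ?thesis using has_bochner_integral_integral_eq[OF G[of x]] by simp
  qed
  have gi: "integrable lborel (\<lambda>x. \<kappa> x * g x t)" if "0 \<le> t" for t
    using \<kappa> g[OF that] by (intro Bochner_Integration.integrable_bound[OF \<kappa>(1)])
      (auto intro!: AE_I2 simp: abs_mult mult_left_le)
  have "0 \<le> (\<integral>x. \<kappa> x * G x \<partial>lborel)"
    using \<kappa>(2) G0 by (intro Bochner_Integration.integral_nonneg) auto
  then have V0: "0 \<le> V" using has_bochner_integral_integral_eq[OF V] by simp
  show ?thesis
  proof (rule has_bochner_integral_nn_integral)
    have "(\<integral>\<^sup>+t. ennreal (indicator {0..} t *\<^sub>R ((\<integral>x. \<kappa> x * g x t \<partial>lborel) * exp (- p * t))) \<partial>lborel)
      = (\<integral>\<^sup>+t. (\<integral>\<^sup>+x. ennreal (\<kappa> x * (indicator {0..} t *\<^sub>R (g x t * exp (- p * t)))) \<partial>lborel) \<partial>lborel)"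
    proof (rule nn_integral_cong)
      fix t :: real
      show "ennreal (indicator {0..} t *\<^sub>R ((\<integral>x. \<kappa> x * g x t \<partial>lborel) * exp (- p * t)))
        = (\<integral>\<^sup>+x. ennreal (\<kappa> x * (indicator {0..} t *\<^sub>R (g x t * exp (- p * t)))) \<partial>lborel)"
      proof (cases "0 \<le> t")
        case True
        have "(\<integral>\<^sup>+x. ennreal (\<kappa> x * g x t * exp (- p * t)) \<partial>lborel) = ennreal (\<integral>x. \<kappa> x * g x t * exp (- p * t) \<partial>lborel)"
          using gi[OF True] g[OF True] \<kappa>(2) by (intro nn_integral_eq_integral) auto
        moreover have "(\<integral>x. \<kappa> x * g x t * exp (- p * t) \<partial>lborel) = (\<integral>x. \<kappa> x * g x t \<partial>lborel) * exp (- p * t)"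
          by (rule integral_mult_left_zero)
        ultimately show ?thesis using True by (simp add: mult.assoc)
      qed simp
    qed
    also have "\<dots> = (\<integral>\<^sup>+x. (\<integral>\<^sup>+t. ennreal (\<kappa> x * (indicator {0..} t *\<^sub>R (g x t * exp (- p * t)))) \<partial>lborel) \<partial>lborel)"
      by (rule lborel_pair.Fubini') measurable
    also have "\<dots> = (\<integral>\<^sup>+x. ennreal (\<kappa> x * G x) \<partial>lborel)"
    proof (rule nn_integral_cong)
      fix x :: real
      have "has_bochner_integral lborel (\<lambda>t. \<kappa> x * (indicator {0..} t *\<^sub>R (g x t * exp (- p * t)))) (\<kappa> x * G x)"
        by (intro has_bochner_integral_mult_right G)
      then show "(\<integral>\<^sup>+t. ennreal (\<kappa> x * (indicator {0..} t *\<^sub>R (g x t * exp (- p * t)))) \<partial>lborel) = ennreal (\<kappa> x * G x)"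
        using g \<kappa>(2) unfolding has_bochner_integral_iff
        by (subst nn_integral_eq_integral) (auto simp: indicator_def)
    qed
    also have "\<dots> = ennreal V"
      using V \<kappa>(2) G0 unfolding has_bochner_integral_iff by (subst nn_integral_eq_integral) auto
    finally show "(\<integral>\<^sup>+t. ennreal (indicator {0..} t *\<^sub>R ((\<integral>x. \<kappa> x * g x t \<partial>lborel) * exp (- p * t))) \<partial>lborel) = ennreal V" .
    show "AE t in lborel. 0 \<le> indicator {0..} t *\<^sub>R ((\<integral>x. \<kappa> x * g x t \<partial>lborel) * exp (- p * t))"
      using g \<kappa>(2) by (auto simp: indicator_def intro!: AE_I2 mult_nonneg_nonneg Bochner_Integration.integral_nonneg)
  qed (use V0 in measurable)
qed

lemma continuous_on_mixture:
  fixes \<kappa> :: "real \<Rightarrow> real" and g :: "real \<Rightarrow> real \<Rightarrow> real"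
  assumes \<kappa>: "integrable lborel \<kappa>"
    and [measurable]: "\<And>t. (\<lambda>x. g x t) \<in> borel_measurable borel"
    and g: "\<And>x t. t \<in> S \<Longrightarrow> \<bar>g x t\<bar> \<le> 1" "\<And>x. continuous_on S (g x)"
  shows "continuous_on S (\<lambda>t. \<integral>x. \<kappa> x * g x t \<partial>lborel)"
  unfolding continuous_on_sequentially
proof (intro allI ballI impI)
  fix X t assume t: "t \<in> S" and X: "(\<forall>n. X n \<in> S) \<and> X \<longlonglongrightarrow> t"
  have [measurable]: "\<kappa> \<in> borel_measurable borel" using \<kappa> by auto
  have "(\<lambda>n. \<integral>x. \<kappa> x * g x (X n) \<partial>lborel) \<longlonglongrightarrow> (\<integral>x. \<kappa> x * g x t \<partial>lborel)"
  proof (rule integral_dominated_convergence[where w="\<lambda>x. \<bar>\<kappa> x\<bar>"])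
    show "AE x in lborel. (\<lambda>n. \<kappa> x * g x (X n)) \<longlonglongrightarrow> \<kappa> x * g x t"
      using g(2) X t unfolding continuous_on_sequentially o_def by (intro AE_I2 tendsto_mult tendsto_const) blast
    show "AE x in lborel. norm (\<kappa> x * g x (X n)) \<le> \<bar>\<kappa> x\<bar>" for n
      using g(1)[of "X n"] X by (auto intro!: AE_I2 simp: abs_mult mult_left_le)
  qed (use \<kappa> in auto)
  then show "((\<lambda>t. \<integral>x. \<kappa> x * g x t \<partial>lborel) \<circ> X) \<longlonglongrightarrow> (\<integral>x. \<kappa> x * g x t \<partial>lborel)"
    by (simp add: o_def)
qed

lemma integral_lborel_pos:
  fixes f :: "real \<Rightarrow> real"
  assumes "integrable lborel f" "\<And>x. 0 < f x"
  shows "0 < integral\<^sup>L lborel f"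
proof (rule ccontr)
  assume "\<not> 0 < integral\<^sup>L lborel f"
  moreover have "0 \<le> integral\<^sup>L lborel f" using assms(2) by (simp add: less_imp_le)
  ultimately have "integral\<^sup>L lborel f = 0" by simp
  then have "AE x in lborel. f x = 0"
    using integral_nonneg_eq_0_iff_AE[OF assms(1)] assms(2) by (simp add: less_imp_le)
  then have "AE x in lborel. x \<notin> (UNIV :: real set)"
    by eventually_elim (metis assms(2) less_irrefl)
  then show False by (simp add: AE_iff_measurable[of UNIV])
qed

section \<open>The spectral representation and complete monotonicity in time\<close>

context
  fixes \<rho> l :: real
  assumes \<rho>: "0 < \<rho>" "\<rho> < 1" and l: "0 < l"
begin

text \<open>The Stieltjes formula is multiplied by p and p runs through the positive integers: the
  factor \<open>p / (exp x + p)\<close> increases to 1, while the right-hand side tends to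
  1.\<close>

lemma spectral_density_integral: "has_bochner_integral lborel (spectral_density \<rho> l) 1"
proof -
  let ?k = "spectral_density \<rho> l"
  note k0 = spectral_density_pos[OF \<rho> l]
  note [measurable] = spectral_density_measurable[OF \<rho> l]
  have hb: "has_bochner_integral lborel (\<lambda>x. real (Suc n) * (?k x / (exp x + real (Suc n))))
     (real (Suc n) * (real (Suc n) powr (\<rho> - 1) / (real (Suc n) powr \<rho> + l)))" for n
    by (intro has_bochner_integral_mult_right spectral_density_Stieltjes[OF \<rho> l]) simp
  show ?thesis
  proof (rule has_bochner_integral_monotone_convergence)
    show "integrable lborel (\<lambda>x. real (Suc n) * (?k x / (exp x + real (Suc n))))" for n
      using hb[of n] by (simp only: has_bochner_integral_iff)
    show "AE x in lborel. mono (\<lambda>n. real (Suc n) * (?k x / (exp x + real (Suc n))))"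
    proof (rule AE_I2, rule monoI)
      fix x and m n :: nat assume "m \<le> n"
      then have "real (Suc m) * exp x \<le> real (Suc n) * exp x" by (intro mult_right_mono) auto
      moreover have "0 < exp x + real (Suc m)" "0 < exp x + real (Suc n)" by (auto intro: add_pos_nonneg)
      ultimately have "real (Suc m) / (exp x + real (Suc m)) \<le> real (Suc n) / (exp x + real (Suc n))"
        by (simp add: divide_le_eq le_divide_eq algebra_simps)
      from mult_left_mono[OF this, of "?k x"]
      show "real (Suc m) * (?k x / (exp x + real (Suc m))) \<le> real (Suc n) * (?k x / (exp x + real (Suc n)))"
        using k0[of x] by (simp add: mult.commute)
    qed
    have "((\<lambda>n. real (Suc n) / (exp x + real (Suc n))) \<longlonglongrightarrow> 1)" for x by real_asymp
    from tendsto_mult[OF tendsto_const[of "?k x" for x] this]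
    show "AE x in lborel. (\<lambda>n. real (Suc n) * (?k x / (exp x + real (Suc n)))) \<longlonglongrightarrow> ?k x"
      by (intro AE_I2) (simp add: mult.commute)
    have "(\<lambda>n. real (Suc n) * (real (Suc n) powr (\<rho> - 1) / (real (Suc n) powr \<rho> + l))) \<longlonglongrightarrow> 1"
      using \<rho> l by real_asymp
    moreover have "(\<integral>x. real (Suc n) * (?k x / (exp x + real (Suc n))) \<partial>lborel) = real (Suc n) * (real (Suc n) powr (\<rho> - 1) / (real (Suc n) powr \<rho> + l))" for n
      using hb[of n] by (simp only: has_bochner_integral_iff)
    ultimately show "(\<lambda>n. \<integral>x. real (Suc n) * (?k x / (exp x + real (Suc n))) \<partial>lborel) \<longlonglongrightarrow> 1" by simp
  qed simp
qed

lemma spectral_density_integrable: "integrable lborel (spectral_density \<rho> l)"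
  using spectral_density_integral by (simp add: has_bochner_integral_iff)

lemma continuous_on_mittag_leffler_time: "continuous_on {0..} (\<lambda>t. mittag_leffler \<rho> (c * t powr \<rho>))"
proof (rule continuous_on_compose2[of UNIV "mittag_leffler \<rho>"])
  show "continuous_on UNIV (mittag_leffler \<rho>)"
    using isCont_mittag_leffler[OF \<rho>(1)] by (simp add: continuous_on_eq_continuous_at)
  have "continuous_on {0..} (\<lambda>t::real. t powr \<rho>)"
    using \<rho> by (intro continuous_on_powr' continuous_intros) auto
  then show "continuous_on {0..} (\<lambda>t. c * t powr \<rho>)" by (rule continuous_on_mult[OF continuous_on_const])
qed simp

lemma exp_kernel_Laplace:
  fixes p x :: real
  assumes "0 < p"
  shows "has_bochner_integral lborel (\<lambda>t. indicator {0..} t *\<^sub>R (exp (- exp x * t) * exp (- p * t))) (1 / (exp x + p))"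
proof -
  have "AE t::real in lborel. indicator {0..} t *\<^sub>R (t powr (1 - 1) * exp (- (exp x + p) * t)) = indicator {0..} t *\<^sub>R (exp (- exp x * t) * exp (- p * t))"
    using AE_lborel_singleton[of "0::real"]
    by eventually_elim (auto simp: indicator_def exp_add[symmetric] algebra_simps)
  then show ?thesis
    using Laplace_power[of 1 "exp x + p"] assms
    by (subst has_bochner_integral_cong_AE[symmetric]) (auto simp: add_pos_pos)
qed

lemma spectral_mixture_Laplace:
  assumes "0 < p"
  shows "has_bochner_integral lborel (\<lambda>t. indicator {0..} t *\<^sub>R ((\<integral>x. spectral_density \<rho> l x * exp (- exp x * t) \<partial>lborel) * exp (- p * t)))
    (p powr (\<rho> - 1) / (p powr \<rho> + l))"
proof (rule Laplace_mixture[where G="\<lambda>x. 1 / (exp x + p)"])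
  show "has_bochner_integral lborel (\<lambda>x. spectral_density \<rho> l x * (1 / (exp x + p))) (p powr (\<rho> - 1) / (p powr \<rho> + l))"
    using spectral_density_Stieltjes[OF \<rho> l assms] by simp
qed (use spectral_density_integrable spectral_density_pos[OF \<rho> l] exp_kernel_Laplace[OF assms] in \<open>auto intro: less_imp_le\<close>)

lemma mittag_leffler_eq_mixture:
  assumes "0 \<le> t"
  shows "mittag_leffler \<rho> (- l * t powr \<rho>) = (\<integral>x. spectral_density \<rho> l x * exp (- exp x * t) \<partial>lborel)"
proof (cases "t = 0")
  case True
  then show ?thesis using spectral_density_integral by (simp add: mittag_leffler_0 has_bochner_integral_iff)
next
  case False
  with assms have t: "0 < t" by simp
  \<comment> \<open>From here on \<open>p powr \<rho>\<close> is at least \<open>l + 1\<close>, so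
    the geometric series behind the transform of the Mittag-Leffler function converges.\<close>
  define p0 where "p0 = (l + 1) powr (1 / \<rho>)"
  have p0: "0 < p0" "p0 powr \<rho> = l + 1" using l \<rho> by (auto simp: p0_def powr_powr)
  have p: "0 < p \<and> l < p powr \<rho>" if "p0 \<le> p" for p
  proof -
    have "p0 powr \<rho> \<le> p powr \<rho>" using that p0 \<rho> by (intro powr_mono2) auto
    then show ?thesis using that p0 by auto
  qed
  show ?thesis
  proof (rule Laplace_unique[OF _ _ _ _ t])
    show "has_bochner_integral lborel (\<lambda>t. indicator {0..} t *\<^sub>R (mittag_leffler \<rho> (- l * t powr \<rho>) * exp (- p * t)))
      (p powr (\<rho> - 1) / (p powr \<rho> + l))" if "p0 \<le> p" for p
      using Laplace_mittag_leffler_large[OF \<rho>(1), of p "- l"] p[OF that] l by simp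
    show "has_bochner_integral lborel (\<lambda>t. indicator {0..} t *\<^sub>R ((\<integral>x. spectral_density \<rho> l x * exp (- exp x * t) \<partial>lborel) * exp (- p * t)))
      (p powr (\<rho> - 1) / (p powr \<rho> + l))" if "p0 \<le> p" for p
      using spectral_mixture_Laplace p[OF that] by simp
    show "continuous_on {0<..} (\<lambda>t. mittag_leffler \<rho> (- l * t powr \<rho>))"
      by (rule continuous_on_subset[OF continuous_on_mittag_leffler_time]) auto
    show "continuous_on {0<..} (\<lambda>t. \<integral>x. spectral_density \<rho> l x * exp (- exp x * t) \<partial>lborel)"
      by (intro continuous_on_mixture spectral_density_integrable continuous_intros) auto
  qed
qed

lemma mittag_leffler_spectral:
  assumes "0 \<le> t"
  shows "has_bochner_integral lborel (\<lambda>x. spectral_density \<rho> l x * exp (- exp x * t)) (mittag_leffler \<rho> (- l * t powr \<rho>))"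
  unfolding has_bochner_integral_iff mittag_leffler_eq_mixture[OF assms]
  using spectral_density_measurable[OF \<rho> l] assms
  by (auto intro!: Bochner_Integration.integrable_bound[OF spectral_density_integrable] AE_I2 simp: abs_mult mult_left_le)

text \<open>The representation as a mixture of exponentials removes the lower bound on p that the
  series argument imposes. Subordination depends on this: there p is fixed while the coefficient
  \<open>exp x\<close> is unbounded.\<close>

lemma mittag_leffler_Laplace:
  assumes "0 < p"
  shows "has_bochner_integral lborel (\<lambda>t. indicator {0..} t *\<^sub>R (mittag_leffler \<rho> (- l * t powr \<rho>) * exp (- p * t)))
      (p powr (\<rho> - 1) / (p powr \<rho> + l))"
proof -
  have "indicator {0..} t *\<^sub>R (mittag_leffler \<rho> (- l * t powr \<rho>) * exp (- p * t)) =
    indicator {0..} t *\<^sub>R ((\<integral>x. spectral_density \<rho> l x * exp (- exp x * t) \<partial>lborel) * exp (- p * t))" for t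
    using mittag_leffler_eq_mixture[of t] by (cases "0 \<le> t") (simp_all only: indicator_simps atLeast_iff scaleR_zero_left, simp)
  then show ?thesis using spectral_mixture_Laplace[OF assms] by (simp only:)
qed

lemma mittag_leffler_nonneg: "0 \<le> t \<Longrightarrow> 0 \<le> mittag_leffler \<rho> (- l * t powr \<rho>)"
  using spectral_density_pos[OF \<rho> l] unfolding mittag_leffler_eq_mixture
  by (auto simp: less_imp_le intro!: Bochner_Integration.integral_nonneg)

text \<open>A mixture of strictly decreasing exponentials with an everywhere positive density is
  strictly decreasing.\<close>

lemma mittag_leffler_strict_antimono:
  assumes "0 \<le> s" "s < t"
  shows "mittag_leffler \<rho> (- l * t powr \<rho>) < mittag_leffler \<rho> (- l * s powr \<rho>)"
proof -
  have st: "0 \<le> s" "0 \<le> t" using assms by auto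
  have "has_bochner_integral lborel
      (\<lambda>x. spectral_density \<rho> l x * exp (- exp x * s) - spectral_density \<rho> l x * exp (- exp x * t))
      (mittag_leffler \<rho> (- l * s powr \<rho>) - mittag_leffler \<rho> (- l * t powr \<rho>))"
    by (intro has_bochner_integral_diff mittag_leffler_spectral st)
  moreover have "0 < spectral_density \<rho> l x * exp (- exp x * s) - spectral_density \<rho> l x * exp (- exp x * t)" for x
    using spectral_density_pos[OF \<rho> l, of x] assms by simp
  ultimately show ?thesis
    using integral_lborel_pos[of "\<lambda>x. spectral_density \<rho> l x * exp (- exp x * s) - spectral_density \<rho> l x * exp (- exp x * t)"]
    unfolding has_bochner_integral_iff by simp
qed

lemma mittag_leffler_le_1: "0 \<le> t \<Longrightarrow> mittag_leffler \<rho> (- l * t powr \<rho>) \<le> 1"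
  using mittag_leffler_strict_antimono[of 0 t] by (cases "t = 0") (auto simp: mittag_leffler_0)

end

text \<open>Both sides have the Laplace transform \<open>p powr (\<alpha> * \<beta> - 1) / (p powr (\<alpha> * \<beta>) + l)\<close>.\<close>

lemma mittag_leffler_subordination:
  assumes \<alpha>: "0 < \<alpha>" "\<alpha> < 1" and \<beta>: "0 < \<beta>" "\<beta> < 1" and l: "0 < l" and t: "0 < t"
  shows "mittag_leffler (\<alpha> * \<beta>) (- l * t powr (\<alpha> * \<beta>)) =
    (\<integral>x. spectral_density \<alpha> l x * mittag_leffler \<beta> (- exp x * t powr \<beta>) \<partial>lborel)"
proof -
  have ab: "0 < \<alpha> * \<beta>" "\<alpha> * \<beta> < 1" using \<alpha> \<beta> mult_strict_mono[of \<alpha> 1 \<beta> 1] by auto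
  note k = spectral_density_integrable[OF \<alpha> l] spectral_density_pos[OF \<alpha> l]
  note [measurable] = mittag_leffler_measurable[OF \<beta>(1)]
  show ?thesis
  proof (rule Laplace_unique[OF _ _ _ _ t])
    fix p :: real assume "1 \<le> p"
    then have p: "0 < p" by simp
    show "has_bochner_integral lborel (\<lambda>t. indicator {0..} t *\<^sub>R (mittag_leffler (\<alpha> * \<beta>) (- l * t powr (\<alpha> * \<beta>)) * exp (- p * t)))
      (p powr (\<alpha> * \<beta> - 1) / (p powr (\<alpha> * \<beta>) + l))"
      by (rule mittag_leffler_Laplace[OF ab l p])
    show "has_bochner_integral lborel (\<lambda>t. indicator {0..} t *\<^sub>R ((\<integral>x. spectral_density \<alpha> l x * mittag_leffler \<beta> (- exp x * t powr \<beta>) \<partial>lborel) * exp (- p * t)))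
      (p powr (\<alpha> * \<beta> - 1) / (p powr (\<alpha> * \<beta>) + l))"
    proof (rule Laplace_mixture[where G="\<lambda>x. p powr (\<beta> - 1) / (p powr \<beta> + exp x)"])
      \<comment> \<open>The Stieltjes formula for \<alpha> is taken at the point
        \<open>p powr \<beta>\<close>; the factor \<open>p powr (\<beta> - 1)\<close> belongs to the
        transform of the inner function.\<close>
      have "has_bochner_integral lborel (\<lambda>x. p powr (\<beta> - 1) * (spectral_density \<alpha> l x / (exp x + p powr \<beta>)))
        (p powr (\<beta> - 1) * ((p powr \<beta>) powr (\<alpha> - 1) / ((p powr \<beta>) powr \<alpha> + l)))"
        using p by (intro has_bochner_integral_mult_right spectral_density_Stieltjes[OF \<alpha> l]) simp
      moreover have "p powr (\<beta> - 1) * ((p powr \<beta>) powr (\<alpha> - 1) / ((p powr \<beta>) powr \<alpha> + l)) =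
        p powr (\<alpha> * \<beta> - 1) / (p powr (\<alpha> * \<beta>) + l)"
        using p by (simp add: powr_powr powr_add[symmetric] algebra_simps)
      ultimately show "has_bochner_integral lborel (\<lambda>x. spectral_density \<alpha> l x * (p powr (\<beta> - 1) / (p powr \<beta> + exp x)))
        (p powr (\<alpha> * \<beta> - 1) / (p powr (\<alpha> * \<beta>) + l))" by (simp add: mult.commute add.commute)
      show "has_bochner_integral lborel (\<lambda>t. indicator {0..} t *\<^sub>R (mittag_leffler \<beta> (- exp x * t powr \<beta>) * exp (- p * t)))
         (p powr (\<beta> - 1) / (p powr \<beta> + exp x))" for x
        by (rule mittag_leffler_Laplace[OF \<beta> exp_gt_zero p])
      show "0 \<le> mittag_leffler \<beta> (- exp x * t powr \<beta>)" "mittag_leffler \<beta> (- exp x * t powr \<beta>) \<le> 1" if "0 \<le> t" for x t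
        using mittag_leffler_nonneg[OF \<beta> exp_gt_zero that] mittag_leffler_le_1[OF \<beta> exp_gt_zero that] by auto
    qed (use k in \<open>auto intro: less_imp_le\<close>)
  next
    show "continuous_on {0<..} (\<lambda>t. mittag_leffler (\<alpha> * \<beta>) (- l * t powr (\<alpha> * \<beta>)))"
      by (rule continuous_on_subset[OF continuous_on_mittag_leffler_time[OF ab l]]) auto
    show "continuous_on {0<..} (\<lambda>t. \<integral>x. spectral_density \<alpha> l x * mittag_leffler \<beta> (- exp x * t powr \<beta>) \<partial>lborel)"
    proof (rule continuous_on_mixture[OF k(1)])
      show "\<bar>mittag_leffler \<beta> (- exp x * t powr \<beta>)\<bar> \<le> 1" if "t \<in> {0<..}" for x t
        using mittag_leffler_nonneg[OF \<beta> exp_gt_zero, of t x] mittag_leffler_le_1[OF \<beta> exp_gt_zero, of t x] that by auto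
      show "continuous_on {0<..} (\<lambda>t. mittag_leffler \<beta> (- exp x * t powr \<beta>))" for x
        by (rule continuous_on_subset[OF continuous_on_mittag_leffler_time[OF \<beta> l]]) auto
    qed measurable
  qed
qed

section \<open>Dependence on the order\<close>

lemma set_integral_reflect:
  fixes F :: "real \<Rightarrow> 'b::{banach,second_countable_topology}"
  shows "set_integrable lborel {0..t} (\<lambda>s. F (t - s)) \<longleftrightarrow> set_integrable lborel {0..t} F"
    and "(LINT s:{0..t}|lborel. F (t - s)) = (LINT x:{0..t}|lborel. F x)"
proof -
  have eq: "indicator {0..t} s *\<^sub>R F (t - s) = (\<lambda>x. indicator {0..t} x *\<^sub>R F x) (t + (-1) * s)" for s
    by (auto simp: indicator_def)
  show "set_integrable lborel {0..t} (\<lambda>s. F (t - s)) \<longleftrightarrow> set_integrable lborel {0..t} F"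
    unfolding set_integrable_def eq by (rule lborel_integrable_real_affine_iff) simp
  show "(LINT s:{0..t}|lborel. F (t - s)) = (LINT x:{0..t}|lborel. F x)"
    unfolding set_lebesgue_integral_def eq
    by (subst lborel_integral_real_affine[where c="-1" and t=t and f="\<lambda>x. indicator {0..t} x *\<^sub>R F x"]) auto
qed

lemma mittag_leffler_differentiable:
  assumes "0 < \<rho>"
  shows "\<exists>D. (mittag_leffler \<rho> has_real_derivative D) (at z)"
proof -
  have "summable (\<lambda>n. (1 / Gamma (\<rho> * real n + 1)) * y ^ n)" for y
    using mittag_leffler2_summable[OF assms order_refl, of y] by simp
  from termdiffs_strong_converges_everywhere[OF this]
  have "((\<lambda>x. \<Sum>n. (1 / Gamma (\<rho> * real n + 1)) * x ^ n) has_real_derivative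
     (\<Sum>n. diffs (\<lambda>n. 1 / Gamma (\<rho> * real n + 1)) n * z ^ n)) (at z)" .
  moreover have "(\<lambda>x. \<Sum>n. (1 / Gamma (\<rho> * real n + 1)) * x ^ n) = mittag_leffler \<rho>"
    by (simp add: mittag_leffler_def fun_eq_iff)
  ultimately show ?thesis by auto
qed

context
  fixes \<rho> l :: real
  assumes \<rho>: "0 < \<rho>" "\<rho> < 1" and l: "0 < l"
begin

text \<open>The Volterra equations at \<open>t + h\<close> and t are subtracted. The kernel may then
  be replaced by its value at t, and what is left is the integral of a decreasing function over an
  interval of length h. Working with increments avoids differentiating a weakly singular
  integral.\<close>

lemma mittag_leffler_increment:
  assumes t: "0 < t" and h: "0 < h"
  shows "mittag_leffler \<rho> (- l * t powr \<rho>) - mittag_leffler \<rho> (- l * (t + h) powr \<rho>)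
     \<le> l / Gamma \<rho> * t powr (\<rho> - 1) * (h * mittag_leffler \<rho> (- l * t powr \<rho>))"
proof -
  define e where "e = (\<lambda>t. mittag_leffler \<rho> (- l * t powr \<rho>))"
  \<comment> \<open>The kernel is attached to s and the moving time to \<open>e\<close>, so that the
    integrals for \<open>t + h\<close> and t carry the same weight and can be subtracted
    pointwise.\<close>
  define C where "C = (\<lambda>t. LINT s:{0..t}|lborel. s powr (\<rho> - 1) * e (t - s))"
  define I where "I = (\<lambda>t. LINT s:{0..t}|lborel. e (t - s))"
  have e0: "0 \<le> e x" if "0 \<le> x" for x using mittag_leffler_nonneg[OF \<rho> l that] by (simp add: e_def)
  have eanti: "e y \<le> e x" if "0 \<le> x" "x \<le> y" for x y
    using mittag_leffler_strict_antimono[OF \<rho> l that(1), of y] that(2) by (cases "x = y") (auto simp: e_def)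
  have e_cont: "continuous_on {0..} e"
    unfolding e_def by (rule continuous_on_mittag_leffler_time[OF \<rho> l])
  have Ci: "set_integrable lborel {0..t} (\<lambda>s. s powr (\<rho> - 1) * e (t - s))"
    and C: "C t * (- l) = Gamma \<rho> * (e t - 1)" if "0 < t" for t
    using mittag_leffler_convolution(1)[OF \<rho>(1,1) that, of "- l"] mittag_leffler_volterra[OF \<rho>(1) that, of "- l"]
      set_integral_reflect[of t "\<lambda>x. (t - x) powr (\<rho> - 1) * e x"]
    unfolding C_def e_def by simp_all
  have ei: "set_integrable lborel {a..b} e" if "0 \<le> a" for a b
    by (rule borel_integrable_atLeastAtMost') (rule continuous_on_subset[OF e_cont], use that in auto)
  have Ii: "set_integrable lborel {0..t} (\<lambda>s. e (t - s))" for t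
    using ei[of 0 t] set_integral_reflect(1)[of t e] by simp
  define D where "D = (\<lambda>s. indicator {0..t+h} s * e (t + h - s) - indicator {0..t} s * e (t - s))"
  have Di: "integrable lborel D" and DI: "integral\<^sup>L lborel D = I (t + h) - I t"
    using Ii[of "t+h"] Ii[of t] unfolding D_def I_def set_integrable_def set_lebesgue_integral_def by simp_all
  have aDi: "integrable lborel (\<lambda>s. s powr (\<rho> - 1) * D s)" and aDI: "(\<integral>s. s powr (\<rho> - 1) * D s \<partial>lborel) = C (t + h) - C t"
  proof -
    have "(\<lambda>s. s powr (\<rho> - 1) * D s) = (\<lambda>s. indicator {0..t+h} s *\<^sub>R (s powr (\<rho> - 1) * e (t + h - s)) - indicator {0..t} s *\<^sub>R (s powr (\<rho> - 1) * e (t - s)))"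
      by (auto simp: D_def fun_eq_iff algebra_simps)
    then show "integrable lborel (\<lambda>s. s powr (\<rho> - 1) * D s)" "(\<integral>s. s powr (\<rho> - 1) * D s \<partial>lborel) = C (t + h) - C t"
      using Ci[of "t+h"] Ci[of t] t h unfolding C_def set_integrable_def set_lebesgue_integral_def by simp_all
  qed
  \<comment> \<open>\<open>D\<close> changes sign from negative to positive at \<open>t\<close>, and the kernel is decreasing\<close>
  have "(\<integral>s. s powr (\<rho> - 1) * D s \<partial>lborel) \<le> (\<integral>s. t powr (\<rho> - 1) * D s \<partial>lborel)"
  proof (rule integral_mono_AE[OF aDi])
    show "AE s in lborel. s powr (\<rho> - 1) * D s \<le> t powr (\<rho> - 1) * D s"
      using AE_lborel_singleton[of "0::real"]
    proof eventually_elim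
      fix s :: real assume s: "s \<noteq> 0"
      consider "s < 0" | "0 < s" "s \<le> t" | "t < s" using s by linarith
      then show "s powr (\<rho> - 1) * D s \<le> t powr (\<rho> - 1) * D s"
      proof cases
        case 1 then show ?thesis by (simp add: D_def)
      next
        case 2
        then have "D s = e (t + h - s) - e (t - s)" using h by (simp add: D_def)
        then have "D s \<le> 0" using eanti[of "t - s" "t + h - s"] 2 h by simp
        moreover have "t powr (\<rho> - 1) \<le> s powr (\<rho> - 1)" using 2 \<rho> by (intro powr_mono2') auto
        ultimately show ?thesis by (rule mult_right_mono_neg[rotated])
      next
        case 3
        then have "0 \<le> D s" using e0 by (auto simp: D_def indicator_def)
        moreover have "s powr (\<rho> - 1) \<le> t powr (\<rho> - 1)" using 3 t \<rho> by (intro powr_mono2') auto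
        ultimately show ?thesis by (rule mult_right_mono[rotated])
      qed
    qed
  qed (use Di in simp)
  then have C_le: "C (t + h) - C t \<le> t powr (\<rho> - 1) * (I (t + h) - I t)"
    unfolding aDI using DI by simp
  have "I (t + h) = (LINT x:{0..t+h}|lborel. e x)" "I t = (LINT x:{0..t}|lborel. e x)"
    unfolding I_def by (rule set_integral_reflect(2))+
  moreover have "(LINT x:{0..t+h}|lborel. e x) = (LINT x:{0..t}|lborel. e x) + (LINT x:{t..t+h}|lborel. e x)"
  proof -
    have "integral {0..t+h} e = integral {0..t} e + integral {t..t+h} e"
      using t h by (intro Henstock_Kurzweil_Integration.integral_combine[symmetric] integrable_continuous_real continuous_on_subset[OF e_cont]) auto
    then show ?thesis using ei[of 0 "t+h"] ei[of 0 t] ei[of t "t+h"] t by (simp add: set_borel_integral_eq_integral)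
  qed
  moreover have "(LINT x:{t..t+h}|lborel. e x) \<le> (LINT x:{t..t+h}|lborel. e t)"
    using t by (intro set_integral_mono ei eanti borel_integrable_atLeastAtMost') auto
  moreover have "(LINT x:{t..t+h}|lborel. e t) = h * e t"
    using h by (simp add: set_lebesgue_integral_def)
  ultimately have "I (t + h) - I t \<le> h * e t" by simp
  then have "t powr (\<rho> - 1) * (I (t + h) - I t) \<le> t powr (\<rho> - 1) * (h * e t)" by (intro mult_left_mono) auto
  with C_le have "C (t + h) - C t \<le> t powr (\<rho> - 1) * (h * e t)" by simp
  moreover have G: "0 < Gamma \<rho>" using \<rho> by simp
  moreover have "Gamma \<rho> * (e t - e (t + h)) = l * (C (t + h) - C t)"
    using C[OF t] C[of "t + h"] t h by (simp add: algebra_simps)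
  ultimately have "Gamma \<rho> * (e t - e (t + h)) \<le> l * (t powr (\<rho> - 1) * (h * e t))"
    using l by simp
  then have "e t - e (t + h) \<le> l / Gamma \<rho> * t powr (\<rho> - 1) * (h * e t)" using G by (simp add: field_simps)
  then show ?thesis by (simp add: e_def)
qed

text \<open>
  The increment bound says that the logarithmic derivative of the left-hand side is at least that
  of the right-hand side.
\<close>

lemma mittag_leffler_ge_exp:
  assumes t: "0 \<le> t"
  shows "exp (- l * t powr \<rho> / Gamma (1 + \<rho>)) \<le> mittag_leffler \<rho> (- l * t powr \<rho>)"
proof -
  define c where "c = l / Gamma (1 + \<rho>)"
  define e where "e = (\<lambda>t. mittag_leffler \<rho> (- l * t powr \<rho>))"
  have G: "0 < Gamma \<rho>" using \<rho> by simp
  have G1: "Gamma (1 + \<rho>) = \<rho> * Gamma \<rho>"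
    using Gamma_plus1[of \<rho>] \<rho> by (force elim!: nonpos_Ints_cases' simp: add.commute)
  have cr: "c * \<rho> = l / Gamma \<rho>" using G \<rho> by (simp add: c_def G1)
  have D: "\<exists>D. (e has_real_derivative D) (at s) \<and> 0 \<le> D + c * \<rho> * s powr (\<rho> - 1) * e s" if s: "0 < s" for s
  proof -
    obtain E where "(mittag_leffler \<rho> has_real_derivative E) (at (- l * s powr \<rho>))"
      using mittag_leffler_differentiable[OF \<rho>(1)] by blast
    moreover have "((\<lambda>s. - l * s powr \<rho>) has_real_derivative (- l * (\<rho> * s powr (\<rho> - 1)))) (at s)"
      using s by (auto intro!: derivative_eq_intros)
    ultimately have "(e has_real_derivative (E * (- l * (\<rho> * s powr (\<rho> - 1))))) (at s)"
      unfolding e_def by (rule DERIV_chain2)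
    then obtain D where D: "(e has_real_derivative D) (at s)" by blast
    \<comment> \<open>The derivative is known to exist, so right-hand difference quotients are
      enough to bound it from below.\<close>
    then have "((\<lambda>h. (e (s + h) - e s) / h) \<longlongrightarrow> D) (at_right 0)"
      unfolding DERIV_def by (rule tendsto_within_subset) simp
    moreover have "\<forall>\<^sub>F h in at_right 0. - (c * \<rho> * s powr (\<rho> - 1) * e s) \<le> (e (s + h) - e s) / h"
    proof (rule eventually_mono[OF eventually_at_right_less])
      fix h :: real assume h: "0 < h"
      have "e s - e (s + h) \<le> h * (c * \<rho> * s powr (\<rho> - 1) * e s)"
        using mittag_leffler_increment[OF s h] unfolding e_def cr by (simp add: mult_ac)
      then show "- (c * \<rho> * s powr (\<rho> - 1) * e s) \<le> (e (s + h) - e s) / h"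
        using h by (simp add: le_divide_eq mult.commute)
    qed
    ultimately have "- (c * \<rho> * s powr (\<rho> - 1) * e s) \<le> D"
      by (rule tendsto_lowerbound) simp
    then show ?thesis using D by auto
  qed
  \<comment> \<open>The product is nondecreasing. Derivatives are used in the open interval only,
    because \<open>s powr \<rho>\<close> is not differentiable at 0; continuity covers the
    endpoint.\<close>
  have "e 0 * exp (c * 0 powr \<rho>) \<le> e t * exp (c * t powr \<rho>)"
  proof (rule DERIV_nonneg_imp_increasing_open[OF t])
    fix s assume "0 < s" "s < t"
    then obtain D where D: "(e has_real_derivative D) (at s)" "0 \<le> D + c * \<rho> * s powr (\<rho> - 1) * e s" using D by blast
    have "((\<lambda>s. e s * exp (c * s powr \<rho>)) has_real_derivative
       (D * exp (c * s powr \<rho>) + exp (c * s powr \<rho>) * (c * (\<rho> * s powr (\<rho> - 1))) * e s)) (at s)"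
      using \<open>0 < s\<close> by (auto intro!: derivative_eq_intros D(1))
    moreover have "D * exp (c * s powr \<rho>) + exp (c * s powr \<rho>) * (c * (\<rho> * s powr (\<rho> - 1))) * e s
       = exp (c * s powr \<rho>) * (D + c * \<rho> * s powr (\<rho> - 1) * e s)" by (simp add: algebra_simps)
    ultimately show "\<exists>y. ((\<lambda>s. e s * exp (c * s powr \<rho>)) has_real_derivative y) (at s) \<and> 0 \<le> y"
      using D(2) by (metis exp_ge_zero mult_nonneg_nonneg)
  next
    have "continuous_on {0..t} (\<lambda>t::real. t powr \<rho>)"
      using \<rho> by (intro continuous_on_powr' continuous_intros) auto
    then have "continuous_on {0..t} (\<lambda>t::real. exp (c * t powr \<rho>))"
      by (intro continuous_on_exp continuous_on_mult[OF continuous_on_const])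
    moreover have "continuous_on {0..t} e"
      unfolding e_def by (rule continuous_on_subset[OF continuous_on_mittag_leffler_time[OF \<rho> l]]) auto
    ultimately show "continuous_on {0..t} (\<lambda>s. e s * exp (c * s powr \<rho>))"
      by (rule continuous_on_mult[rotated])
  qed
  then have "1 \<le> e t * exp (c * t powr \<rho>)" by (simp add: e_def mittag_leffler_0)
  then have "exp (- (c * t powr \<rho>)) \<le> e t" by (simp add: exp_minus field_simps)
  then show ?thesis by (simp add: c_def e_def)
qed

end

text \<open>Slopes of the convex function ln Gamma increase. Its slope between 2 and 3 is
  \<open>ln 2\<close>, since \<open>Gamma 2 = 1\<close> and \<open>Gamma 3 = 2\<close>, and this
  bounds the slope between \<open>1 + \<beta>\<close> and 2. The weight \<open>u\<close> expresses 2
  as a convex combination of 3 and \<open>1 + \<beta>\<close>.\<close>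

lemma Gamma_1_plus_ge:
  assumes "0 \<le> \<beta>" "\<beta> \<le> (1::real)"
  shows "2 powr (\<beta> - 1) \<le> Gamma (1 + \<beta>)"
proof -
  define u where "u = 1 / (2 - \<beta>)"
  have u: "0 \<le> u" "u \<le> 1" "u * (2 - \<beta>) = 1" using assms by (auto simp: u_def)
  have eq: "(1 - u) *\<^sub>R 3 + u *\<^sub>R (1 + \<beta>) = 2" using u(3) by (simp add: algebra_simps)
  have "(ln \<circ> Gamma) ((1 - u) *\<^sub>R 3 + u *\<^sub>R (1 + \<beta>)) \<le> (1 - u) * (ln \<circ> Gamma) 3 + u * (ln \<circ> Gamma) (1 + \<beta>)"
    using assms u by (intro convex_onD[OF log_convex_Gamma_real]) auto
  then have "(ln \<circ> Gamma) 2 \<le> (1 - u) * (ln \<circ> Gamma) 3 + u * (ln \<circ> Gamma) (1 + \<beta>)"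
    unfolding eq .
  moreover have "Gamma 2 = (1::real)" "Gamma 3 = (2::real)"
    using Gamma_fact[of 1, where 'a=real] Gamma_fact[of 2, where 'a=real] by (simp_all add: fact_numeral)
  ultimately have "0 \<le> (1 - u) * ln 2 + u * ln (Gamma (1 + \<beta>))" by simp
  then have "0 \<le> (2 - \<beta>) * ((1 - u) * ln 2 + u * ln (Gamma (1 + \<beta>)))" using assms by simp
  also have "\<dots> = ((2 - \<beta>) - u * (2 - \<beta>)) * ln 2 + u * (2 - \<beta>) * ln (Gamma (1 + \<beta>))"
    by (simp add: algebra_simps)
  also have "\<dots> = (1 - \<beta>) * ln 2 + ln (Gamma (1 + \<beta>))" unfolding u(3) by simp
  finally have "(\<beta> - 1) * ln 2 \<le> ln (Gamma (1 + \<beta>))" by (simp add: algebra_simps)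
  then have "exp ((\<beta> - 1) * ln 2) \<le> exp (ln (Gamma (1 + \<beta>)))" by simp
  then show ?thesis using assms by (simp add: powr_def)
qed

text \<open>This is the origin of the threshold 2:
  \<open>t powr (\<beta> - 1) < 2 powr (\<beta> - 1)\<close>, and the latter is the lower bound for
  \<open>Gamma (1 + \<beta>)\<close>.\<close>

lemma powr_div_Gamma_less:
  assumes "0 < \<beta>" "\<beta> < 1" "2 < (t::real)"
  shows "t powr \<beta> / Gamma (1 + \<beta>) < t"
proof -
  have G: "0 < Gamma (1 + \<beta>)" using assms by simp
  have "t powr \<beta> = t * t powr (\<beta> - 1)" using assms by (simp add: powr_diff)
  also have "\<dots> < t * 2 powr (\<beta> - 1)" using assms by (intro mult_strict_left_mono powr_less_mono2_neg) auto
  also have "\<dots> \<le> t * Gamma (1 + \<beta>)" using assms Gamma_1_plus_ge[of \<beta>] by (intro mult_left_mono) auto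
  finally show ?thesis using G by (simp add: divide_less_eq)
qed

text \<open>Comparison with the limiting order 1. Strictness here shows that the limiting value is
  not taken at any admissible order.\<close>

lemma mittag_leffler_gt_exp:
  assumes "0 < \<rho>" "\<rho> < 1" "0 < l" "2 < t"
  shows "exp (- l * t) < mittag_leffler \<rho> (- l * t powr \<rho>)"
proof -
  have "exp (- l * t) < exp (- l * t powr \<rho> / Gamma (1 + \<rho>))"
    using powr_div_Gamma_less[OF assms(1,2,4)] assms(3) by (simp add: times_divide_eq_right[symmetric] del: times_divide_eq_right)
  also have "\<dots> \<le> mittag_leffler \<rho> (- l * t powr \<rho>)"
    using assms by (intro mittag_leffler_ge_exp) auto
  finally show ?thesis .
qed

lemma mittag_leffler_order_strict_antimono:
  assumes \<rho>: "0 < \<rho>" "\<rho> < \<rho>'" "\<rho>' < 1" and l: "0 < l" and t: "2 < t"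
  shows "mittag_leffler \<rho>' (- l * t powr \<rho>') < mittag_leffler \<rho> (- l * t powr \<rho>)"
proof -
  \<comment> \<open>With this index, averaging Mittag-Leffler functions of order \<beta> over the
    spectral measure of the larger order yields the smaller order.\<close>
  define \<beta> where "\<beta> = \<rho> / \<rho>'"
  have \<beta>: "0 < \<beta>" "\<beta> < 1" "\<rho>' * \<beta> = \<rho>" using \<rho> by (auto simp: \<beta>_def)
  have \<rho>': "0 < \<rho>'" "\<rho>' < 1" using \<rho> by auto
  define c where "c = t powr \<beta> / Gamma (1 + \<beta>)"
  have c: "0 \<le> c" "c < t" using powr_div_Gamma_less[OF \<beta>(1,2) t] \<beta> t by (auto simp: c_def)
  let ?k = "spectral_density \<rho>' l"
  note k = spectral_density_integrable[OF \<rho>' l] spectral_density_pos[OF \<rho>' l]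
  note [measurable] = mittag_leffler_measurable[OF \<beta>(1)] spectral_density_measurable[OF \<rho>' l]
  \<comment> \<open>Strictness comes from \<open>c < t\<close>; under the integral only the weak
    pointwise comparison is used.\<close>
  have "mittag_leffler \<rho>' (- l * t powr \<rho>') < mittag_leffler \<rho>' (- l * c powr \<rho>')"
    by (rule mittag_leffler_strict_antimono[OF \<rho>' l c])
  also have "\<dots> = (\<integral>x. ?k x * exp (- exp x * c) \<partial>lborel)"
    by (rule mittag_leffler_eq_mixture[OF \<rho>' l c(1)])
  also have "\<dots> \<le> (\<integral>x. ?k x * mittag_leffler \<beta> (- exp x * t powr \<beta>) \<partial>lborel)"
  proof (rule integral_mono)
    show "integrable lborel (\<lambda>x. ?k x * exp (- exp x * c))"
      using mittag_leffler_spectral[OF \<rho>' l c(1)] by (simp add: has_bochner_integral_iff)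
    have b: "\<bar>mittag_leffler \<beta> (- exp x * t powr \<beta>)\<bar> \<le> 1" for x
      using mittag_leffler_nonneg[OF \<beta>(1,2) exp_gt_zero, of t x] mittag_leffler_le_1[OF \<beta>(1,2) exp_gt_zero, of t x] t by auto
    have "(\<lambda>x. ?k x * mittag_leffler \<beta> (- exp x * t powr \<beta>)) \<in> borel_measurable lborel" by measurable
    then show "integrable lborel (\<lambda>x. ?k x * mittag_leffler \<beta> (- exp x * t powr \<beta>))"
    proof (rule Bochner_Integration.integrable_bound[OF k(1)])
      show "AE x in lborel. norm (?k x * mittag_leffler \<beta> (- exp x * t powr \<beta>)) \<le> norm (?k x)"
      proof (rule AE_I2)
        fix x show "norm (?k x * mittag_leffler \<beta> (- exp x * t powr \<beta>)) \<le> norm (?k x)"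
          using mult_left_mono[OF b[of x], of "\<bar>?k x\<bar>"] by (simp only: real_norm_def abs_mult) simp
      qed
    qed
    show "?k x * exp (- exp x * c) \<le> ?k x * mittag_leffler \<beta> (- exp x * t powr \<beta>)" for x
      using mittag_leffler_ge_exp[OF \<beta>(1,2) exp_gt_zero, of t x] t k(2)[of x]
      by (intro mult_left_mono) (auto simp: c_def)
  qed
  also have "\<dots> = mittag_leffler \<rho> (- l * t powr \<rho>)"
    using mittag_leffler_subordination[OF \<rho>' \<beta>(1,2) l, of t] t \<beta>(3) by simp
  finally show ?thesis .
qed

text \<open>In the integrated Caputo equation, dropping the nonnegative part that contains
  \<open>e\<close> bounds the integral of \<open>e\<close> over \<open>{0..t}\<close> by that of the
  bare kernel, and monotonicity bounds it below by \<open>t * e t\<close>. The right-hand side is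
  independent of \<open>l\<close>, which later controls all eigenmodes at once.\<close>

lemma mittag_leffler_decay:
  assumes \<rho>: "0 < \<rho>" "\<rho> < 1" and l: "0 < l" and t: "0 < t"
  shows "l * mittag_leffler \<rho> (- l * t powr \<rho>) \<le> t powr (- \<rho>) / Gamma (2 - \<rho>)"
proof -
  define e where "e = (\<lambda>t. mittag_leffler \<rho> (- l * t powr \<rho>))"
  have anti: "e y \<le> e x" if "0 \<le> x" "x \<le> y" for x y
    using mittag_leffler_strict_antimono[OF \<rho> l that(1), of y] that(2) by (cases "x = y") (auto simp: e_def)
  have nn: "0 \<le> e x" if "0 \<le> x" for x using mittag_leffler_nonneg[OF \<rho> l that] by (simp add: e_def)
  have cont: "continuous_on {0..t} e"
    unfolding e_def by (rule continuous_on_subset[OF continuous_on_mittag_leffler_time[OF \<rho> l]]) auto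
  have a: "0 < 1 - \<rho>" using \<rho> by simp
  have G: "Gamma (2 - \<rho>) = (1 - \<rho>) * Gamma (1 - \<rho>)"
    using Gamma_plus1[of "1 - \<rho>"] \<rho> by (force elim!: nonpos_Ints_cases' simp: add.commute)
  have Gp: "0 < Gamma (1 - \<rho>)" using a by simp
  have "t * e t = (LINT x:{0..t}|lborel. e t)" using t by (simp add: set_lebesgue_integral_def)
  also have "\<dots> \<le> (LINT x:{0..t}|lborel. e x)"
    by (intro set_integral_mono borel_integrable_atLeastAtMost' cont anti continuous_on_const) auto
  finally have 1: "t * e t \<le> (LINT x:{0..t}|lborel. e x)" .
  have k: "set_integrable lborel {0..t} (\<lambda>x. (t - x) powr (- \<rho>))"
    "(LINT x:{0..t}|lborel. (t - x) powr (- \<rho>)) = t powr (1-\<rho>) / (1-\<rho>)"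
    using power_kernel_integral[OF a, of t] t by auto
  have ke: "set_integrable lborel {0..t} (\<lambda>x. (t - x) powr (- \<rho>) * e x)"
    using mittag_leffler_convolution(1)[OF \<rho>(1) a t, of "- l"] by (simp add: e_def)
  have "0 \<le> (LINT x:{0..t}|lborel. (t - x) powr (- \<rho>) * e x)"
    unfolding set_lebesgue_integral_def using nn
    by (intro Bochner_Integration.integral_nonneg) (auto simp: indicator_def)
  moreover have "(LINT x:{0..t}|lborel. (t - x) powr (- \<rho>) * (e x - 1)) =
      (LINT x:{0..t}|lborel. (t - x) powr (- \<rho>) * e x) - t powr (1-\<rho>) / (1-\<rho>)"
    using set_integral_diff(2)[OF ke k(1)] k(2) by (simp add: right_diff_distrib)
  ultimately have "- (t powr (1-\<rho>) / (1-\<rho>)) \<le> - l * Gamma (1 - \<rho>) * (LINT x:{0..t}|lborel. e x)"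
    using mittag_leffler_caputo[OF \<rho> t, of "- l"] by (simp add: e_def)
  then have "l * Gamma (1 - \<rho>) * (LINT x:{0..t}|lborel. e x) \<le> t powr (1-\<rho>) / (1-\<rho>)" by simp
  moreover have "l * Gamma (1 - \<rho>) * (t * e t) \<le> l * Gamma (1 - \<rho>) * (LINT x:{0..t}|lborel. e x)"
    using 1 l Gp by (intro mult_left_mono) auto
  ultimately have "l * Gamma (1 - \<rho>) * (t * e t) \<le> t powr (1-\<rho>) / (1-\<rho>)" by linarith
  also have "\<dots> = t * t powr (- \<rho>) / (1 - \<rho>)" using t by (simp add: powr_diff powr_minus divide_inverse)
  finally have "t * (l * e t * Gamma (1 - \<rho>) * (1 - \<rho>)) \<le> t * t powr (- \<rho>)" using a by (simp add: field_simps)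
  then have "l * e t * Gamma (1 - \<rho>) * (1 - \<rho>) \<le> t powr (- \<rho>)" using t by (simp del: mult_le_cancel_left add: mult_le_cancel_left_pos)
  then show ?thesis unfolding G using a Gp by (simp add: e_def field_simps)
qed

section \<open>Abel's integral equation\<close>

text \<open>The function of the order is continuous on the closed interval from \<rho>0 to 1 and
  strictly decreasing below 1, where it stays above its value at 1. Its range over the admissible
  orders is half-open, which explains one strict and one weak inequality.\<close>

lemma mittag_leffler_order_unique:
  assumes \<rho>0: "0 < \<rho>0" "\<rho>0 < 1" and l: "0 < l" and t: "2 < t"
  shows "(\<exists>!\<rho>. \<rho>0 \<le> \<rho> \<and> \<rho> < 1 \<and> mittag_leffler \<rho> (- l * t powr \<rho>) = y) \<longleftrightarrow>
    exp (- l * t) < y \<and> y \<le> mittag_leffler \<rho>0 (- l * t powr \<rho>0)"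
proof -
  define f where "f = (\<lambda>\<rho>. mittag_leffler \<rho> (- l * t powr \<rho>))"
  have f1: "f 1 = exp (- l * t)" using t by (simp add: f_def mittag_leffler_1)
  have less: "f b < f a" if "\<rho>0 \<le> a" "a < b" "b < 1" for a b
    unfolding f_def using that \<rho>0 l t by (intro mittag_leffler_order_strict_antimono) auto
  have gt: "exp (- l * t) < f a" if "\<rho>0 \<le> a" "a < 1" for a
    unfolding f_def using that \<rho>0 l t by (intro mittag_leffler_gt_exp) auto
  have le0: "f a \<le> f \<rho>0" if "\<rho>0 \<le> a" "a < 1" for a
    using that less[of \<rho>0 a] by (cases "a = \<rho>0") auto
  have inj: "a = b" if "\<rho>0 \<le> a" "a < 1" "\<rho>0 \<le> b" "b < 1" "f a = f b" for a b
    using less[of a b] less[of b a] that by (cases a b rule: linorder_cases) auto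
  have ex: "\<exists>\<rho>. \<rho>0 \<le> \<rho> \<and> \<rho> < 1 \<and> f \<rho> = y" if y: "exp (- l * t) < y" "y \<le> f \<rho>0"
  proof -
    have "continuous_on {\<rho>0..1} f"
      unfolding f_def using \<rho>0 t by (intro continuous_on_mittag_leffler_order) auto
    then obtain \<rho> where "\<rho>0 \<le> \<rho>" "\<rho> \<le> 1" "f \<rho> = y"
      using IVT2'[of f 1 y \<rho>0] y \<rho>0 f1 by auto
    moreover have "\<rho> \<noteq> 1" using y f1 calculation by auto
    ultimately show ?thesis by (intro exI[of _ \<rho>]) auto
  qed
  have "(\<exists>!\<rho>. \<rho>0 \<le> \<rho> \<and> \<rho> < 1 \<and> f \<rho> = y) \<longleftrightarrow> exp (- l * t) < y \<and> y \<le> f \<rho>0"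
    using ex inj gt le0 by (metis (no_types, lifting))
  then show ?thesis by (simp add: f_def)
qed

lemma kernel_set_integrable:
  fixes f :: "real \<Rightarrow> 'b::{banach,second_countable_topology}"
  assumes a: "0 < a" and t: "0 \<le> t" and cont: "continuous_on {0..t} f"
  shows "set_integrable lborel {0..t} (\<lambda>x. (t - x) powr (a - 1) *\<^sub>R f x)"
proof -
  have "compact (f ` {0..t})" by (intro compact_continuous_image cont) auto
  then obtain M where M: "\<And>x. x \<in> {0..t} \<Longrightarrow> norm (f x) \<le> M"
    using compact_imp_bounded bounded_iff by (metis imageI)
  have m: "(\<lambda>x. indicator {0..t} x *\<^sub>R f x) \<in> borel_measurable borel"
    by (rule borel_measurable_continuous_on_indicator[OF _ cont]) simp
  have "set_integrable lborel {0..t} (\<lambda>x. (t - x) powr (a - 1) * M)"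
    by (intro set_integrable_mult_left power_kernel_integral(1)[OF a t])
  then have k: "integrable lborel (\<lambda>x. indicator {0..t} x *\<^sub>R ((t - x) powr (a - 1) * M))"
    by (simp only: set_integrable_def)
  have eq: "indicator {0..t} x *\<^sub>R ((t - x) powr (a - 1) *\<^sub>R f x) = (t - x) powr (a - 1) *\<^sub>R (indicator {0..t} x *\<^sub>R f x)" for x
    by simp
  show ?thesis unfolding set_integrable_def eq
  proof (rule Bochner_Integration.integrable_bound[OF k])
    show "(\<lambda>x. (t - x) powr (a - 1) *\<^sub>R (indicator {0..t} x *\<^sub>R f x)) \<in> borel_measurable lborel"
      using m by measurable
    show "AE x in lborel. norm ((t - x) powr (a - 1) *\<^sub>R (indicator {0..t} x *\<^sub>R f x)) \<le> norm (indicator {0..t} x *\<^sub>R ((t - x) powr (a - 1) * M))"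
      using M by (intro AE_I2) (auto simp: indicator_def abs_mult intro!: mult_left_mono order.trans[OF M abs_ge_self])
  qed
qed

text \<open>The exponents add up to -1, so the power of the interval length in the convolution
  formula is 0 and the value depends neither on x nor on t. This independence is what makes Abel's
  inversion work.\<close>

lemma Beta_shift:
  assumes \<rho>: "0 < \<rho>" "\<rho> < 1" and "x < (t::real)"
  shows "has_bochner_integral lborel (\<lambda>s. indicator {x..t} s *\<^sub>R ((t - s) powr (\<rho> - 1) * (s - x) powr (- \<rho>))) (Beta \<rho> (1 - \<rho>))"
proof -
  have "has_bochner_integral lborel (\<lambda>s. indicator {0..t-x} s *\<^sub>R (((t-x) - s) powr (\<rho> - 1) * s powr ((1 - \<rho>) - 1))) (Beta \<rho> (1 - \<rho>))"
    using Beta_convolution[of \<rho> "1 - \<rho>" "t - x"] assms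
    by (simp add: has_bochner_integral_iff set_integrable_def set_lebesgue_integral_def)
  then have "has_bochner_integral lborel (\<lambda>s. indicator {0..t-x} (- x + 1 * s) *\<^sub>R (((t-x) - (- x + 1 * s)) powr (\<rho> - 1) * (- x + 1 * s) powr ((1 - \<rho>) - 1))) (Beta \<rho> (1 - \<rho>))"
    by (subst (asm) lborel_has_bochner_integral_real_affine_iff[where c=1 and t="-x"]) simp_all
  moreover have "indicator {0..t-x} (- x + 1 * s) *\<^sub>R (((t-x) - (- x + 1 * s)) powr (\<rho> - 1) * (- x + 1 * s) powr ((1 - \<rho>) - 1))
     = indicator {x..t} s *\<^sub>R ((t - s) powr (\<rho> - 1) * (s - x) powr (- \<rho>))" for s
    by (auto simp: indicator_def algebra_simps)
  ultimately show ?thesis by (simp only:)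
qed

text \<open>Exchanging the order of integration leaves the constant of \<open>Beta_shift\<close> as
  inner integral.\<close>

lemma Abel_inversion:
  fixes w :: "real \<Rightarrow> 'b::{banach,second_countable_topology}"
  assumes \<rho>: "0 < \<rho>" "\<rho> < 1" and t: "0 \<le> t" and cont: "continuous_on {0..t} w"
  shows "(LINT s:{0..t}|lborel. (t - s) powr (\<rho> - 1) *\<^sub>R (LINT x:{0..s}|lborel. (s - x) powr (- \<rho>) *\<^sub>R w x))
    = Beta \<rho> (1 - \<rho>) *\<^sub>R (LINT x:{0..t}|lborel. w x)"
proof -
  define v where "v = (\<lambda>x. indicator {0..t} x *\<^sub>R w x)"
  have [measurable]: "v \<in> borel_measurable borel"
    unfolding v_def by (rule borel_measurable_continuous_on_indicator[OF _ cont]) simp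
  \<comment> \<open>The indicator encodes the triangle \<open>x \<le> s \<le> t\<close>, so that
    Fubini applies on the whole plane. The constant inner integral is available for
    \<open>x < t\<close>; the point \<open>x = t\<close> is a null set.\<close>
  define K where "K = (\<lambda>x s. indicator {x..t} s *\<^sub>R ((t - s) powr (\<rho> - 1) * (s - x) powr (- \<rho>)))"
  have Kalt: "K x s = indicator {r. 0 \<le> r} (s - x) * indicator {r. 0 \<le> r} (t - s) * ((t - s) powr (\<rho> - 1) * (s - x) powr (- \<rho>))" for x s
    by (auto simp: K_def indicator_def)
  have [measurable]: "case_prod K \<in> borel_measurable (borel \<Otimes>\<^sub>M borel)"
    unfolding Kalt[abs_def] by measurable
  have K0: "0 \<le> K x s" for x s by (simp add: K_def indicator_def)
  have KB: "has_bochner_integral lborel (K x) (Beta \<rho> (1 - \<rho>))" if "x < t" for x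
    unfolding K_def by (rule Beta_shift[OF \<rho> that])
  have int1: "integrable lborel (\<lambda>s. K x s *\<^sub>R v x)" if "x \<noteq> t" for x
    using KB[of x] that by (cases "x < t") (auto simp: has_bochner_integral_iff v_def)
  have int2: "(\<integral>s. K x s *\<^sub>R v x \<partial>lborel) = Beta \<rho> (1 - \<rho>) *\<^sub>R v x" if "x \<noteq> t" for x
    using KB[of x] that by (cases "x < t") (auto simp: has_bochner_integral_iff v_def)
  have vi: "integrable lborel v"
    using borel_integrable_atLeastAtMost'[OF cont] by (simp add: set_integrable_def v_def)
  have "integrable (lborel \<Otimes>\<^sub>M lborel) (\<lambda>(x, s). K x s *\<^sub>R v x)"
  proof (rule lborel_pair.Fubini_integrable)
    have "integrable lborel (\<lambda>x. Beta \<rho> (1 - \<rho>) * norm (v x))" using vi by simp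
    moreover have "AE x in lborel. Beta \<rho> (1 - \<rho>) * norm (v x) = (\<integral>s. norm (case (x, s) of (x, s) \<Rightarrow> K x s *\<^sub>R v x) \<partial>lborel)"
      using AE_lborel_singleton[of t]
    proof eventually_elim
      fix x assume x: "x \<noteq> t"
      show "Beta \<rho> (1 - \<rho>) * norm (v x) = (\<integral>s. norm (case (x, s) of (x, s) \<Rightarrow> K x s *\<^sub>R v x) \<partial>lborel)"
        using KB[of x] x K0 by (cases "x < t") (auto simp: has_bochner_integral_iff v_def)
    qed
    ultimately show "integrable lborel (\<lambda>x. \<integral>s. norm (case (x, s) of (x, s) \<Rightarrow> K x s *\<^sub>R v x) \<partial>lborel)"
      by (subst (asm) integrable_cong_AE) auto
    show "AE x in lborel. integrable lborel (\<lambda>s. case (x, s) of (x, s) \<Rightarrow> K x s *\<^sub>R v x)"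
      using AE_lborel_singleton[of t] by eventually_elim (simp add: int1)
  qed measurable
  then have "(\<integral>s. (\<integral>x. K x s *\<^sub>R v x \<partial>lborel) \<partial>lborel) = (\<integral>x. (\<integral>s. K x s *\<^sub>R v x \<partial>lborel) \<partial>lborel)"
    by (rule lborel_pair.Fubini_integral)
  also have "\<dots> = (\<integral>x. Beta \<rho> (1 - \<rho>) *\<^sub>R v x \<partial>lborel)"
    using AE_lborel_singleton[of t] by (intro integral_cong_AE) (auto simp: int2)
  also have "\<dots> = Beta \<rho> (1 - \<rho>) *\<^sub>R (LINT x:{0..t}|lborel. w x)"
    unfolding v_def set_lebesgue_integral_def by (rule integral_scaleR_right)
  also have "(\<integral>s. (\<integral>x. K x s *\<^sub>R v x \<partial>lborel) \<partial>lborel) =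
     (LINT s:{0..t}|lborel. (t - s) powr (\<rho> - 1) *\<^sub>R (LINT x:{0..s}|lborel. (s - x) powr (- \<rho>) *\<^sub>R w x))"
    unfolding set_lebesgue_integral_def
  proof (rule Bochner_Integration.integral_cong[OF refl])
    fix s :: real
    have "K x s *\<^sub>R v x = (indicator {0..t} s * (t - s) powr (\<rho> - 1)) *\<^sub>R (indicator {0..s} x *\<^sub>R ((s - x) powr (- \<rho>) *\<^sub>R w x))" for x
      by (auto simp: K_def v_def indicator_def)
    then have "(\<integral>x. K x s *\<^sub>R v x \<partial>lborel) = (\<integral>x. (indicator {0..t} s * (t - s) powr (\<rho> - 1)) *\<^sub>R (indicator {0..s} x *\<^sub>R ((s - x) powr (- \<rho>) *\<^sub>R w x)) \<partial>lborel)"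
      by (simp only:)
    then show "(\<integral>x. K x s *\<^sub>R v x \<partial>lborel) = indicator {0..t} s *\<^sub>R (t - s) powr (\<rho> - 1) *\<^sub>R (\<integral>x. indicator {0..s} x *\<^sub>R ((s - x) powr (- \<rho>) *\<^sub>R w x) \<partial>lborel)"
      by (simp only: integral_scaleR_right) (simp only: scaleR_scaleR)
  qed
  finally show ?thesis .
qed

text \<open>
  The weight \<open>exp (- K * t)\<close> with large \<open>K\<close> turns the weakly singular Volterra operator into a
  contraction.
\<close>

lemma weakly_singular_Volterra_zero:
  fixes W :: "real \<Rightarrow> 'b::{banach,second_countable_topology}"
  assumes \<rho>: "0 < \<rho>" and cont: "continuous_on {0..T} W"
    and eq: "\<And>t. t \<in> {0<..T} \<Longrightarrow> W t = c *\<^sub>R (LINT s:{0..t}|lborel. (t - s) powr (\<rho> - 1) *\<^sub>R W s)"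
    and W0: "W 0 = 0" and t: "t \<in> {0..T}"
  shows "W t = 0"
proof -
  \<comment> \<open>By the Laplace transform of a power, the weighted operator has norm at most
    \<open>\<bar>c\<bar> * Gamma \<rho> / K powr \<rho>\<close>; this \<open>K\<close> makes it at
    most 1/2.\<close>
  define K where "K = ((\<bar>c\<bar> * Gamma \<rho> + 1) * 2) powr (1 / \<rho>)"
  have G: "0 < Gamma \<rho>" using \<rho> by simp
  have "0 < (\<bar>c\<bar> * Gamma \<rho> + 1) * 2" using G by (simp add: add_nonneg_pos)
  then have K: "0 < K" "K powr \<rho> = (\<bar>c\<bar> * Gamma \<rho> + 1) * 2"
    using \<rho> unfolding K_def by (simp_all only: powr_powr powr_gt_zero) auto
  have q: "\<bar>c\<bar> * Gamma \<rho> / K powr \<rho> \<le> 1 / 2"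
  proof -
    have "0 < \<bar>c\<bar> * Gamma \<rho> + 1" using G by (simp add: add_nonneg_pos)
    then show ?thesis unfolding K(2) by (simp add: divide_le_eq)
  qed
  define N where "N = (\<lambda>t. exp (- K * t) * norm (W t))"
  have "continuous_on {0..T} N" unfolding N_def by (intro continuous_intros cont)
  \<comment> \<open>At a maximum point \<open>u\<close> of the weighted norm the equation yields
    \<open>N u \<le> N u / 2\<close>, hence \<open>N u = 0\<close>.\<close>
  then obtain u where u: "u \<in> {0..T}" "\<And>s. s \<in> {0..T} \<Longrightarrow> N s \<le> N u"
    using continuous_attains_sup[of "{0..T}" N] t by auto
  have "N u \<le> N u / 2"
  proof (cases "u = 0")
    case True then show ?thesis by (simp add: N_def W0)
  next
    case False
    with u have u0: "0 < u" "u \<le> T" by auto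
    have cu: "continuous_on {0..u} W" using cont u0 by (auto elim: continuous_on_subset)
    have i1: "set_integrable lborel {0..u} (\<lambda>s. (u - s) powr (\<rho> - 1) *\<^sub>R W s)"
      using u0 by (intro kernel_set_integrable[OF \<rho>] cu) auto
    have i2: "set_integrable lborel {0..u} (\<lambda>s. (u - s) powr (\<rho> - 1) * exp (- K * (u - s)))"
      using kernel_set_integrable[OF \<rho>, of u "\<lambda>s. exp (- K * (u - s))"] u0 by (simp add: continuous_intros)
    have "norm (LINT s:{0..u}|lborel. (u - s) powr (\<rho> - 1) *\<^sub>R W s) \<le> (LINT s:{0..u}|lborel. norm ((u - s) powr (\<rho> - 1) *\<^sub>R W s))"
      by (rule set_integral_norm_bound[OF i1])
    also have "\<dots> \<le> (LINT s:{0..u}|lborel. (N u * exp (K * u)) * ((u - s) powr (\<rho> - 1) * exp (- K * (u - s))))"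
    proof (rule set_integral_mono)
      show "set_integrable lborel {0..u} (\<lambda>s. norm ((u - s) powr (\<rho> - 1) *\<^sub>R W s))"
        by (rule set_integrable_norm[OF i1])
      show "set_integrable lborel {0..u} (\<lambda>s. (N u * exp (K * u)) * ((u - s) powr (\<rho> - 1) * exp (- K * (u - s))))"
        using i2 by (intro set_integrable_mult_right)
      fix s assume s: "s \<in> {0..u}"
      have "norm (W s) = exp (K * s) * N s" by (simp add: N_def mult.assoc[symmetric] exp_add[symmetric])
      also have "\<dots> \<le> exp (K * s) * N u" using s u0 by (intro mult_left_mono u(2)) auto
      also have "exp (K * s) = exp (K * u) * exp (- K * (u - s))" by (simp add: exp_add[symmetric] algebra_simps)
      finally have "(u - s) powr (\<rho> - 1) * norm (W s) \<le> (u - s) powr (\<rho> - 1) * (exp (K * u) * exp (- K * (u - s)) * N u)"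
        by (intro mult_left_mono) auto
      then show "norm ((u - s) powr (\<rho> - 1) *\<^sub>R W s) \<le> (N u * exp (K * u)) * ((u - s) powr (\<rho> - 1) * exp (- K * (u - s)))"
        by (simp add: mult_ac)
    qed
    also have "\<dots> = N u * exp (K * u) * (LINT s:{0..u}|lborel. (u - s) powr (\<rho> - 1) * exp (- K * (u - s)))"
      by simp
    also have "(LINT s:{0..u}|lborel. (u - s) powr (\<rho> - 1) * exp (- K * (u - s))) = (LINT s:{0..u}|lborel. s powr (\<rho> - 1) * exp (- K * s))"
      by (rule set_integral_reflect(2)[of u "\<lambda>s. s powr (\<rho> - 1) * exp (- K * s)"])
    also have "N u * exp (K * u) * (LINT s:{0..u}|lborel. s powr (\<rho> - 1) * exp (- K * s)) \<le> N u * exp (K * u) * (Gamma \<rho> / K powr \<rho>)"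
    proof (rule mult_left_mono)
      have L: "has_bochner_integral lborel (\<lambda>t. indicator {0..} t *\<^sub>R (t powr (\<rho> - 1) * exp (- K * t))) (Gamma \<rho> / K powr \<rho>)"
        by (rule Laplace_power[OF \<rho> K(1)])
      have "set_integrable lborel {0..u} (\<lambda>s. s powr (\<rho> - 1) * exp (- K * s))"
        using i2 set_integral_reflect(1)[of u "\<lambda>s. s powr (\<rho> - 1) * exp (- K * s)"] by simp
      then have "(LINT s:{0..u}|lborel. s powr (\<rho> - 1) * exp (- K * s)) \<le> (\<integral>t. indicator {0..} t *\<^sub>R (t powr (\<rho> - 1) * exp (- K * t)) \<partial>lborel)"
        unfolding set_lebesgue_integral_def set_integrable_def using L
        by (intro integral_mono) (auto simp: has_bochner_integral_iff indicator_def)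
      then show "(LINT s:{0..u}|lborel. s powr (\<rho> - 1) * exp (- K * s)) \<le> Gamma \<rho> / K powr \<rho>"
        using has_bochner_integral_integral_eq[OF L] by simp
    qed (simp add: N_def)
    finally have bound: "norm (LINT s:{0..u}|lborel. (u - s) powr (\<rho> - 1) *\<^sub>R W s) \<le> N u * exp (K * u) * (Gamma \<rho> / K powr \<rho>)" .
    have "norm (W u) = \<bar>c\<bar> * norm (LINT s:{0..u}|lborel. (u - s) powr (\<rho> - 1) *\<^sub>R W s)"
      using eq[of u] u0 by simp
    also have "\<dots> \<le> \<bar>c\<bar> * (N u * exp (K * u) * (Gamma \<rho> / K powr \<rho>))" by (intro mult_left_mono bound) auto
    also have "\<dots> = (N u * exp (K * u)) * (\<bar>c\<bar> * Gamma \<rho> / K powr \<rho>)" by simp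
    also have "\<dots> \<le> (N u * exp (K * u)) * (1 / 2)" by (intro mult_left_mono q) (simp add: N_def)
    finally have "exp (- K * u) * norm (W u) \<le> exp (- K * u) * ((N u * exp (K * u)) * (1 / 2))" by (intro mult_left_mono) auto
    also have "\<dots> = N u / 2" by (simp add: exp_minus)
    finally show ?thesis by (simp add: N_def)
  qed
  then have "N u \<le> 0" by simp
  then have "N t \<le> 0" using u(2)[OF t] by simp
  then show ?thesis by (simp add: N_def mult_le_0_iff)
qed

text \<open>Applying the fractional integral of order \<rho> to both sides turns the equation into a
  weakly singular Volterra equation for the primitive \<open>W\<close> of w. Thus \<open>W\<close>
  vanishes, and w is its derivative.\<close>

lemma Abel_equation_zero:
  fixes w :: "real \<Rightarrow> 'b::{euclidean_space}"
  assumes \<rho>: "0 < \<rho>" "\<rho> < 1" and T: "0 < T" and cont: "continuous_on {0..T} w"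
    and eq: "\<And>t. t \<in> {0<..T} \<Longrightarrow> (LINT x:{0..t}|lborel. (t - x) powr (- \<rho>) *\<^sub>R w x) = c *\<^sub>R (LINT x:{0..t}|lborel. w x)"
    and t: "t \<in> {0..T}"
  shows "w t = 0"
proof -
  define W where "W = (\<lambda>t. LINT x:{0..t}|lborel. w x)"
  have wi: "set_integrable lborel {0..t} w" if "t \<le> T" for t
    using that by (intro borel_integrable_atLeastAtMost' continuous_on_subset[OF cont]) auto
  have W_eq: "W t = integral {0..t} w" if "t \<le> T" for t
    using wi[OF that] by (simp add: W_def set_borel_integral_eq_integral)
  have der: "(W has_vector_derivative w t) (at t within {0..T})" if "t \<in> {0..T}" for t
    using integral_has_vector_derivative[OF cont that] that
    by (rule has_vector_derivative_transform[rotated 2]) (auto simp: W_eq)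
  have W_cont: "continuous_on {0..T} W"
    unfolding continuous_on_eq_continuous_within using has_vector_derivative_continuous[OF der] by blast
  have B: "0 < Beta \<rho> (1 - \<rho>)" using \<rho> by (simp add: Beta_def)
  have W0: "W 0 = 0" by (simp add: W_eq T less_imp_le)
  have W: "W t = 0" if "t \<in> {0..T}" for t
  proof (rule weakly_singular_Volterra_zero[OF \<rho>(1) W_cont _ W0 that])
    fix t assume t: "t \<in> {0<..T}"
    have "Beta \<rho> (1 - \<rho>) *\<^sub>R W t = (LINT s:{0..t}|lborel. (t - s) powr (\<rho> - 1) *\<^sub>R (LINT x:{0..s}|lborel. (s - x) powr (- \<rho>) *\<^sub>R w x))"
      unfolding W_def using t by (intro Abel_inversion[symmetric] \<rho> continuous_on_subset[OF cont]) auto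
    also have "\<dots> = (LINT s:{0..t}|lborel. (t - s) powr (\<rho> - 1) *\<^sub>R (c *\<^sub>R W s))"
      unfolding set_lebesgue_integral_def
    proof (rule Bochner_Integration.integral_cong[OF refl])
      \<comment> \<open>The equation is assumed for positive times only; at \<open>s = 0\<close>
        both sides are 0.\<close>
      have "(\<integral>x. indicator {0..0} x *\<^sub>R (0 - x) powr (- \<rho>) *\<^sub>R w x \<partial>lborel) = 0"
        using AE_lborel_singleton[of "0::real"] by (intro integral_eq_zero_AE) (auto simp: indicator_def)
      then have "(\<integral>x. indicator {0..s} x *\<^sub>R (s - x) powr (- \<rho>) *\<^sub>R w x \<partial>lborel) = c *\<^sub>R W s" if "s \<in> {0..t}" for s
        using eq[of s] that t W0 by (cases "s = 0") (auto simp: W_def set_lebesgue_integral_def)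
      then show "indicator {0..t} s *\<^sub>R (t - s) powr (\<rho> - 1) *\<^sub>R (\<integral>x. indicator {0..s} x *\<^sub>R (s - x) powr (- \<rho>) *\<^sub>R w x \<partial>lborel) =
         indicator {0..t} s *\<^sub>R (t - s) powr (\<rho> - 1) *\<^sub>R c *\<^sub>R W s" for s
        by (auto simp: indicator_def)
    qed
    also have "\<dots> = c *\<^sub>R (LINT s:{0..t}|lborel. (t - s) powr (\<rho> - 1) *\<^sub>R W s)"
      unfolding set_lebesgue_integral_def integral_scaleR_right[symmetric]
      by (simp only: scaleR_left_commute[of _ c])
    finally show "W t = (c / Beta \<rho> (1 - \<rho>)) *\<^sub>R (LINT s:{0..t}|lborel. (t - s) powr (\<rho> - 1) *\<^sub>R W s)"
      using B by (metis (no_types, lifting) divide_inverse less_irrefl mult.commute scaleR_scaleR scaleR_one left_inverse)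
  qed
  have "(W has_vector_derivative 0) (at t within {0..T})"
    using has_vector_derivative_const[of 0] t W
    by (rule has_vector_derivative_transform[rotated 2]) auto
  moreover have "at t within {0..T} \<noteq> bot"
    using t T by (simp add: trivial_limit_within islimpt_Icc)
  ultimately show ?thesis using der[OF t] vector_derivative_unique_within by blast
qed

section \<open>The Caputo derivative of scalar functions\<close>

lemma caputo_integrand_eq: "caputo_integrand \<rho> h t x = (t - x) powr (- \<rho>) *\<^sub>R (h x - h 0)"
  by (simp add: caputo_integrand_def powr_minus_divide)

lemma caputo_integrand_integrable:
  fixes y :: "real \<Rightarrow> 'b::{banach,second_countable_topology}"
  assumes "\<rho> < 1" "0 \<le> t" "continuous_on {0..t} y"
  shows "set_integrable lborel {0..t} (caputo_integrand \<rho> y t)"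
  using kernel_set_integrable[of "1 - \<rho>" t "\<lambda>x. y x - y 0"] assms
  by (simp add: caputo_integrand_eq[abs_def] continuous_intros)

lemma caputo_integral_bound:
  fixes y :: "real \<Rightarrow> 'b::{banach,second_countable_topology}"
  assumes \<rho>: "\<rho> < 1" and t: "0 \<le> t" and cont: "continuous_on {0..t} y"
    and M: "\<And>x. x \<in> {0..t} \<Longrightarrow> norm (y x - y 0) \<le> M"
  shows "norm (caputo_integral \<rho> y t) \<le> t powr (1 - \<rho>) / (1 - \<rho>) * M"
proof -
  have a: "0 < 1 - \<rho>" using \<rho> by simp
  note i = caputo_integrand_integrable[OF \<rho> t cont]
  note k = power_kernel_integral[OF a t]
  have "norm (caputo_integral \<rho> y t) \<le> (LINT x:{0..t}|lborel. norm (caputo_integrand \<rho> y t x))"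
    unfolding caputo_integral_def by (rule set_integral_norm_bound[OF i])
  also have "\<dots> \<le> (LINT x:{0..t}|lborel. (t - x) powr (1 - \<rho> - 1) * M)"
  proof (rule set_integral_mono)
    show "set_integrable lborel {0..t} (\<lambda>x. norm (caputo_integrand \<rho> y t x))"
      by (rule set_integrable_norm[OF i])
    show "set_integrable lborel {0..t} (\<lambda>x. (t - x) powr (1 - \<rho> - 1) * M)"
      by (intro set_integrable_mult_left k)
    show "norm (caputo_integrand \<rho> y t x) \<le> (t - x) powr (1 - \<rho> - 1) * M" if "x \<in> {0..t}" for x
      using M[OF that] by (simp add: caputo_integrand_eq mult_left_mono)
  qed
  also have "\<dots> = t powr (1 - \<rho>) / (1 - \<rho>) * M" using k(2) by simp
  finally show ?thesis .
qed

text \<open>The Caputo derivative is prescribed for positive times only. The value and the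
  continuity at 0 fix the constant when the equation is integrated from 0.\<close>

lemma caputo_integral_continuous_at_0:
  fixes y :: "real \<Rightarrow> 'b::{banach,second_countable_topology}"
  assumes \<rho>: "\<rho> < 1" and cont: "continuous_on {0..T} y"
  shows "caputo_integral \<rho> y 0 = 0" "continuous (at 0 within {0..T}) (caputo_integral \<rho> y)"
proof -
  have "compact ((\<lambda>x. y x - y 0) ` {0..T})" by (intro compact_continuous_image continuous_intros cont) auto
  then obtain M where M: "\<And>x. x \<in> {0..T} \<Longrightarrow> norm (y x - y 0) \<le> M"
    using compact_imp_bounded bounded_iff by (metis imageI)
  have b: "norm (caputo_integral \<rho> y t) \<le> t powr (1 - \<rho>) / (1 - \<rho>) * M" if "t \<in> {0..T}" for t
    using that M by (intro caputo_integral_bound \<rho> continuous_on_subset[OF cont]) auto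
  show 0: "caputo_integral \<rho> y 0 = 0"
    using caputo_integral_bound[OF \<rho>, of 0 y 0] by (simp add: continuous_on_sing)
  have "continuous_on {0..} (\<lambda>t::real. t powr (1 - \<rho>))"
    using \<rho> by (intro continuous_on_powr' continuous_intros) auto
  then have "((\<lambda>t::real. t powr (1 - \<rho>)) \<longlongrightarrow> 0 powr (1 - \<rho>)) (at 0 within {0..})"
    unfolding continuous_on_def by (metis atLeast_iff order_refl)
  then have "((\<lambda>t::real. t powr (1 - \<rho>)) \<longlongrightarrow> 0) (at 0 within {0..T})"
    by (rule tendsto_within_subset[OF tendsto_eq_rhs]) auto
  then have "((\<lambda>t. t powr (1 - \<rho>) / (1 - \<rho>) * M) \<longlongrightarrow> 0 / (1 - \<rho>) * M) (at 0 within {0..T})"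
    using \<rho> by (intro tendsto_intros) auto
  then have "(caputo_integral \<rho> y \<longlongrightarrow> 0) (at 0 within {0..T})"
    using b by (intro Lim_null_comparison[of "caputo_integral \<rho> y" "\<lambda>t. t powr (1 - \<rho>) / (1 - \<rho>) * M"])
      (auto simp: eventually_at_filter)
  then show "continuous (at 0 within {0..T}) (caputo_integral \<rho> y)"
    by (simp add: continuous_within 0)
qed

text \<open>Integrating the equation in time leaves a relation between two integrals of y, and the
  Mittag-Leffler function satisfies the same relation. The difference of the two solves Abel's
  homogeneous equation. The factor \<open>Gamma (1 - \<rho>)\<close> is present because
  \<open>caputo_integral\<close> does not include the normalisation of the derivative.\<close>

lemma caputo_scalar_unique:
  fixes y :: "real \<Rightarrow> 'b::euclidean_space"
  assumes \<rho>: "0 < \<rho>" "\<rho> < 1" and T: "0 < T" and cont: "continuous_on {0..T} y"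
    and der: "\<And>t. t \<in> {0<..T} \<Longrightarrow>
      (caputo_integral \<rho> y has_vector_derivative (- (l * Gamma (1 - \<rho>))) *\<^sub>R y t) (at t within {0<..T})"
    and t: "t \<in> {0..T}"
  shows "y t = mittag_leffler \<rho> (- l * t powr \<rho>) *\<^sub>R y 0"
proof -
  define I where "I = caputo_integral \<rho> y"
  define e where "e = (\<lambda>t. mittag_leffler \<rho> (- l * t powr \<rho>))"
  have e_cont: "continuous_on {0..} e"
    unfolding e_def by (rule continuous_on_mittag_leffler_time[OF \<rho> zero_less_one])
  have I_cont: "continuous_on {0..T} I"
    unfolding continuous_on_eq_continuous_within
  proof
    fix s assume s: "s \<in> {0..T}"
    show "continuous (at s within {0..T}) I"
    proof (cases "s = 0")
      case True
      then show ?thesis using caputo_integral_continuous_at_0(2)[OF \<rho>(2) cont] by (simp add: I_def)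
    next
      case False
      then have "at s within {0..T} = at s within {0<..T}"
        using s by (intro at_within_nhd[of _ "{0<..}"]) auto
      moreover have "continuous (at s within {0<..T}) I"
        unfolding I_def using s False by (intro has_vector_derivative_continuous[OF der]) auto
      ultimately show ?thesis by simp
    qed
  qed
  have I_eq: "I s = (- (l * Gamma (1 - \<rho>))) *\<^sub>R (LINT x:{0..s}|lborel. y x)" if s: "s \<in> {0<..T}" for s
  proof -
    \<comment> \<open>Derivatives of \<open>I\<close> are available at positive times; the version
      of the fundamental theorem with interior derivatives needs only continuity at the endpoint
      0.\<close>
    have "((\<lambda>x. (- (l * Gamma (1 - \<rho>))) *\<^sub>R y x) has_integral (I s - I 0)) {0..s}"
    proof (rule fundamental_theorem_of_calculus_interior)
      show "continuous_on {0..s} I" using I_cont s by (auto elim: continuous_on_subset)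
      fix x assume x: "x \<in> {0<..<s}"
      then have "at x within {0<..T} = at x within UNIV"
        using s by (intro at_within_nhd[of _ "{0<..<s}"]) auto
      then show "(I has_vector_derivative (- (l * Gamma (1 - \<rho>))) *\<^sub>R y x) (at x)"
        using der[of x] x s by (simp add: I_def)
    qed (use s in auto)
    moreover have "I 0 = 0" using caputo_integral_continuous_at_0(1)[OF \<rho>(2) cont] by (simp add: I_def)
    ultimately have "((\<lambda>x. (- (l * Gamma (1 - \<rho>))) *\<^sub>R y x) has_integral I s) {0..s}" by simp
    moreover have "continuous_on {0..s} y" using cont s by (auto elim: continuous_on_subset)
    then have "(y has_integral (LINT x:{0..s}|lborel. y x)) {0..s}"
      using borel_integrable_atLeastAtMost' has_integral_set_lebesgue set_borel_integral_eq_integral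
      by (metis integrable_integral)
    then have "((\<lambda>x. (- (l * Gamma (1 - \<rho>))) *\<^sub>R y x) has_integral (- (l * Gamma (1 - \<rho>))) *\<^sub>R (LINT x:{0..s}|lborel. y x)) {0..s}"
      by (rule has_integral_cmul)
    ultimately show ?thesis by (rule has_integral_unique)
  qed
  \<comment> \<open>\<open>w x\<close> equals \<open>(y x - y 0) - (e x - 1) *\<^sub>R y 0\<close>,
    so the subtracted initial values in the two Caputo integrals cancel.\<close>
  define w where "w = (\<lambda>x. y x - e x *\<^sub>R y 0)"
  have "w t = 0"
  proof (rule Abel_equation_zero[OF \<rho> T _ _ t])
    show "continuous_on {0..T} w"
      unfolding w_def by (intro continuous_intros cont continuous_on_subset[OF e_cont]) auto
    fix s assume s: "s \<in> {0<..T}"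
    have cs: "continuous_on {0..s} y" "continuous_on {0..s} e"
      using s cont e_cont by (auto elim: continuous_on_subset)
    have i1: "set_integrable lborel {0..s} (\<lambda>x. (s - x) powr (- \<rho>) *\<^sub>R (y x - y 0))"
      using kernel_set_integrable[of "1 - \<rho>" s "\<lambda>x. y x - y 0"] \<rho> s cs by (simp add: continuous_intros)
    have i2: "set_integrable lborel {0..s} (\<lambda>x. (s - x) powr (- \<rho>) * (e x - 1))"
      using kernel_set_integrable[of "1 - \<rho>" s "\<lambda>x. e x - 1"] \<rho> s cs by (simp add: continuous_intros)
    have j1: "set_integrable lborel {0..s} y" and j2: "set_integrable lborel {0..s} e"
      by (intro borel_integrable_atLeastAtMost' cs)+
    have "(LINT x:{0..s}|lborel. (s - x) powr (- \<rho>) *\<^sub>R w x) =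
      (LINT x:{0..s}|lborel. (s - x) powr (- \<rho>) *\<^sub>R (y x - y 0) - ((s - x) powr (- \<rho>) * (e x - 1)) *\<^sub>R y 0)"
      by (simp add: w_def algebra_simps)
    also have "\<dots> = I s - (LINT x:{0..s}|lborel. (s - x) powr (- \<rho>) * (e x - 1)) *\<^sub>R y 0"
    proof -
      have "set_integrable lborel {0..s} (\<lambda>x. ((s - x) powr (- \<rho>) * (e x - 1)) *\<^sub>R y 0)"
        using integrable_scaleR_left[of "y 0" lborel "\<lambda>x. indicator {0..s} x *\<^sub>R ((s - x) powr (- \<rho>) * (e x - 1))"] i2
        by (simp add: set_integrable_def)
      moreover have "(LINT x:{0..s}|lborel. ((s - x) powr (- \<rho>) * (e x - 1)) *\<^sub>R y 0) = (LINT x:{0..s}|lborel. (s - x) powr (- \<rho>) * (e x - 1)) *\<^sub>R y 0"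
        using integral_scaleR_left[of "y 0" lborel "\<lambda>x. indicator {0..s} x *\<^sub>R ((s - x) powr (- \<rho>) * (e x - 1))"] i2
        by (simp add: set_integrable_def set_lebesgue_integral_def)
      ultimately show ?thesis using set_integral_diff(2)[OF i1]
        by (simp add: I_def caputo_integral_def caputo_integrand_eq)
    qed
    also have "(LINT x:{0..s}|lborel. (s - x) powr (- \<rho>) * (e x - 1)) = - l * Gamma (1 - \<rho>) * (LINT x:{0..s}|lborel. e x)"
      unfolding e_def using s by (intro mittag_leffler_caputo \<rho>) auto
    also have "I s - (- l * Gamma (1 - \<rho>) * (LINT x:{0..s}|lborel. e x)) *\<^sub>R y 0
       = (- (l * Gamma (1 - \<rho>))) *\<^sub>R ((LINT x:{0..s}|lborel. y x) - (LINT x:{0..s}|lborel. e x) *\<^sub>R y 0)"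
      unfolding I_eq[OF s] by (simp add: scaleR_diff_right)
    also have "(LINT x:{0..s}|lborel. y x) - (LINT x:{0..s}|lborel. e x) *\<^sub>R y 0 = (LINT x:{0..s}|lborel. w x)"
    proof -
      have "set_integrable lborel {0..s} (\<lambda>x. e x *\<^sub>R y 0)"
        by (intro borel_integrable_atLeastAtMost' continuous_intros cs)
      moreover have "(LINT x:{0..s}|lborel. e x *\<^sub>R y 0) = (LINT x:{0..s}|lborel. e x) *\<^sub>R y 0"
        using integral_scaleR_left[of "y 0" lborel "\<lambda>x. indicator {0..s} x *\<^sub>R e x"] j2
        by (simp add: set_integrable_def set_lebesgue_integral_def)
      ultimately show ?thesis using set_integral_diff(2)[OF j1, of "\<lambda>x. e x *\<^sub>R y 0"] by (simp add: w_def)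
    qed
    finally show "(LINT x:{0..s}|lborel. (s - x) powr (- \<rho>) *\<^sub>R w x) = (- (l * Gamma (1 - \<rho>))) *\<^sub>R (LINT x:{0..s}|lborel. w x)" .
  qed
  then show ?thesis by (simp add: w_def e_def)
qed

section \<open>Scalar products over the real or complex field\<close>

lemma conjg_0 [simp]: "conjg (0::'k::real_or_complex) = 0"
  using conjg_add[of "0::'k" 0] by simp

lemma norm_conjg [simp]: "norm (conjg a) = norm (a::'k::real_or_complex)"
proof (cases "a = 0")
  case False
  have "norm a * norm (conjg a) = (norm a)\<^sup>2"
    using arg_cong[OF mult_conjg[of a], of norm] by (simp add: norm_mult)
  then show ?thesis using False by (simp add: power2_eq_square)
qed simp

context hilbert_space
begin

lemma ip_zero_left [simp]: "ip 0 y = 0"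
  using ip_add_left[of 0 0 y] by simp

lemma ip_minus_left [simp]: "ip (- x) y = - ip x y"
  using ip_add_left[of x "- x" y] by (simp add: eq_neg_iff_add_eq_0 add.commute)

lemma ip_diff_left: "ip (x - y) z = ip x z - ip y z"
  using ip_add_left[of x "- y" z] by simp

lemma ip_add_right: "ip x (y + z) = ip x y + ip x z"
  by (metis ip_conjg ip_add_left conjg_add)

lemma ip_smul_right: "ip x (smul c y) = conjg c * ip x y"
  by (metis ip_conjg ip_smul_left conjg_mult)

lemma ip_zero_right [simp]: "ip x 0 = 0"
  using ip_conjg[of x 0] by simp

lemma ip_scaleR_left: "ip (r *\<^sub>R x) y = r *\<^sub>R ip x y"
  by (simp add: smul_of_real[symmetric] ip_smul_left scaleR_conv_of_real)

lemma ip_eq_0_commute: "ip x y = 0 \<Longrightarrow> ip y x = 0"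
  using ip_conjg[of y x] by simp

lemma norm_add_orthogonal:
  assumes "ip a b = 0"
  shows "(norm (a + b))\<^sup>2 = (norm a)\<^sup>2 + (norm b)\<^sup>2"
proof -
  have "of_real ((norm (a + b))\<^sup>2) = (of_real ((norm a)\<^sup>2 + (norm b)\<^sup>2) :: 'k)"
    using assms ip_eq_0_commute[OF assms] by (simp only: ip_self[symmetric] ip_add_left ip_add_right of_real_add) simp
  then show ?thesis by (simp only: of_real_eq_iff)
qed

lemma norm_smul: "norm (smul c x) = norm c * norm x"
proof -
  have "ip (smul c x) (smul c x) = (c * conjg c) * ip x x" by (simp add: ip_smul_left ip_smul_right)
  then have "(of_real ((norm (smul c x))\<^sup>2) :: 'k) = of_real ((norm c * norm x)\<^sup>2)"
    by (simp add: ip_self mult_conjg scaleR_conv_of_real power_mult_distrib)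
  then have "(norm (smul c x))\<^sup>2 = (norm c * norm x)\<^sup>2" by (simp only: of_real_eq_iff)
  then show ?thesis by simp
qed

lemma Cauchy_Schwarz: "norm (ip x y) \<le> norm x * norm y"
proof (cases "y = 0")
  case False
  define c where "c = ip x y / of_real ((norm y)\<^sup>2)"
  have "ip (x - smul c y) y = 0"
    using False by (simp add: ip_diff_left ip_smul_left ip_self c_def)
  then have "ip (x - smul c y) (smul c y) = 0" by (simp add: ip_smul_right)
  from norm_add_orthogonal[OF this] have "(norm (smul c y))\<^sup>2 \<le> (norm x)\<^sup>2" by simp
  then have "norm c * norm y \<le> norm x" by (simp add: norm_smul power2_le_iff_abs_le)
  moreover have "norm c = norm (ip x y) / (norm y)\<^sup>2" by (simp add: c_def norm_divide del: of_real_power)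
  ultimately show ?thesis using False by (simp add: power2_eq_square field_simps)
qed simp

lemma bounded_linear_ip: "bounded_linear (\<lambda>x. ip x y)"
  by (rule bounded_linear_intro[of _ "norm y"]) (simp_all add: ip_add_left ip_scaleR_left Cauchy_Schwarz)

lemma bounded_linear_smul: "bounded_linear (\<lambda>c. smul c x)"
proof (rule bounded_linear_intro[of _ "norm x"])
  show "smul (r *\<^sub>R c) x = r *\<^sub>R smul c x" for r c
    by (simp add: smul_of_real[symmetric] scaleR_conv_of_real scale_scale)
qed (simp_all add: norm_smul scale_left_distrib)

end

section \<open>Expansions in a complete orthonormal system\<close>

locale hilbert_basis = hilbert_space smul ip
  for smul :: "'k::real_or_complex \<Rightarrow> 'a::{banach,second_countable_topology} \<Rightarrow> 'a" and ip +
  fixes v :: "nat \<Rightarrow> 'a"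
  assumes cons: "complete_orthonormal_system ip v"
begin

lemma ip_basis: "ip (v j) (v k) = (if j = k then 1 else 0)"
  using cons by (auto simp: complete_orthonormal_system_def)

lemma norm_basis [simp]: "norm (v k) = 1"
proof -
  have "(of_real ((norm (v k))\<^sup>2) :: 'k) = of_real 1" using ip_self[of "v k"] ip_basis[of k k] by simp
  then have "(norm (v k))\<^sup>2 = 1" by (simp only: of_real_eq_iff)
  then show ?thesis by (metis norm_ge_zero power2_eq_1_iff neg_0_le_iff_le not_one_le_zero)
qed

text \<open>Completeness in the form used below: identities between vectors are verified coefficient
  by coefficient and so become scalar identities.\<close>

lemma eq_by_coeffs:
  assumes "\<And>k. ip x (v k) = ip y (v k)"
  shows "x = y"
proof -
  have "\<forall>k. ip (x - y) (v k) = 0" using assms by (simp add: ip_diff_left)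
  then show ?thesis using cons by (auto simp: complete_orthonormal_system_def)
qed

lemma ip_sum_left: "ip (sum f F) y = (\<Sum>k\<in>F. ip (f k) y)"
  using bounded_linear.linear[OF bounded_linear_ip] by (rule linear_sum)

lemma ip_finite_combination:
  assumes "finite F"
  shows "ip (\<Sum>k\<in>F. smul (c k) (v k)) (v j) = (if j \<in> F then c j else 0)"
proof -
  have "ip (\<Sum>k\<in>F. smul (c k) (v k)) (v j) = (\<Sum>k\<in>F. if k = j then c k else 0)"
    unfolding ip_sum_left by (intro sum.cong) (auto simp: ip_smul_left ip_basis)
  then show ?thesis using assms by simp
qed

lemma norm_finite_combination:
  assumes "finite F"
  shows "(norm (\<Sum>k\<in>F. smul (c k) (v k)))\<^sup>2 = (\<Sum>k\<in>F. (norm (c k))\<^sup>2)"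
  using assms
proof (induction F)
  case (insert j F)
  have "ip (\<Sum>k\<in>F. smul (c k) (v k)) (smul (c j) (v j)) = 0"
    using insert ip_finite_combination[of F c j] by (simp add: ip_smul_right)
  then have "ip (smul (c j) (v j)) (\<Sum>k\<in>F. smul (c k) (v k)) = 0" by (rule ip_eq_0_commute)
  from norm_add_orthogonal[OF this] show ?case using insert by (simp add: norm_smul)
qed simp

text \<open>The existence half of the Riesz-Fischer theorem. The series need not converge
  absolutely, so the Cauchy criterion is checked with Pythagoras on blocks.\<close>

lemma synthesis_summable:
  assumes "summable (\<lambda>k. (norm (c k))\<^sup>2)"
  shows "summable (\<lambda>k. smul (c k) (v k))"
  unfolding summable_Cauchy
proof (intro allI impI)
  fix e :: real assume e: "0 < e"
  then obtain N where N: "\<And>m n. N \<le> m \<Longrightarrow> norm (\<Sum>k=m..<n. (norm (c k))\<^sup>2) < e\<^sup>2"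
    using assms unfolding summable_Cauchy by (meson zero_less_power)
  show "\<exists>N. \<forall>m\<ge>N. \<forall>n. norm (\<Sum>k=m..<n. smul (c k) (v k)) < e"
  proof (intro exI allI impI)
    fix m n assume "N \<le> m"
    then have "(norm (\<Sum>k=m..<n. smul (c k) (v k)))\<^sup>2 < e\<^sup>2"
      using N[of m n] by (simp add: norm_finite_combination sum_nonneg)
    then show "norm (\<Sum>k=m..<n. smul (c k) (v k)) < e" using e by (auto intro: power2_less_imp_less)
  qed
qed

lemma ip_synthesis:
  assumes "summable (\<lambda>k. (norm (c k))\<^sup>2)"
  shows "ip (\<Sum>k. smul (c k) (v k)) (v j) = c j"
proof -
  have "ip (\<Sum>k. smul (c k) (v k)) (v j) = (\<Sum>k. ip (smul (c k) (v k)) (v j))"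
    by (rule bounded_linear.suminf[OF bounded_linear_ip synthesis_summable[OF assms]])
  also have "\<dots> = (\<Sum>k\<in>{j}. ip (smul (c k) (v k)) (v j))"
    by (rule suminf_finite) (auto simp: ip_smul_left ip_basis)
  finally show ?thesis by (simp add: ip_smul_left ip_basis)
qed

lemma norm_synthesis_tail:
  assumes "summable (\<lambda>k. (norm (c k))\<^sup>2)"
  shows "(norm ((\<Sum>k. smul (c k) (v k)) - (\<Sum>k<n. smul (c k) (v k))))\<^sup>2 = (\<Sum>k. (norm (c (k + n)))\<^sup>2)"
proof -
  have "(\<lambda>m. \<Sum>k<m. smul (c k) (v k)) \<longlonglongrightarrow> (\<Sum>k. smul (c k) (v k))"
    by (rule summable_LIMSEQ[OF synthesis_summable[OF assms]])
  then have "(\<lambda>m. (norm ((\<Sum>k<m+n. smul (c k) (v k)) - (\<Sum>k<n. smul (c k) (v k))))\<^sup>2)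
     \<longlonglongrightarrow> (norm ((\<Sum>k. smul (c k) (v k)) - (\<Sum>k<n. smul (c k) (v k))))\<^sup>2"
    by (intro tendsto_intros LIMSEQ_ignore_initial_segment)
  moreover have "(norm ((\<Sum>k<m+n. smul (c k) (v k)) - (\<Sum>k<n. smul (c k) (v k))))\<^sup>2 = (\<Sum>k<m. (norm (c (k + n)))\<^sup>2)" for m
  proof -
    have "(\<Sum>k<m+n. smul (c k) (v k)) = (\<Sum>k<n. smul (c k) (v k)) + (\<Sum>k=n..<m+n. smul (c k) (v k))"
      using sum.atLeastLessThan_concat[of 0 n "m+n" "\<lambda>k. smul (c k) (v k)"] by (simp add: atLeast0LessThan)
    then have "(\<Sum>k<m+n. smul (c k) (v k)) - (\<Sum>k<n. smul (c k) (v k)) = (\<Sum>k=n..<m+n. smul (c k) (v k))"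
      by simp
    then show ?thesis
      using sum.shift_bounds_nat_ivl[of "\<lambda>k. (norm (c k))\<^sup>2" 0 n m] by (simp add: norm_finite_combination atLeast0LessThan)
  qed
  moreover have "(\<lambda>m. \<Sum>k<m. (norm (c (k + n)))\<^sup>2) \<longlonglongrightarrow> (\<Sum>k. (norm (c (k + n)))\<^sup>2)"
    using assms by (intro summable_LIMSEQ) (simp add: summable_iff_shift[of "\<lambda>k. (norm (c k))\<^sup>2"])
  ultimately show ?thesis by (auto intro: LIMSEQ_unique)
qed

lemma Bessel_summable: "summable (\<lambda>k. (norm (ip x (v k)))\<^sup>2)"
proof (rule bounded_imp_summable)
  fix n
  define P where "P = (\<Sum>k\<le>n. smul (ip x (v k)) (v k))"
  have z: "ip (v j) (x - P) = 0" if "j \<le> n" for j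
  proof (rule ip_eq_0_commute)
    show "ip (x - P) (v j) = 0" unfolding P_def ip_diff_left
      using that by (subst ip_finite_combination) auto
  qed
  have "ip P (x - P) = 0"
    unfolding P_def[symmetric] by (subst P_def) (simp add: ip_sum_left ip_smul_left z)
  from norm_add_orthogonal[OF this] have "(norm P)\<^sup>2 \<le> (norm x)\<^sup>2" by simp
  then show "(\<Sum>k\<le>n. (norm (ip x (v k)))\<^sup>2) \<le> (norm x)\<^sup>2"
    unfolding P_def by (simp add: norm_finite_combination)
qed simp

text \<open>The majorant is only square summable, so the Weierstrass test for norms does not apply.
  Orthogonality gives the exact norm of a tail, and the tails of the squared majorant make the
  convergence uniform.\<close>

lemma continuous_on_synthesis:
  fixes c :: "real \<Rightarrow> nat \<Rightarrow> 'k"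
  assumes c: "\<And>k. continuous_on S (\<lambda>t. c t k)" and b: "\<And>t k. t \<in> S \<Longrightarrow> norm (c t k) \<le> b k"
    and sb: "summable (\<lambda>k. (b k)\<^sup>2)"
  shows "continuous_on S (\<lambda>t. \<Sum>k. smul (c t k) (v k))"
proof -
  have sq: "(norm (c t k))\<^sup>2 \<le> (b k)\<^sup>2" if "t \<in> S" for t k using b[OF that] by (intro power_mono) auto
  have sc: "summable (\<lambda>k. (norm (c t k))\<^sup>2)" if "t \<in> S" for t
    using sq[OF that] by (intro summable_comparison_test'[OF sb, of 0]) auto
  have "uniform_limit S (\<lambda>n t. \<Sum>k<n. smul (c t k) (v k)) (\<lambda>t. \<Sum>k. smul (c t k) (v k)) sequentially"
  proof (rule uniform_limitI)
    fix e :: real assume e: "0 < e"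
    obtain N where N: "\<And>n. N \<le> n \<Longrightarrow> norm (\<Sum>k. (b (k + n))\<^sup>2) < e\<^sup>2"
      using suminf_exist_split[OF _ sb, of "e\<^sup>2"] e by auto
    show "\<forall>\<^sub>F n in sequentially. \<forall>t\<in>S. dist (\<Sum>k<n. smul (c t k) (v k)) (\<Sum>k. smul (c t k) (v k)) < e"
    proof (rule eventually_sequentiallyI, rule ballI)
      fix n t assume n: "N \<le> n" and t: "t \<in> S"
      have "(dist (\<Sum>k<n. smul (c t k) (v k)) (\<Sum>k. smul (c t k) (v k)))\<^sup>2 = (\<Sum>k. (norm (c t (k + n)))\<^sup>2)"
        using norm_synthesis_tail[OF sc[OF t], of n] by (simp add: dist_norm norm_minus_commute)
      also have "\<dots> \<le> (\<Sum>k. (b (k + n))\<^sup>2)"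
        using sc[OF t] sb sq[OF t]
        by (intro suminf_le) (simp_all add: summable_iff_shift[of "\<lambda>k. (norm (c t k))\<^sup>2"] summable_iff_shift[of "\<lambda>k. (b k)\<^sup>2"])
      also have "\<dots> < e\<^sup>2" using N[OF n] by simp
      finally show "dist (\<Sum>k<n. smul (c t k) (v k)) (\<Sum>k. smul (c t k) (v k)) < e"
        using e by (auto intro: power2_less_imp_less)
    qed
  qed
  then show ?thesis
    by (rule uniform_limit_theorem[rotated])
      (auto intro!: always_eventually continuous_on_sum bounded_linear.continuous_on[OF bounded_linear_smul] c)
qed

end

section \<open>The forward and the inverse problem\<close>

text \<open>Bounded linear maps commute with the Bochner integral. Applied to a coefficient
  functional, this reduces the vector-valued Caputo derivative to scalar ones.\<close>

lemma caputo_integral_bounded_linear: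
  fixes u :: "real \<Rightarrow> 'b::{banach,second_countable_topology}" and f :: "'b \<Rightarrow> 'c::{banach,second_countable_topology}"
  assumes f: "bounded_linear f" and i: "set_integrable lborel {0..t} (caputo_integrand \<rho> u t)"
  shows "caputo_integral \<rho> (\<lambda>x. f (u x)) t = f (caputo_integral \<rho> u t)"
proof -
  interpret f: bounded_linear f by (rule f)
  have "f (caputo_integral \<rho> u t) = (\<integral>x. f (indicator {0..t} x *\<^sub>R caputo_integrand \<rho> u t x) \<partial>lborel)"
    using i unfolding caputo_integral_def set_lebesgue_integral_def set_integrable_def
    by (rule integral_bounded_linear[OF f, symmetric])
  also have "\<dots> = caputo_integral \<rho> (\<lambda>x. f (u x)) t"
    by (simp add: caputo_integral_def set_lebesgue_integral_def caputo_integrand_def f.scaleR f.diff)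
  finally show ?thesis by simp
qed

locale fractional_problem = hilbert_basis smul ip v
  for smul :: "'k::real_or_complex \<Rightarrow> 'a::{banach,second_countable_topology} \<Rightarrow> 'a" and ip v +
  fixes lam :: "nat \<Rightarrow> real" and \<sigma> \<rho> T :: real and \<phi> :: 'a
  assumes lam_pos: "\<And>k. 0 < lam k" and \<rho>: "0 < \<rho>" "\<rho> < 1" and T: "0 < T"
begin

definition mu :: "nat \<Rightarrow> real" where "mu k = lam k powr \<sigma>"

definition relax :: "nat \<Rightarrow> real \<Rightarrow> real" where "relax k t = mittag_leffler \<rho> (- mu k * t powr \<rho>)"

definition sol :: "real \<Rightarrow> 'a" where
  "sol t = (\<Sum>k. smul (relax k t *\<^sub>R ip \<phi> (v k)) (v k))"

text \<open>The candidate for the image of \<open>sol t\<close> under the operator power, with its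
  own series so that continuity can be studied independently of the domain. At \<open>t = 0\<close>
  the coefficients may fail to be square summable, so it is meaningful for positive times.\<close>

definition Asol :: "real \<Rightarrow> 'a" where
  "Asol t = (\<Sum>k. smul ((mu k * relax k t) *\<^sub>R ip \<phi> (v k)) (v k))"

lemma mu_pos: "0 < mu k"
  using lam_pos[of k] by (simp add: mu_def)

lemma relax_nonneg: "0 \<le> t \<Longrightarrow> 0 \<le> relax k t"
  unfolding relax_def by (rule mittag_leffler_nonneg[OF \<rho> mu_pos])

lemma relax_le_1: "0 \<le> t \<Longrightarrow> relax k t \<le> 1"
  unfolding relax_def by (rule mittag_leffler_le_1[OF \<rho> mu_pos])

lemma relax_0 [simp]: "relax k 0 = 1"
  by (simp add: relax_def mittag_leffler_0)

lemma relax_continuous: "continuous_on {0..} (relax k)"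
  unfolding relax_def by (rule continuous_on_mittag_leffler_time[OF \<rho> mu_pos])

text \<open>A bound independent of k. It expresses smoothing: the initial value is an arbitrary
  vector, yet at positive times the solution lies in the domain of the operator power. The negative
  power of \<open>a\<close> reflects the singularity at 0.\<close>

lemma mu_relax_bound:
  assumes "0 < a" "a \<le> t"
  shows "\<bar>mu k * relax k t\<bar> \<le> a powr (- \<rho>) / Gamma (2 - \<rho>)"
proof -
  have G: "0 < Gamma (2 - \<rho>)" using \<rho> by simp
  have "mu k * relax k t \<le> t powr (- \<rho>) / Gamma (2 - \<rho>)"
    unfolding relax_def using assms by (intro mittag_leffler_decay \<rho> mu_pos) auto
  also have "\<dots> \<le> a powr (- \<rho>) / Gamma (2 - \<rho>)"
    using assms \<rho> G by (intro divide_right_mono powr_mono2') auto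
  finally show ?thesis using mu_pos[of k] relax_nonneg[of t k] assms by simp
qed

lemma scaled_coeff_summable:
  assumes "\<And>k. \<bar>r k\<bar> \<le> B"
  shows "summable (\<lambda>k. (norm (r k *\<^sub>R ip x (v k)))\<^sup>2)"
proof (rule summable_comparison_test'[of _ 0])
  show "summable (\<lambda>k. B\<^sup>2 * (norm (ip x (v k)))\<^sup>2)" by (intro summable_mult Bessel_summable)
  show "norm ((norm (r k *\<^sub>R ip x (v k)))\<^sup>2) \<le> B\<^sup>2 * (norm (ip x (v k)))\<^sup>2" for k
    using power_mono[OF assms[of k], of 2] by (simp add: power_mult_distrib mult_right_mono)
qed

lemma sol_coeff: "0 \<le> t \<Longrightarrow> ip (sol t) (v k) = relax k t *\<^sub>R ip \<phi> (v k)"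
  unfolding sol_def by (intro ip_synthesis scaled_coeff_summable[of _ 1]) (simp add: relax_nonneg relax_le_1)

lemma Asol_coeff: "0 < t \<Longrightarrow> ip (Asol t) (v k) = (mu k * relax k t) *\<^sub>R ip \<phi> (v k)"
  unfolding Asol_def by (intro ip_synthesis scaled_coeff_summable[OF mu_relax_bound[OF _ order_refl]])

lemma sol_0: "sol 0 = \<phi>"
  by (rule eq_by_coeffs) (simp add: sol_coeff)

lemma sol_continuous: "continuous_on {0..} sol"
  unfolding sol_def
proof (rule continuous_on_synthesis)
  show "summable (\<lambda>k. (norm (ip \<phi> (v k)))\<^sup>2)" by (rule Bessel_summable)
  show "norm (relax k t *\<^sub>R ip \<phi> (v k)) \<le> norm (ip \<phi> (v k))" if "t \<in> {0..}" for t k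
    using relax_nonneg[of t k] relax_le_1[of t k] that by (simp add: mult_left_le_one_le)
qed (intro continuous_intros relax_continuous)

lemma Asol_continuous:
  assumes a: "0 < a"
  shows "continuous_on {a..} Asol"
  unfolding Asol_def
proof (rule continuous_on_synthesis)
  let ?B = "a powr (- \<rho>) / Gamma (2 - \<rho>)"
  show "summable (\<lambda>k. (?B * norm (ip \<phi> (v k)))\<^sup>2)"
    unfolding power_mult_distrib by (intro summable_mult Bessel_summable)
  show "norm ((mu k * relax k t) *\<^sub>R ip \<phi> (v k)) \<le> ?B * norm (ip \<phi> (v k))" if "t \<in> {a..}" for t k
    using mu_relax_bound[OF a, of t k] that unfolding norm_scaleR by (intro mult_right_mono) auto
  show "continuous_on {a..} (\<lambda>t. (mu k * relax k t) *\<^sub>R ip \<phi> (v k))" for k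
    by (intro continuous_intros continuous_on_subset[OF relax_continuous]) (use a in auto)
qed

lemma sol_in_pow_domain: "0 < t \<Longrightarrow> sol t \<in> pow_domain ip v lam \<sigma>"
proof -
  assume t: "0 < t"
  have "lam k powr (2 * \<sigma>) * (norm (ip (sol t) (v k)))\<^sup>2 = (norm ((mu k * relax k t) *\<^sub>R ip \<phi> (v k)))\<^sup>2" for k
  proof -
    have "lam k powr (2 * \<sigma>) = (mu k)\<^sup>2" by (simp add: mu_def power2_eq_square powr_add[symmetric])
    then show ?thesis using t by (simp add: sol_coeff abs_mult power_mult_distrib)
  qed
  then show ?thesis
    unfolding pow_domain_def mem_Collect_eq
    using scaled_coeff_summable[OF mu_relax_bound[OF t order_refl], where x=\<phi>] by simp
qed

lemma pow_operator_sol: "0 < t \<Longrightarrow> pow_operator smul ip v lam \<sigma> (sol t) = Asol t"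
  unfolding pow_operator_def Asol_def by (simp add: sol_coeff mu_def scaleR_conv_of_real mult.assoc)

lemma caputo_integral_sol_coeff:
  assumes t: "0 < t"
  shows "ip (caputo_integral \<rho> sol t) (v k) = (- (mu k * Gamma (1 - \<rho>) * integral {0..t} (relax k))) *\<^sub>R ip \<phi> (v k)"
proof -
  have c: "continuous_on {0..t} sol" "continuous_on {0..t} (relax k)"
    by (rule continuous_on_subset[OF sol_continuous], simp) (rule continuous_on_subset[OF relax_continuous], simp)
  have "ip (caputo_integral \<rho> sol t) (v k) = caputo_integral \<rho> (\<lambda>x. ip (sol x) (v k)) t"
    using t by (intro caputo_integral_bounded_linear[symmetric] bounded_linear_ip caputo_integrand_integrable \<rho> c) auto
  also have "\<dots> = (\<integral>x. (indicator {0..t} x *\<^sub>R ((t - x) powr (- \<rho>) * (relax k x - 1))) *\<^sub>R ip \<phi> (v k) \<partial>lborel)"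
    unfolding caputo_integral_def set_lebesgue_integral_def
    by (intro Bochner_Integration.integral_cong)
      (auto simp: caputo_integrand_eq sol_coeff indicator_def algebra_simps)
  also have "\<dots> = (LINT x:{0..t}|lborel. (t - x) powr (- \<rho>) * (relax k x - 1)) *\<^sub>R ip \<phi> (v k)"
  proof -
    have "set_integrable lborel {0..t} (\<lambda>x. (t - x) powr (- \<rho>) * (relax k x - 1))"
      using kernel_set_integrable[of "1 - \<rho>" t "\<lambda>x. relax k x - 1"] \<rho> t c(2) by (simp add: continuous_intros)
    then show ?thesis unfolding set_lebesgue_integral_def set_integrable_def by (intro integral_scaleR_left)
  qed
  also have "(LINT x:{0..t}|lborel. (t - x) powr (- \<rho>) * (relax k x - 1)) = - (mu k * Gamma (1 - \<rho>) * (LINT x:{0..t}|lborel. relax k x))"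
    using mittag_leffler_caputo[OF \<rho> t, of "- mu k"] by (simp add: relax_def)
  also have "(LINT x:{0..t}|lborel. relax k x) = integral {0..t} (relax k)"
    by (intro set_borel_integral_eq_integral borel_integrable_atLeastAtMost' c)
  finally show ?thesis .
qed

text \<open>Starting at a positive time keeps the integrand continuous, and the constant at
  \<open>a\<close> disappears on differentiation. As the identity is checked on coefficients, no
  series has to be differentiated term by term.\<close>

lemma caputo_integral_sol_diff:
  assumes a: "0 < a" "a \<le> t"
  shows "caputo_integral \<rho> sol t = caputo_integral \<rho> sol a - Gamma (1 - \<rho>) *\<^sub>R integral {a..t} Asol"
proof (rule eq_by_coeffs)
  fix k
  have ci: "continuous_on {a..t} Asol" using Asol_continuous[OF a(1)] by (auto elim: continuous_on_subset)
  have rc: "continuous_on {0..t} (relax k)" by (rule continuous_on_subset[OF relax_continuous]) auto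
  have "ip (integral {a..t} Asol) (v k) = integral {a..t} (\<lambda>s. ip (Asol s) (v k))"
    using integral_linear[OF integrable_continuous_interval[OF ci] bounded_linear_ip[of "v k"]]
    by (simp add: o_def)
  also have "\<dots> = integral {a..t} (\<lambda>s. relax k s *\<^sub>R (mu k *\<^sub>R ip \<phi> (v k)))"
    using a by (intro integral_cong) (simp add: Asol_coeff mult.commute)
  also have "\<dots> = integral {a..t} (relax k) *\<^sub>R (mu k *\<^sub>R ip \<phi> (v k))"
    by (intro integral_unique has_integral_scaleR_left integrable_integral integrable_continuous_interval continuous_on_subset[OF rc]) (use a in auto)
  finally have 1: "ip (integral {a..t} Asol) (v k) = integral {a..t} (relax k) *\<^sub>R (mu k *\<^sub>R ip \<phi> (v k))" .
  have 2: "integral {0..t} (relax k) = integral {0..a} (relax k) + integral {a..t} (relax k)"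
    using a by (intro Henstock_Kurzweil_Integration.integral_combine[symmetric] integrable_continuous_interval rc) auto
  show "ip (caputo_integral \<rho> sol t) (v k) = ip (caputo_integral \<rho> sol a - Gamma (1 - \<rho>) *\<^sub>R integral {a..t} Asol) (v k)"
    using a by (simp add: caputo_integral_sol_coeff ip_diff_left ip_scaleR_left 1 2 algebra_simps)
qed

lemma caputo_integral_sol_derivative:
  assumes t: "t \<in> {0<..T}"
  shows "(caputo_integral \<rho> sol has_vector_derivative - Gamma (1 - \<rho>) *\<^sub>R Asol t) (at t within {0<..T})"
proof -
  \<comment> \<open>Any positive number below t would do: near t the sets \<open>{a..T}\<close> and
    \<open>{0<..T}\<close> have the same within-filter.\<close>
  define a where "a = t / 2"
  have a: "0 < a" "a < t" using t by (auto simp: a_def)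
  have c: "continuous_on {a..T} Asol" using Asol_continuous[OF a(1)] by (auto elim: continuous_on_subset)
  have "((\<lambda>s. integral {a..s} Asol) has_vector_derivative Asol t) (at t within {a..T})"
    using t a by (intro integral_has_vector_derivative c) auto
  then have "((\<lambda>s. caputo_integral \<rho> sol a - Gamma (1 - \<rho>) *\<^sub>R integral {a..s} Asol) has_vector_derivative (0 - Gamma (1 - \<rho>) *\<^sub>R Asol t)) (at t within {a..T})"
    by (intro has_vector_derivative_diff has_vector_derivative_const bounded_linear.has_vector_derivative[OF bounded_linear_scaleR_right])
  then have "(caputo_integral \<rho> sol has_vector_derivative (0 - Gamma (1 - \<rho>) *\<^sub>R Asol t)) (at t within {a..T})"
    using t a by (elim has_vector_derivative_transform[rotated 2]) (auto intro: caputo_integral_sol_diff[OF a(1)])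
  moreover have "at t within {a..T} = at t within {0<..T}"
    using a by (intro at_within_nhd[of _ "{a<..}"]) auto
  ultimately show ?thesis by simp
qed

text \<open>\<open>vector_derivative\<close> is determined by a choice, which is unique only where
  the filter is nontrivial. This includes \<open>t = T\<close>, where the derivative is
  one-sided.\<close>

lemma within_nontrivial: "t \<in> {0<..T} \<Longrightarrow> at t within {0<..T} \<noteq> bot"
proof -
  assume t: "t \<in> {0<..T}"
  then have "t islimpt {0..t}" by (simp add: islimpt_Icc)
  then have "t islimpt ({0..t} - {0})" using islimpt_insert[of t 0 "{0..t} - {0}"] t by (simp add: insert_absorb)
  then have "t islimpt {0<..T}" by (rule islimpt_subset) (use t in auto)
  then show ?thesis by (simp add: trivial_limit_within)
qed

lemma forward_solution_sol: "forward_solution smul ip v lam \<sigma> T \<rho> \<phi> (restrict sol {0..T})"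
proof -
  define u where "u = restrict sol {0..T}"
  have u: "u t = sol t" if "t \<in> {0..T}" for t using that by (simp add: u_def)
  have ci: "caputo_integrand \<rho> u t x = caputo_integrand \<rho> sol t x" if "x \<in> {0..t}" "t \<le> T" for t x
    using that T by (simp add: caputo_integrand_def u)
  have cI: "caputo_integral \<rho> u t = caputo_integral \<rho> sol t" if "t \<le> T" for t
    unfolding caputo_integral_def by (intro set_lebesgue_integral_cong ballI impI allI) (auto simp: ci that)
  have int: "set_integrable lborel {0..t} (caputo_integrand \<rho> u t)" if "t \<in> {0<..T}" for t
  proof -
    have "set_integrable lborel {0..t} (caputo_integrand \<rho> sol t)"
      using that by (intro caputo_integrand_integrable \<rho> continuous_on_subset[OF sol_continuous]) auto
    moreover have "set_integrable lborel {0..t} (caputo_integrand \<rho> u t) = set_integrable lborel {0..t} (caputo_integrand \<rho> sol t)"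
      using that by (intro set_integrable_cong ci) auto
    ultimately show ?thesis by simp
  qed
  have der: "(caputo_integral \<rho> u has_vector_derivative - Gamma (1 - \<rho>) *\<^sub>R Asol t) (at t within {0<..T})" if "t \<in> {0<..T}" for t
    by (rule has_vector_derivative_transform[OF that _ caputo_integral_sol_derivative[OF that]]) (simp add: cI)
  have "0 < Gamma (1 - \<rho>)" using \<rho> by (intro Gamma_real_pos) simp
  then have G: "Gamma (1 - \<rho>) \<noteq> 0" by linarith
  have cd: "caputo_derivative T \<rho> u t = - Asol t" if "t \<in> {0<..T}" for t
    unfolding caputo_derivative_def vector_derivative_within[OF within_nontrivial[OF that] der[OF that]]
    using G by simp
  have Ac: "continuous_on {0<..T} Asol"
    unfolding continuous_on_eq_continuous_within
  proof
    fix t assume t: "t \<in> {0<..T}"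
    have "isCont Asol t"
      by (rule continuous_on_interior[OF Asol_continuous[of "t/2"]]) (use t in \<open>auto intro: interiorI[of "{t/2<..}"]\<close>)
    then show "continuous (at t within {0<..T}) Asol" by (rule continuous_at_imp_continuous_at_within)
  qed
  show ?thesis
    unfolding forward_solution_def u_def[symmetric]
  proof (intro conjI ballI)
    show "continuous_on {0..T} u"
    proof -
      have "continuous_on {0..T} u \<longleftrightarrow> continuous_on {0..T} sol" by (intro continuous_on_cong u refl)
      then show ?thesis using continuous_on_subset[OF sol_continuous, of "{0..T}"] by simp
    qed
    show "caputo_exists T \<rho> u t" if "t \<in> {0<..T}" for t
      unfolding caputo_exists_def using int der[OF that] by blast
    show "continuous_on {0<..T} (caputo_derivative T \<rho> u)"
    proof -
      have "continuous_on {0<..T} (caputo_derivative T \<rho> u) \<longleftrightarrow> continuous_on {0<..T} (\<lambda>t. - Asol t)"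
        by (intro continuous_on_cong cd refl)
      then show ?thesis using continuous_on_minus[OF Ac] by simp
    qed
    show "u t \<in> pow_domain ip v lam \<sigma>" if "t \<in> {0<..T}" for t
      using that by (simp add: u sol_in_pow_domain)
    show "continuous_on {0<..T} (\<lambda>t. pow_operator smul ip v lam \<sigma> (u t))"
    proof -
      have "continuous_on {0<..T} (\<lambda>t. pow_operator smul ip v lam \<sigma> (u t)) \<longleftrightarrow> continuous_on {0<..T} Asol"
        by (intro continuous_on_cong refl) (simp add: u pow_operator_sol)
      then show ?thesis using Ac by simp
    qed
    show "caputo_derivative T \<rho> u t + pow_operator smul ip v lam \<sigma> (u t) = 0" if "t \<in> {0<..T}" for t
      using that by (simp add: cd u pow_operator_sol)
    show "u 0 = \<phi>" using T by (simp add: u sol_0)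
  qed
qed

lemma pow_operator_coeff:
  assumes "x \<in> pow_domain ip v lam \<sigma>"
  shows "ip (pow_operator smul ip v lam \<sigma> x) (v k) = mu k *\<^sub>R ip x (v k)"
proof -
  have "(norm (of_real (mu k) * ip x (v k)))\<^sup>2 = lam k powr (2 * \<sigma>) * (norm (ip x (v k)))\<^sup>2" for k
    by (simp add: norm_mult power_mult_distrib mu_def) (simp add: power2_eq_square powr_add[symmetric])
  then have "summable (\<lambda>k. (norm (of_real (mu k) * ip x (v k)))\<^sup>2)"
    using assms by (simp add: pow_domain_def)
  then show ?thesis
    unfolding pow_operator_def mu_def[symmetric] by (simp add: ip_synthesis scaleR_conv_of_real)
qed

text \<open>A coefficient functional turns the equation into the scalar one for the eigenvalue
  \<open>mu k\<close>. The integrability contained in \<open>caputo_exists\<close> lets the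
  functional pass under the integral, and the domain condition identifies the coefficients of the
  operator power.\<close>

lemma forward_solution_coeff:
  assumes sol: "forward_solution smul ip v lam \<sigma> T \<rho> \<phi> u" and t: "t \<in> {0..T}"
  shows "ip (u t) (v k) = relax k t *\<^sub>R ip \<phi> (v k)"
proof -
  define y where "y = (\<lambda>t. ip (u t) (v k))"
  have cont: "continuous_on {0..T} u" and ex: "\<And>t. t \<in> {0<..T} \<Longrightarrow> caputo_exists T \<rho> u t"
    and dom: "\<And>t. t \<in> {0<..T} \<Longrightarrow> u t \<in> pow_domain ip v lam \<sigma>"
    and eq: "\<And>t. t \<in> {0<..T} \<Longrightarrow> caputo_derivative T \<rho> u t + pow_operator smul ip v lam \<sigma> (u t) = 0"
    and u0: "u 0 = \<phi>"
    using sol unfolding forward_solution_def by auto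
  have "0 < Gamma (1 - \<rho>)" using \<rho> by (intro Gamma_real_pos) simp
  then have G: "Gamma (1 - \<rho>) \<noteq> 0" by linarith
  have der: "(caputo_integral \<rho> y has_vector_derivative (- (mu k * Gamma (1 - \<rho>))) *\<^sub>R y t) (at t within {0<..T})"
    if t: "t \<in> {0<..T}" for t
  proof -
    obtain d where d: "(caputo_integral \<rho> u has_vector_derivative d) (at t within {0<..T})"
      and int: "\<And>s. s \<in> {0<..T} \<Longrightarrow> set_integrable lborel {0..s} (caputo_integrand \<rho> u s)"
      using ex[OF t] unfolding caputo_exists_def by auto
    have "caputo_derivative T \<rho> u t = (1 / Gamma (1 - \<rho>)) *\<^sub>R d"
      unfolding caputo_derivative_def vector_derivative_within[OF within_nontrivial[OF t] d] ..
    then have "(1 / Gamma (1 - \<rho>)) *\<^sub>R d = - pow_operator smul ip v lam \<sigma> (u t)"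
      using eq[OF t] by (simp add: eq_neg_iff_add_eq_0)
    then have "d = Gamma (1 - \<rho>) *\<^sub>R (- pow_operator smul ip v lam \<sigma> (u t))"
      using G by (metis divide_self_if scaleR_one scaleR_scaleR times_divide_eq_right mult.right_neutral)
    then have "ip d (v k) = (- (mu k * Gamma (1 - \<rho>))) *\<^sub>R y t"
      using pow_operator_coeff[OF dom[OF t], of k] by (simp add: ip_scaleR_left y_def mult.commute)
    moreover have "((\<lambda>s. ip (caputo_integral \<rho> u s) (v k)) has_vector_derivative ip d (v k)) (at t within {0<..T})"
      by (rule bounded_linear.has_vector_derivative[OF bounded_linear_ip d])
    ultimately show ?thesis
      using caputo_integral_bounded_linear[OF bounded_linear_ip int]
      by (intro has_vector_derivative_transform[OF t, of "caputo_integral \<rho> y" "\<lambda>s. ip (caputo_integral \<rho> u s) (v k)"])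
        (auto simp: y_def)
  qed
  have "y t = mittag_leffler \<rho> (- mu k * t powr \<rho>) *\<^sub>R y 0"
  proof (rule caputo_scalar_unique[OF \<rho> T _ der t])
    show "continuous_on {0..T} y"
      unfolding y_def by (rule bounded_linear.continuous_on[OF bounded_linear_ip cont])
  qed
  then show ?thesis by (simp add: y_def relax_def u0)
qed

lemma forward_solution_unique:
  assumes "forward_solution smul ip v lam \<sigma> T \<rho> \<phi> u" "u \<in> extensional {0..T}"
  shows "u = restrict sol {0..T}"
proof (rule extensionalityI[OF assms(2) restrict_extensional])
  fix t assume t: "t \<in> {0..T}"
  then have "u t = sol t"
    by (intro eq_by_coeffs) (simp add: forward_solution_coeff[OF assms(1)] sol_coeff)
  then show "u t = restrict sol {0..T} t" using t by simp
qed

end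

theorem theorem2p5:
  fixes \<rho>0 lam1 :: real
  assumes "0 < \<rho>0" and "\<rho>0 < 1" and "0 < lam1"
  shows "\<exists>T0>0.
    \<forall>(smul :: 'k::real_or_complex \<Rightarrow> 'a::{banach,second_countable_topology} \<Rightarrow> 'a)
      (ip :: 'a \<Rightarrow> 'a \<Rightarrow> 'k) (D :: 'a set) (A :: 'a \<Rightarrow> 'a) (v :: nat \<Rightarrow> 'a) (lam :: nat \<Rightarrow> real)
      (\<phi> :: 'a) (\<sigma> :: real) (T :: real) (t0 :: real) (d0 :: real).
      operator_setting smul ip D A v lam \<longrightarrow> lam 0 = lam1 \<longrightarrow> 0 < \<sigma> \<longrightarrow>
      T0 \<le> t0 \<longrightarrow> t0 \<le> T \<longrightarrow>
      ((\<exists>!p. p \<in> first_inverse_solutions smul ip v lam \<sigma> \<rho>0 T \<phi> t0 d0) \<longleftrightarrow>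
       exp (- (lam1 powr \<sigma>) * t0) < d0 / norm (ip \<phi> (v 0)) \<and>
       d0 / norm (ip \<phi> (v 0)) \<le> mittag_leffler \<rho>0 (- (lam1 powr \<sigma>) * t0 powr \<rho>0))"
proof (intro exI[of _ 3] conjI allI impI)
  fix smul :: "'k \<Rightarrow> 'a \<Rightarrow> 'a" and ip :: "'a \<Rightarrow> 'a \<Rightarrow> 'k" and D :: "'a set" and A :: "'a \<Rightarrow> 'a"
    and v :: "nat \<Rightarrow> 'a" and lam :: "nat \<Rightarrow> real" and \<phi> :: 'a and \<sigma> T t0 d0 :: real
  \<comment> \<open>The witness 3 is just a convenient number above the threshold 2 for monotonicity
    in the order; it depends neither on \<open>lam1\<close> nor on \<rho>0.\<close>
  assume os: "operator_setting smul ip D A v lam" and lam0: "lam 0 = lam1" and "0 < \<sigma>"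
    and t0: "3 \<le> t0" and t0T: "t0 \<le> T"
  let ?S = "first_inverse_solutions smul ip v lam \<sigma> \<rho>0 T \<phi> t0 d0"
  let ?N = "norm (ip \<phi> (v 0))"
  define l where "l = lam1 powr \<sigma>"
  define f where "f = (\<lambda>\<rho>. mittag_leffler \<rho> (- l * t0 powr \<rho>))"
  have l: "0 < l" using assms by (simp add: l_def)
  have lam_pos: "0 < lam k" for k
    using os unfolding operator_setting_def mono_def by (meson less_le_trans zero_le)
  have hs: "hilbert_space smul ip" and cons: "complete_orthonormal_system ip v"
    using os unfolding operator_setting_def by auto
  have fp: "fractional_problem smul ip v lam \<rho> T" if "\<rho>0 \<le> \<rho>" "\<rho> < 1" for \<rho>
    using that assms t0 t0T hs cons lam_pos
    by (intro fractional_problem.intro hilbert_basis.intro hilbert_basis_axioms.intro fractional_problem_axioms.intro) auto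
  define U where "U = (\<lambda>\<rho>. restrict (fractional_problem.sol smul ip v lam \<sigma> \<rho> \<phi>) {0..T})"
  \<comment> \<open>For each order the function is forced to be \<open>U \<rho>\<close>, so solution
    pairs correspond to the orders that solve one scalar equation.\<close>
  have mem: "(u, \<rho>) \<in> ?S \<longleftrightarrow> \<rho>0 \<le> \<rho> \<and> \<rho> < 1 \<and> u = U \<rho> \<and> f \<rho> * ?N = d0" for u \<rho>
  proof (cases "\<rho>0 \<le> \<rho> \<and> \<rho> < 1")
    case True
    interpret fractional_problem smul ip v lam \<sigma> \<rho> T \<phi> using True by (intro fp) auto
    have n: "norm (ip (U \<rho> t0) (v 0)) = f \<rho> * ?N"
      using t0 t0T relax_nonneg[of t0 0] by (simp add: U_def sol_coeff f_def l_def relax_def mu_def lam0)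
    have "(u, \<rho>) \<in> ?S \<longleftrightarrow> (forward_solution smul ip v lam \<sigma> T \<rho> \<phi> u \<and> u \<in> extensional {0..T}) \<and> norm (ip (u t0) (v 0)) = d0"
      using True by (auto simp: first_inverse_solutions_def)
    also have "forward_solution smul ip v lam \<sigma> T \<rho> \<phi> u \<and> u \<in> extensional {0..T} \<longleftrightarrow> u = U \<rho>"
      unfolding U_def using forward_solution_unique forward_solution_sol restrict_extensional by metis
    finally show ?thesis using True n by auto
  qed (auto simp: first_inverse_solutions_def)
  have S: "(\<exists>!p. p \<in> ?S) \<longleftrightarrow> (\<exists>!\<rho>. \<rho>0 \<le> \<rho> \<and> \<rho> < 1 \<and> f \<rho> * ?N = d0)"
  proof
    assume "\<exists>!p. p \<in> ?S"
    then show "\<exists>!\<rho>. \<rho>0 \<le> \<rho> \<and> \<rho> < 1 \<and> f \<rho> * ?N = d0"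
      by (metis mem prod.inject surj_pair)
  next
    assume "\<exists>!\<rho>. \<rho>0 \<le> \<rho> \<and> \<rho> < 1 \<and> f \<rho> * ?N = d0"
    then obtain \<rho> where \<rho>: "\<rho>0 \<le> \<rho>" "\<rho> < 1" "f \<rho> * ?N = d0"
      and un: "\<And>r. \<rho>0 \<le> r \<Longrightarrow> r < 1 \<Longrightarrow> f r * ?N = d0 \<Longrightarrow> r = \<rho>" by metis
    show "\<exists>!p. p \<in> ?S"
    proof (rule ex1I[of _ "(U \<rho>, \<rho>)"])
      show "(U \<rho>, \<rho>) \<in> ?S" using \<rho> mem by simp
      show "p = (U \<rho>, \<rho>)" if "p \<in> ?S" for p
        using that un by (cases p) (auto simp: mem)
    qed
  qed
  show "(\<exists>!p. p \<in> ?S) \<longleftrightarrow> exp (- (lam1 powr \<sigma>) * t0) < d0 / ?N \<and>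
       d0 / ?N \<le> mittag_leffler \<rho>0 (- (lam1 powr \<sigma>) * t0 powr \<rho>0)"
  proof (cases "?N = 0")
    \<comment> \<open>The scalar equation reads \<open>0 = d0\<close> and thus holds for all
      admissible orders or for none; \<rho>0 and \<open>(\<rho>0 + 1) / 2\<close> are two different
      ones. On the other side \<open>d0 / 0 = 0\<close> does not exceed the exponential, so both
      sides of the equivalence are false.\<close>
    case True
    have "\<not> (\<exists>!\<rho>. \<rho>0 \<le> \<rho> \<and> \<rho> < 1 \<and> f \<rho> * ?N = d0)"
    proof
      assume "\<exists>!\<rho>. \<rho>0 \<le> \<rho> \<and> \<rho> < 1 \<and> f \<rho> * ?N = d0"
      then have "\<exists>!\<rho>. \<rho>0 \<le> \<rho> \<and> \<rho> < 1 \<and> 0 = d0" using True by simp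
      moreover have "\<rho>0 \<noteq> (\<rho>0 + 1) / 2" "\<rho>0 \<le> (\<rho>0 + 1) / 2" "(\<rho>0 + 1) / 2 < 1" using assms by auto
      ultimately show False using assms by (metis order_refl)
    qed
    then show ?thesis unfolding S using True by (simp add: not_less)
  next
    case False
    then have "(\<exists>!\<rho>. \<rho>0 \<le> \<rho> \<and> \<rho> < 1 \<and> f \<rho> * ?N = d0) \<longleftrightarrow> (\<exists>!\<rho>. \<rho>0 \<le> \<rho> \<and> \<rho> < 1 \<and> f \<rho> = d0 / ?N)"
      by (simp add: eq_divide_eq)
    also have "\<dots> \<longleftrightarrow> exp (- l * t0) < d0 / ?N \<and> d0 / ?N \<le> f \<rho>0"
      unfolding f_def using assms l t0 by (intro mittag_leffler_order_unique) auto
    finally show ?thesis unfolding S by (simp add: f_def l_def)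
  qed
qed simp

end
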